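(* Let $H$ be a Hopf algebra which is either finite-dimensional or cosemisimple, and let $(R,m,u,\delta,\varepsilon)$ be an $N$-dimensional pre-bialgebra in ${}_H^H\mathcal{YD}$ with cocycle $\xi$. Assume that $R$ is a thin coalgebra with $P(R)=Ky$, let $(H,g,\chi)$ be the Yetter-Drinfeld datum associated to $y$, let $q=\chi(g)$, and let $d_0=1_R,d_1=y,\ldots,d_{N-1}$ be a divided power basis of $R$ as described in the context. Set $Y:=y\otimes 1_H$ and $\Gamma:=1_R\otimes g$ in $R\#_\xi H$, and for $N$ even $x:=\xi(d_1\otimes d_{N/2-1})$. Powers of $y$ are taken in $R$, powers of $Y,\Gamma$ in $R\#_\xi H$. 1) Regardless of the parity of $N$, there exists $\lambda(N)\in K$ such that $$\xi(y\otimes y^{N-1})=\xi(y^2\otimes y^{N-2})=\cdots=\xi(y^{N-1}\otimes y)=\lambda(N)(1_H-g^N).$$ Moreover $(H,g,\chi,\lambda(N))$ is a compatible datum for $q$ and $Y^N=\lambda(N)(1_{R\#_\xi H}-\Gamma^N)$. 2) If either $N$ is odd, or $N$ is even and $x=0$ (e.g. $N/2$ is even or $H$ is cosemisimple), then for all $a,b\in\mathbb N$ $$\xi(y^a\otimes y^b)=\begin{cases}1_H & \text{if } a+b=0,\\ \lambda(N)(1_H-g^N) & \text{if } a+b=N,\ a\ne 0,\ b\neq 0,\\ 0&\text{otherwise,}\end{cases}$$ and $R=R_q(H,g,\chi)$ is a quantum line.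
   Context: $K$ is a field of characteristic $0$; everything is over $K$; $\mathbb N$ contains $0$. Yetter-Drinfeld modules. For a Hopf algebra $H$ with antipode $S$, an object $V$ of ${}_H^H\mathcal{YD}$ is a left $H$-module and left $H$-comodule (coaction $\rho(v)=\sum v_{\langle -1\rangle}\otimes v_{\langle 0\rangle}$) with $\rho(hv)=\sum h_{(1)}v_{\langle -1\rangle}S(h_{(3)})\otimes h_{(2)}v_{\langle 0\rangle}$. Tensor products carry the diagonal action and codiagonal coaction; the unit object is $K$; $c_{V,W}(v\otimes w)=\sum v_{\langle -1\rangle}w\otimes v_{\langle 0\rangle}$. If $(R,\delta,\varepsilon)$ is a coalgebra in ${}_H^H\mathcal{YD}$, with $\delta(r)=\sum r^{(1)}\otimes r^{(2)}$, then $R\otimes R$ is a coalgebra via $\delta_{R\otimes R}(r\otimes s)=\sum r^{(1)}\otimes r^{(2)}_{\langle -1\rangle}s^{(1)}\otimes r^{(2)}_{\langle 0\rangle}\otimes s^{(2)}$. Pre-bialgebra. A pre-bialgebra $(R,m,u,\delta,\varepsilon)$ in ${}_H^H\mathcal{YD}$ is a coalgebra $(R,\delta,\varepsilon)$ in ${}_H^H\mathcal{YD}$ with $K$-linear maps $m:R\otimes R\to R$, $u:K\to R$ (write $1_R=u(1)$) such that $h1_R=\varepsilon_H(h)1_R$, $\rho(1_R)=1_H\otimes 1_R$, $\delta(1_R)=1_R\otimes 1_R$, $\varepsilon(1_R)=1$, $h\,m(r\otimes s)=\sum m(h_{(1)}r\otimes h_{(2)}s)$, $\delta m=(m\otimes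 m)\delta_{R\otimes R}$, $\varepsilon m=\varepsilon\otimes\varepsilon$, $m(r\otimes 1_R)=r=m(1_R\otimes r)$. (Associativity and $H$-colinearity of $m$ are not required.) Cocycle. A cocycle for it is a $K$-linear map $\xi:R\otimes R\to H$ such that, with $m_H$ the multiplication of $H$, $\mu_R:H\otimes R\to R$ the action, $c_{R,H}(r\otimes h)=\sum r_{\langle -1\rangle}h\otimes r_{\langle 0\rangle}$ and $c_{H,R}(h\otimes r)=\sum h_{(1)}r\otimes h_{(2)}$: $\sum\xi(h_{(1)}r\otimes h_{(2)}s)=\sum h_{(1)}\xi(r\otimes s)S(h_{(2)})$; $\Delta_H\xi=(m_H\otimes\xi)(\xi\otimes\rho_{R\otimes R})\delta_{R\otimes R}$ and $\varepsilon_H\xi=\varepsilon\otimes\varepsilon$; $c_{R,H}(m\otimes\xi)\delta_{R\otimes R}=(m_H\otimes m)(\xi\otimes\rho_{R\otimes R})\delta_{R\otimes R}$; $m(R\otimes m)=m(R\otimes\mu_R)[(m\otimes\xi)\delta_{R\otimes R}\otimes R]$; $m_H(\xi\otimes H)[R\otimes(m\otimes\xi)\delta_{R\otimes R}]=m_H(\xi\otimes H)(R\otimes c_{H,R})[(m\otimes\xi)\delta_{R\otimes R}\otimes R]$; $\xi(r\otimes 1_R)=\xi(1_R\otimes r)=\varepsilon(r)1_H$. The bialgebra $R\#_\xi H$ is $R\otimes H$ with unit $1_R\otimes 1_H$, counit $\varepsilon\otimes\varepsilon_H$, $\Delta(r\# h)=\sum r^{(1)}\# r^{(2)}_{\langle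 -1\rangle}h_{(1)}\otimes r^{(2)}_{\langle 0\rangle}\# h_{(2)}$ and product $(r\# h)(s\# k)=\sum \widetilde m^0(r\otimes h_{(1)}s)\#\widetilde m^1(r\otimes h_{(1)}s)h_{(2)}k$, where $\sum\widetilde m^0(r\otimes s)\otimes\widetilde m^1(r\otimes s)=(m\otimes\xi)\delta_{R\otimes R}(r\otimes s)$. Thin. A coalgebra $C$ is thin if its coradical $C_0$ is one-dimensional and its space $P(C)$ of primitive elements is one-dimensional. Yetter-Drinfeld datum. For $q$ a primitive $\theta$-th root of unity, a Yetter-Drinfeld datum $(H,g,\chi)$ for $q$ consists of a group-like $g\in G(H)$ and a character (algebra map) $\chi:H\to K$ with $\chi(g)=q$ and $g\sum\chi(h_{(1)})h_{(2)}=\sum h_{(1)}\chi(h_{(2)})g$ for all $h\in H$. If $R$ is a finite-dimensional pre-bialgebra which is thin with $P(R)=Ky$, it is known that there are a primitive $\theta$-th root of unity $q$ ($2\le\theta\le\dim R$) and a Yetter-Drinfeld datum $(H,g,\chi)$ for $q$ with $\rho(y)=g\otimes y$ and $hy=\chi(h)y$; it is called the Yetter-Drinfeld datum associated to $y$. Divided power basis. $(n)_q=1+q+\cdots+q^{n-1}$, $(n)_q!=(1)_q\cdots(n)_q$, $\chi^n$ is the convolution power. One fixes a basis $d_0=1_R,d_1=y,\ldots,d_{N-1}$ of $R$ with $\delta(d_n)=\sum_{t=0}^n d_t\otimes d_{n-t}$, $gd_n=q^nd_n$, $hd_n=\chi^n(h)d_n$ for $h\in H$, and $yd_{n-1}=(n)_qd_n$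 for $1\le n\le N-1$ (such a basis is known to exist). It is known that in this situation $R$ is an associative algebra, $q$ has order $N$, $y^n=(n)_q!\,d_n$ for $0\le n\le N-1$, and $y^N=0$ (so $y^n=0$ for $n\geq N$). Compatible datum. For $q$ a primitive $N$-th root of unity, a compatible datum for $q$ is $(H,g,\chi,\lambda(N))$ with $(H,g,\chi)$ a Yetter-Drinfeld datum for $q$ and $\lambda(N)\in K$, where $\lambda(N)=0$ is required if $g^N=1_H$ or if $\chi^N(h)(1_H-g^N)\ne\sum h_{(1)}(1_H-g^N)S(h_{(2)})$ for some $h\in H$, and $\lambda(N)$ is arbitrary otherwise. Quantum line. For a Yetter-Drinfeld datum $(H,g,\chi)$ for a primitive $N$-th root of unity $q$, the quantum line $R_q(H,g,\chi)$ is the algebra $K[X]/(X^N)$, $y$ the class of $X$, with its unique structure of braided bialgebra in ${}_H^H\mathcal{YD}$ such that $hy=\chi(h)y$, $\rho(y)=g\otimes y$, $\delta(y)=y\otimes 1+1\otimes y$. *)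

theory Defs
  imports
    Complex_Main
    "HOL-Library.Function_Algebras"
    "HOL-Computational_Algebra.Polynomial"
begin

section \<open>Linear algebra and tensor products over a field\<close>

definition finite_dimensional :: "('k::field \<Rightarrow> 'v::ab_group_add \<Rightarrow> 'v) \<Rightarrow> bool" where
  "finite_dimensional s \<longleftrightarrow> (\<exists>B. finite B \<and> module.span s B = UNIV)"

definition bilinear_map ::
  "('k::field \<Rightarrow> 'v::ab_group_add \<Rightarrow> 'v) \<Rightarrow> ('k \<Rightarrow> 'w::ab_group_add \<Rightarrow> 'w) \<Rightarrow>
   ('k \<Rightarrow> 'u::ab_group_add \<Rightarrow> 'u) \<Rightarrow> ('v \<Rightarrow> 'w \<Rightarrow> 'u) \<Rightarrow> bool" where
  "bilinear_map sV sW sU f \<longleftrightarrow>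
     (\<forall>w. Vector_Spaces.linear sV sU (\<lambda>v. f v w)) \<and> (\<forall>v. Vector_Spaces.linear sW sU (f v))"

text \<open>
  The tensor product \<open>V \<otimes> W\<close> of two vector spaces over \<open>'k\<close>, whose scalar multiplications are
  \<open>sV\<close> and \<open>sW\<close>, is realised as the span of the pure tensors in the dual of the space of
  bilinear forms: \<open>v \<otimes> w\<close> is evaluation \<open>\<beta> \<mapsto> \<beta> v w\<close> (and is \<open>0\<close> on functions that are not
  bilinear). Over a field bilinear forms separate the elements of the tensor product, so that this
  is the usual tensor product. Addition is pointwise.
\<close>

type_synonym ('k, 'v, 'w) tensor = "('v \<Rightarrow> 'w \<Rightarrow> 'k) \<Rightarrow> 'k"

definition tscale :: "'k::field \<Rightarrow> ('k, 'v, 'w) tensor \<Rightarrow> ('k, 'v, 'w) tensor" where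
  "tscale c t = (\<lambda>\<beta>. c * t \<beta>)"

definition tens ::
  "('k::field \<Rightarrow> 'v::ab_group_add \<Rightarrow> 'v) \<Rightarrow> ('k \<Rightarrow> 'w::ab_group_add \<Rightarrow> 'w) \<Rightarrow>
   'v \<Rightarrow> 'w \<Rightarrow> ('k, 'v, 'w) tensor" where
  "tens sV sW v w = (\<lambda>\<beta>. if bilinear_map sV sW (*) \<beta> then \<beta> v w else 0)"

abbreviation tens_syntax  ("(_/ \<otimes>\<^bsub>_,_\<^esub> _)" [71, 0, 0, 71] 70) where
  "v \<otimes>\<^bsub>sV,sW\<^esub> w \<equiv> tens sV sW v w"

text \<open>The subspace \<open>A \<otimes> B\<close> of \<open>V \<otimes> W\<close>, for subspaces \<open>A\<close> and \<open>B\<close>.\<close>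

definition tensor_space ::
  "('k::field \<Rightarrow> 'v::ab_group_add \<Rightarrow> 'v) \<Rightarrow> ('k \<Rightarrow> 'w::ab_group_add \<Rightarrow> 'w) \<Rightarrow>
   'v set \<Rightarrow> 'w set \<Rightarrow> ('k, 'v, 'w) tensor set" where
  "tensor_space sV sW A B = module.span tscale {v \<otimes>\<^bsub>sV,sW\<^esub> w | v w. v \<in> A \<and> w \<in> B}"

text \<open>
  For \<open>t = \<Sum> v\<^sub>i \<otimes> w\<^sub>i\<close> in \<open>V \<otimes> W\<close> and a bilinear \<open>F\<close>, this is \<open>\<Sum> F v\<^sub>i w\<^sub>i\<close>, i.e. the
  linear map on \<open>V \<otimes> W\<close> induced by \<open>F\<close>; it does not depend on the chosen representation of \<open>t\<close>.
  It is used to write Sweedler sums: \<open>\<Sum> F c\<^sub>1 c\<^sub>2\<close> is \<open>tlift s s (\<delta> c) (\<lambda>c1 c2. F c1 c2)\<close>.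
  Every \<open>F\<close> below is bilinear.
\<close>

definition tlift ::
  "('k::field \<Rightarrow> 'v::ab_group_add \<Rightarrow> 'v) \<Rightarrow> ('k \<Rightarrow> 'w::ab_group_add \<Rightarrow> 'w) \<Rightarrow>
   ('k, 'v, 'w) tensor \<Rightarrow> ('v \<Rightarrow> 'w \<Rightarrow> 'u::ab_group_add) \<Rightarrow> 'u" where
  "tlift sV sW t F =
     (\<Sum>(v, w) \<leftarrow> (SOME xs. t = (\<Sum>(v, w) \<leftarrow> xs. v \<otimes>\<^bsub>sV,sW\<^esub> w)). F v w)"


section \<open>Coalgebras\<close>

locale coalgebra = vector_space s
  for s :: "'k::field \<Rightarrow> 'c::ab_group_add \<Rightarrow> 'c" +
  fixes \<delta> :: "'c \<Rightarrow> ('k, 'c, 'c) tensor" and \<epsilon> :: "'c \<Rightarrow> 'k"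
  assumes comult_linear: "Vector_Spaces.linear s tscale \<delta>"
    and comult_in: "\<delta> c \<in> tensor_space s s UNIV UNIV"
    and counit_linear: "Vector_Spaces.linear s (*) \<epsilon>"
    and coassoc:
      "tlift s s (\<delta> c) (\<lambda>a b. tlift s s (\<delta> a) (\<lambda>a1 a2. (a1 \<otimes>\<^bsub>s,s\<^esub> a2) \<otimes>\<^bsub>tscale,s\<^esub> b)) =
       tlift s s (\<delta> c) (\<lambda>a b. tlift s s (\<delta> b) (\<lambda>b1 b2. (a \<otimes>\<^bsub>s,s\<^esub> b1) \<otimes>\<^bsub>tscale,s\<^esub> b2))"
    and counit_left: "tlift s s (\<delta> c) (\<lambda>a b. s (\<epsilon> a) b) = c"
    and counit_right: "tlift s s (\<delta> c) (\<lambda>a b. s (\<epsilon> b) a) = c"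

definition subcoalgebra ::
  "('k::field \<Rightarrow> 'c::ab_group_add \<Rightarrow> 'c) \<Rightarrow> ('c \<Rightarrow> ('k, 'c, 'c) tensor) \<Rightarrow> 'c set \<Rightarrow> bool" where
  "subcoalgebra s \<delta> D \<longleftrightarrow> module.subspace s D \<and> \<delta> ` D \<subseteq> tensor_space s s D D"

definition simple_subcoalgebra ::
  "('k::field \<Rightarrow> 'c::ab_group_add \<Rightarrow> 'c) \<Rightarrow> ('c \<Rightarrow> ('k, 'c, 'c) tensor) \<Rightarrow> 'c set \<Rightarrow> bool" where
  "simple_subcoalgebra s \<delta> D \<longleftrightarrow> subcoalgebra s \<delta> D \<and> D \<noteq> {0} \<and>
     (\<forall>E. subcoalgebra s \<delta> E \<longrightarrow> E \<subseteq> D \<longrightarrow> E = {0} \<or> E = D)"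

definition coradical ::
  "('k::field \<Rightarrow> 'c::ab_group_add \<Rightarrow> 'c) \<Rightarrow> ('c \<Rightarrow> ('k, 'c, 'c) tensor) \<Rightarrow> 'c set" where
  "coradical s \<delta> = module.span s (\<Union> {D. simple_subcoalgebra s \<delta> D})"

definition cosemisimple ::
  "('k::field \<Rightarrow> 'c::ab_group_add \<Rightarrow> 'c) \<Rightarrow> ('c \<Rightarrow> ('k, 'c, 'c) tensor) \<Rightarrow> bool" where
  "cosemisimple s \<delta> \<longleftrightarrow> coradical s \<delta> = UNIV"

text \<open>
  Primitive elements and thinness are taken with respect to a group-like element \<open>e\<close>, which for a
  thin coalgebra is the unique group-like element; in a pre-bialgebra it is \<open>1\<^sub>R\<close>.
\<close>

definition primitives ::
  "('k::field \<Rightarrow> 'c::ab_group_add \<Rightarrow> 'c) \<Rightarrow> ('c \<Rightarrow> ('k, 'c, 'c) tensor) \<Rightarrow> 'c \<Rightarrow> 'c set" where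
  "primitives s \<delta> e = {c. \<delta> c = c \<otimes>\<^bsub>s,s\<^esub> e + e \<otimes>\<^bsub>s,s\<^esub> c}"

definition thin ::
  "('k::field \<Rightarrow> 'c::ab_group_add \<Rightarrow> 'c) \<Rightarrow> ('c \<Rightarrow> ('k, 'c, 'c) tensor) \<Rightarrow> 'c \<Rightarrow> bool" where
  "thin s \<delta> e \<longleftrightarrow>
     vector_space.dim s (coradical s \<delta>) = 1 \<and> vector_space.dim s (primitives s \<delta> e) = 1"


section \<open>Hopf algebras and Yetter-Drinfeld data\<close>

locale hopf_algebra = coalgebra sH \<Delta> \<epsilon>H
  for sH :: "'k::field \<Rightarrow> 'h::ring_1 \<Rightarrow> 'h"
    and \<Delta> :: "'h \<Rightarrow> ('k, 'h, 'h) tensor" and \<epsilon>H :: "'h \<Rightarrow> 'k" +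
  fixes S :: "'h \<Rightarrow> 'h"
  assumes mult_bilinear: "bilinear_map sH sH sH (*)"
    and comult_one: "\<Delta> 1 = 1 \<otimes>\<^bsub>sH,sH\<^esub> 1"
    and comult_mult: "\<Delta> (h * k) =
      tlift sH sH (\<Delta> h) (\<lambda>h1 h2. tlift sH sH (\<Delta> k) (\<lambda>k1 k2. (h1 * k1) \<otimes>\<^bsub>sH,sH\<^esub> (h2 * k2)))"
    and counit_one: "\<epsilon>H 1 = 1"
    and counit_mult: "\<epsilon>H (h * k) = \<epsilon>H h * \<epsilon>H k"
    and antipode_linear: "Vector_Spaces.linear sH sH S"
    and antipode_left: "tlift sH sH (\<Delta> h) (\<lambda>h1 h2. S h1 * h2) = sH (\<epsilon>H h) 1"
    and antipode_right: "tlift sH sH (\<Delta> h) (\<lambda>h1 h2. h1 * S h2) = sH (\<epsilon>H h) 1"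
begin

definition grouplike :: "'h \<Rightarrow> bool" where
  "grouplike g \<longleftrightarrow> \<Delta> g = g \<otimes>\<^bsub>sH,sH\<^esub> g \<and> \<epsilon>H g = 1"

definition hopf_character :: "('h \<Rightarrow> 'k) \<Rightarrow> bool" where
  "hopf_character \<chi> \<longleftrightarrow> Vector_Spaces.linear sH (*) \<chi> \<and> \<chi> 1 = 1 \<and> (\<forall>h k. \<chi> (h * k) = \<chi> h * \<chi> k)"

primrec conv_pow :: "('h \<Rightarrow> 'k) \<Rightarrow> nat \<Rightarrow> 'h \<Rightarrow> 'k" where
  "conv_pow \<chi> 0 = \<epsilon>H"
| "conv_pow \<chi> (Suc n) = (\<lambda>h. tlift sH sH (\<Delta> h) (\<lambda>h1 h2. \<chi> h1 * conv_pow \<chi> n h2))"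

end

definition primitive_root_of_unity :: "nat \<Rightarrow> 'k::field \<Rightarrow> bool" where
  "primitive_root_of_unity n q \<longleftrightarrow> n > 0 \<and> q ^ n = 1 \<and> (\<forall>j. 0 < j \<and> j < n \<longrightarrow> q ^ j \<noteq> 1)"

context hopf_algebra
begin

definition yd_datum :: "nat \<Rightarrow> 'k \<Rightarrow> 'h \<Rightarrow> ('h \<Rightarrow> 'k) \<Rightarrow> bool" where
  "yd_datum n q g \<chi> \<longleftrightarrow> primitive_root_of_unity n q \<and> grouplike g \<and> hopf_character \<chi> \<and> \<chi> g = q \<and>
     (\<forall>h. g * tlift sH sH (\<Delta> h) (\<lambda>h1 h2. sH (\<chi> h1) h2) =
          tlift sH sH (\<Delta> h) (\<lambda>h1 h2. sH (\<chi> h2) h1) * g)"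

definition compatible_datum :: "nat \<Rightarrow> 'k \<Rightarrow> 'h \<Rightarrow> ('h \<Rightarrow> 'k) \<Rightarrow> 'k \<Rightarrow> bool" where
  "compatible_datum n q g \<chi> l \<longleftrightarrow> yd_datum n q g \<chi> \<and>
     (g ^ n = 1 \<or>
      (\<exists>h. sH (conv_pow \<chi> n h) (1 - g ^ n) \<noteq> tlift sH sH (\<Delta> h) (\<lambda>h1 h2. h1 * (1 - g ^ n) * S h2))
      \<longrightarrow> l = 0)"

end


section \<open>Yetter-Drinfeld modules and coalgebras in their category\<close>

locale yd_module = hopf_algebra sH \<Delta> \<epsilon>H S + V: vector_space sV
  for sH :: "'k::field \<Rightarrow> 'h::ring_1 \<Rightarrow> 'h"
    and \<Delta> :: "'h \<Rightarrow> ('k, 'h, 'h) tensor" and \<epsilon>H :: "'h \<Rightarrow> 'k" and S :: "'h \<Rightarrow> 'h"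
    and sV :: "'k \<Rightarrow> 'v::ab_group_add \<Rightarrow> 'v" +
  fixes act :: "'h \<Rightarrow> 'v \<Rightarrow> 'v" and \<rho> :: "'v \<Rightarrow> ('k, 'h, 'v) tensor"
  assumes act_bilinear: "bilinear_map sH sV sV act"
    and act_one: "act 1 v = v"
    and act_mult: "act (h * k) v = act h (act k v)"
    and coact_linear: "Vector_Spaces.linear sV tscale \<rho>"
    and coact_in: "\<rho> v \<in> tensor_space sH sV UNIV UNIV"
    and coact_counit: "tlift sH sV (\<rho> v) (\<lambda>a v0. sV (\<epsilon>H a) v0) = v"
    and coact_coassoc:
      "tlift sH sV (\<rho> v) (\<lambda>a v0. tlift sH sH (\<Delta> a) (\<lambda>a1 a2. (a1 \<otimes>\<^bsub>sH,sH\<^esub> a2) \<otimes>\<^bsub>tscale,sV\<^esub> v0)) =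
       tlift sH sV (\<rho> v) (\<lambda>a v0. tlift sH sV (\<rho> v0) (\<lambda>b v1. (a \<otimes>\<^bsub>sH,sH\<^esub> b) \<otimes>\<^bsub>tscale,sV\<^esub> v1))"
    and yd_compat: "\<rho> (act h v) =
      tlift sH sH (\<Delta> h) (\<lambda>h1 h'. tlift sH sH (\<Delta> h') (\<lambda>h2 h3.
        tlift sH sV (\<rho> v) (\<lambda>a v0. (h1 * a * S h3) \<otimes>\<^bsub>sH,sV\<^esub> act h2 v0)))"
begin

text \<open>
  The diagonal action and the codiagonal coaction on \<open>V \<otimes> V\<close>. The Sweedler sum
  \<open>\<Sum> F a v\<^sub>0 w\<^sub>0\<close> over \<open>\<rho>(v \<otimes> w) = \<Sum> a \<otimes> (v\<^sub>0 \<otimes> w\<^sub>0)\<close> is \<open>coact_sum2 v w F\<close>.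
\<close>

definition act2 :: "'h \<Rightarrow> ('k, 'v, 'v) tensor \<Rightarrow> ('k, 'v, 'v) tensor" where
  "act2 h t = tlift sH sH (\<Delta> h) (\<lambda>h1 h2. tlift sV sV t (\<lambda>v w. act h1 v \<otimes>\<^bsub>sV,sV\<^esub> act h2 w))"

definition coact_sum2 :: "'v \<Rightarrow> 'v \<Rightarrow> ('h \<Rightarrow> 'v \<Rightarrow> 'v \<Rightarrow> 'u::ab_group_add) \<Rightarrow> 'u" where
  "coact_sum2 v w F =
     tlift sH sV (\<rho> v) (\<lambda>a v0. tlift sH sV (\<rho> w) (\<lambda>b w0. F (a * b) v0 w0))"

definition coact2 :: "('k, 'v, 'v) tensor \<Rightarrow> ('k, 'h, ('k, 'v, 'v) tensor) tensor" where
  "coact2 t = tlift sV sV t (\<lambda>v w. coact_sum2 v w (\<lambda>a v0 w0.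
     a \<otimes>\<^bsub>sH,tscale\<^esub> (v0 \<otimes>\<^bsub>sV,sV\<^esub> w0)))"

end

locale yd_coalgebra = yd_module sH \<Delta> \<epsilon>H S sR act \<rho> + R: coalgebra sR \<delta> \<epsilon>
  for sH :: "'k::field \<Rightarrow> 'h::ring_1 \<Rightarrow> 'h"
    and \<Delta> :: "'h \<Rightarrow> ('k, 'h, 'h) tensor" and \<epsilon>H :: "'h \<Rightarrow> 'k" and S :: "'h \<Rightarrow> 'h"
    and sR :: "'k \<Rightarrow> 'r::ab_group_add \<Rightarrow> 'r"
    and act :: "'h \<Rightarrow> 'r \<Rightarrow> 'r" and \<rho> :: "'r \<Rightarrow> ('k, 'h, 'r) tensor"
    and \<delta> :: "'r \<Rightarrow> ('k, 'r, 'r) tensor" and \<epsilon> :: "'r \<Rightarrow> 'k" +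
  assumes comult_module_hom: "\<delta> (act h r) = act2 h (\<delta> r)"
    and comult_comodule_hom: "coact2 (\<delta> r) = tlift sH sR (\<rho> r) (\<lambda>a r0. a \<otimes>\<^bsub>sH,tscale\<^esub> \<delta> r0)"
    and counit_module_hom: "\<epsilon> (act h r) = \<epsilon>H h * \<epsilon> r"
    and counit_comodule_hom: "tlift sH sR (\<rho> r) (\<lambda>a r0. a \<otimes>\<^bsub>sH,(*)\<^esub> \<epsilon> r0) = 1 \<otimes>\<^bsub>sH,(*)\<^esub> \<epsilon> r"
begin

text \<open>
  Sweedler sum over the comultiplication of \<open>R \<otimes> R\<close>: since
  \<open>\<delta>(r \<otimes> s) = \<Sum> (r\<^sup>1 \<otimes> r\<^sup>2\<^sub>-\<^sub>1 s\<^sup>1) \<otimes> (r\<^sup>2\<^sub>0 \<otimes> s\<^sup>2)\<close>, the sum \<open>\<Sum> F a b c d\<close> over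
  \<open>\<delta>(r \<otimes> s) = \<Sum> (a \<otimes> b) \<otimes> (c \<otimes> d)\<close> is \<open>sweedler2 r s F\<close>.
\<close>

definition sweedler2 :: "'r \<Rightarrow> 'r \<Rightarrow> ('r \<Rightarrow> 'r \<Rightarrow> 'r \<Rightarrow> 'r \<Rightarrow> 'u::ab_group_add) \<Rightarrow> 'u" where
  "sweedler2 r s F =
     tlift sR sR (\<delta> r) (\<lambda>r1 r2. tlift sR sR (\<delta> s) (\<lambda>s1 s2. tlift sH sR (\<rho> r2) (\<lambda>a r20.
       F r1 (act a s1) r20 s2)))"

end


section \<open>Pre-bialgebras, braided bialgebras and cocycles\<close>

text \<open>Linear maps out of \<open>R \<otimes> R\<close>, such as \<open>m\<close> and \<open>\<xi>\<close>, are given as bilinear maps.\<close>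

locale pre_bialgebra = yd_coalgebra sH \<Delta> \<epsilon>H S sR act \<rho> \<delta> \<epsilon>
  for sH :: "'k::field \<Rightarrow> 'h::ring_1 \<Rightarrow> 'h"
    and \<Delta> :: "'h \<Rightarrow> ('k, 'h, 'h) tensor" and \<epsilon>H :: "'h \<Rightarrow> 'k" and S :: "'h \<Rightarrow> 'h"
    and sR :: "'k \<Rightarrow> 'r::ab_group_add \<Rightarrow> 'r"
    and act :: "'h \<Rightarrow> 'r \<Rightarrow> 'r" and \<rho> :: "'r \<Rightarrow> ('k, 'h, 'r) tensor"
    and \<delta> :: "'r \<Rightarrow> ('k, 'r, 'r) tensor" and \<epsilon> :: "'r \<Rightarrow> 'k" +
  fixes m :: "'r \<Rightarrow> 'r \<Rightarrow> 'r" and u :: "'k \<Rightarrow> 'r"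
  assumes m_bilinear: "bilinear_map sR sR sR m"
    and u_linear: "Vector_Spaces.linear (*) sR u"
    and act_unit: "act h (u 1) = sR (\<epsilon>H h) (u 1)"
    and coact_unit: "\<rho> (u 1) = 1 \<otimes>\<^bsub>sH,sR\<^esub> u 1"
    and comult_unit: "\<delta> (u 1) = u 1 \<otimes>\<^bsub>sR,sR\<^esub> u 1"
    and counit_unit: "\<epsilon> (u 1) = 1"
    and act_m: "act h (m r s) = tlift sH sH (\<Delta> h) (\<lambda>h1 h2. m (act h1 r) (act h2 s))"
    and comult_m: "\<delta> (m r s) = sweedler2 r s (\<lambda>a b c d. m a b \<otimes>\<^bsub>sR,sR\<^esub> m c d)"
    and counit_m: "\<epsilon> (m r s) = \<epsilon> r * \<epsilon> s"
    and m_unit_right: "m r (u 1) = r"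
    and m_unit_left: "m (u 1) r = r"
begin

text \<open>Powers and polynomial values, bracketed as \<open>y (y (\<dots> (y 1\<^sub>R)))\<close> as \<open>m\<close> need not be associative.\<close>

definition m_pow :: "'r \<Rightarrow> nat \<Rightarrow> 'r" where
  "m_pow y n = (m y ^^ n) (u 1)"

definition poly_val :: "'r \<Rightarrow> 'k poly \<Rightarrow> 'r" where
  "poly_val y p = (\<Sum>i\<le>degree p. sR (coeff p i) (m_pow y i))"

definition associated_yd_datum :: "'r \<Rightarrow> 'h \<Rightarrow> ('h \<Rightarrow> 'k) \<Rightarrow> bool" where
  "associated_yd_datum y g \<chi> \<longleftrightarrow>
     (\<exists>n. 2 \<le> n \<and> n \<le> vector_space.dim sR UNIV \<and> yd_datum n (\<chi> g) g \<chi>) \<and>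
     \<rho> y = g \<otimes>\<^bsub>sH,sR\<^esub> y \<and> (\<forall>h. act h y = sR (\<chi> h) y)"

definition divided_power_basis ::
  "nat \<Rightarrow> 'k \<Rightarrow> 'h \<Rightarrow> ('h \<Rightarrow> 'k) \<Rightarrow> 'r \<Rightarrow> (nat \<Rightarrow> 'r) \<Rightarrow> bool" where
  "divided_power_basis N q g \<chi> y d \<longleftrightarrow>
     inj_on d {..<N} \<and> \<not> module.dependent sR (d ` {..<N}) \<and> module.span sR (d ` {..<N}) = UNIV \<and>
     d 0 = u 1 \<and> d 1 = y \<and>
     (\<forall>n<N. \<delta> (d n) = (\<Sum>t\<le>n. d t \<otimes>\<^bsub>sR,sR\<^esub> d (n - t))) \<and>
     (\<forall>n<N. act g (d n) = sR (q ^ n) (d n)) \<and>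
     (\<forall>n<N. \<forall>h. act h (d n) = sR (conv_pow \<chi> n h) (d n)) \<and>
     (\<forall>n. 1 \<le> n \<and> n < N \<longrightarrow> m y (d (n - 1)) = sR (\<Sum>i<n. q ^ i) (d n))"

end

locale braided_bialgebra = pre_bialgebra sH \<Delta> \<epsilon>H S sR act \<rho> \<delta> \<epsilon> m u
  for sH :: "'k::field \<Rightarrow> 'h::ring_1 \<Rightarrow> 'h"
    and \<Delta> :: "'h \<Rightarrow> ('k, 'h, 'h) tensor" and \<epsilon>H :: "'h \<Rightarrow> 'k" and S :: "'h \<Rightarrow> 'h"
    and sR :: "'k \<Rightarrow> 'r::ab_group_add \<Rightarrow> 'r"
    and act :: "'h \<Rightarrow> 'r \<Rightarrow> 'r" and \<rho> :: "'r \<Rightarrow> ('k, 'h, 'r) tensor"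
    and \<delta> :: "'r \<Rightarrow> ('k, 'r, 'r) tensor" and \<epsilon> :: "'r \<Rightarrow> 'k"
    and m :: "'r \<Rightarrow> 'r \<Rightarrow> 'r" and u :: "'k \<Rightarrow> 'r" +
  assumes m_assoc: "m (m r s) t = m r (m s t)"
    and m_comodule_hom: "\<rho> (m r s) = coact_sum2 r s (\<lambda>a r0 s0. a \<otimes>\<^bsub>sH,sR\<^esub> m r0 s0)"

text \<open>
  The quantum line \<open>R\<^sub>q(H,g,\<chi>)\<close>, up to the canonical isomorphism: \<open>R\<close> is a braided bialgebra,
  \<open>X \<mapsto> y\<close> induces an isomorphism of algebras \<open>K[X]/(X\<^sup>N) \<cong> R\<close>, and \<open>y\<close> has the prescribed
  action, coaction and comultiplication, which determine the braided bialgebra structure.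
\<close>

locale quantum_line = braided_bialgebra sH \<Delta> \<epsilon>H S sR act \<rho> \<delta> \<epsilon> m u
  for sH :: "'k::field \<Rightarrow> 'h::ring_1 \<Rightarrow> 'h"
    and \<Delta> :: "'h \<Rightarrow> ('k, 'h, 'h) tensor" and \<epsilon>H :: "'h \<Rightarrow> 'k" and S :: "'h \<Rightarrow> 'h"
    and sR :: "'k \<Rightarrow> 'r::ab_group_add \<Rightarrow> 'r"
    and act :: "'h \<Rightarrow> 'r \<Rightarrow> 'r" and \<rho> :: "'r \<Rightarrow> ('k, 'h, 'r) tensor"
    and \<delta> :: "'r \<Rightarrow> ('k, 'r, 'r) tensor" and \<epsilon> :: "'r \<Rightarrow> 'k"
    and m :: "'r \<Rightarrow> 'r \<Rightarrow> 'r" and u :: "'k \<Rightarrow> 'r" +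
  fixes N :: nat and q :: 'k and g :: 'h and \<chi> :: "'h \<Rightarrow> 'k" and y :: 'r
  assumes yd_datum: "yd_datum N q g \<chi>"
    and poly_val_surj: "range (poly_val y) = UNIV"
    and poly_val_kernel: "poly_val y p = 0 \<longleftrightarrow> monom 1 N dvd p"
    and act_y: "act h y = sR (\<chi> h) y"
    and coact_y: "\<rho> y = g \<otimes>\<^bsub>sH,sR\<^esub> y"
    and comult_y: "\<delta> y = y \<otimes>\<^bsub>sR,sR\<^esub> u 1 + u 1 \<otimes>\<^bsub>sR,sR\<^esub> y"

locale pre_bialgebra_with_cocycle = pre_bialgebra sH \<Delta> \<epsilon>H S sR act \<rho> \<delta> \<epsilon> m u
  for sH :: "'k::field \<Rightarrow> 'h::ring_1 \<Rightarrow> 'h"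
    and \<Delta> :: "'h \<Rightarrow> ('k, 'h, 'h) tensor" and \<epsilon>H :: "'h \<Rightarrow> 'k" and S :: "'h \<Rightarrow> 'h"
    and sR :: "'k \<Rightarrow> 'r::ab_group_add \<Rightarrow> 'r"
    and act :: "'h \<Rightarrow> 'r \<Rightarrow> 'r" and \<rho> :: "'r \<Rightarrow> ('k, 'h, 'r) tensor"
    and \<delta> :: "'r \<Rightarrow> ('k, 'r, 'r) tensor" and \<epsilon> :: "'r \<Rightarrow> 'k"
    and m :: "'r \<Rightarrow> 'r \<Rightarrow> 'r" and u :: "'k \<Rightarrow> 'r" +
  fixes \<xi> :: "'r \<Rightarrow> 'r \<Rightarrow> 'h"
  assumes xi_bilinear: "bilinear_map sR sR sH \<xi>"
    and xi_act: "tlift sH sH (\<Delta> h) (\<lambda>h1 h2. \<xi> (act h1 r) (act h2 s)) =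
      tlift sH sH (\<Delta> h) (\<lambda>h1 h2. h1 * \<xi> r s * S h2)"
    and xi_comult: "\<Delta> (\<xi> r s) =
      sweedler2 r s (\<lambda>a b c d. coact_sum2 c d (\<lambda>h c0 d0.
        (\<xi> a b * h) \<otimes>\<^bsub>sH,sH\<^esub> \<xi> c0 d0))"
    and xi_counit: "\<epsilon>H (\<xi> r s) = \<epsilon> r * \<epsilon> s"
    and xi_coact:
      "sweedler2 r s (\<lambda>a b c d. tlift sH sR (\<rho> (m a b)) (\<lambda>h r0. (h * \<xi> c d) \<otimes>\<^bsub>sH,sR\<^esub> r0)) =
       sweedler2 r s (\<lambda>a b c d. coact_sum2 c d (\<lambda>h c0 d0.
         (\<xi> a b * h) \<otimes>\<^bsub>sH,sR\<^esub> m c0 d0))"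
    and xi_assoc: "m r (m s t) = sweedler2 r s (\<lambda>a b c d. m (m a b) (act (\<xi> c d) t))"
    and xi_cocycle:
      "sweedler2 s t (\<lambda>a b c d. \<xi> r (m a b) * \<xi> c d) =
       sweedler2 r s (\<lambda>a b c d. tlift sH sH (\<Delta> (\<xi> c d)) (\<lambda>h1 h2. \<xi> (m a b) (act h1 t) * h2))"
    and xi_unit_right: "\<xi> r (u 1) = sH (\<epsilon> r) 1"
    and xi_unit_left: "\<xi> (u 1) r = sH (\<epsilon> r) 1"
begin

text \<open>The algebra \<open>R #\<^sub>\<xi> H\<close> on \<open>R \<otimes> H\<close>.\<close>

definition smash_one :: "('k, 'r, 'h) tensor" where
  "smash_one = u 1 \<otimes>\<^bsub>sR,sH\<^esub> 1"

definition smash_mult ::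
  "('k, 'r, 'h) tensor \<Rightarrow> ('k, 'r, 'h) tensor \<Rightarrow> ('k, 'r, 'h) tensor" where
  "smash_mult v w = tlift sR sH v (\<lambda>r h. tlift sR sH w (\<lambda>s k. tlift sH sH (\<Delta> h) (\<lambda>h1 h2.
     sweedler2 r (act h1 s) (\<lambda>a b c d. m a b \<otimes>\<^bsub>sR,sH\<^esub> (\<xi> c d * h2 * k)))))"

definition smash_pow :: "('k, 'r, 'h) tensor \<Rightarrow> nat \<Rightarrow> ('k, 'r, 'h) tensor" where
  "smash_pow v n = (smash_mult v ^^ n) smash_one"

end

end

theory Submission
  imports Defs
begin

text \<open>
  Everything is computed in the basis \<open>d\<^sub>0, \<dots>, d\<^sub>N\<^sub>-\<^sub>1\<close>. Write \<open>X a b = \<xi>(d\<^sub>a \<otimes> d\<^sub>b)\<close>, of degree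
  \<open>a + b\<close>, and \<open>\<rho>(d\<^sub>n) = \<Sum> c\<^sub>n\<^sub>k \<otimes> d\<^sub>k\<close> with \<open>c\<^sub>n\<^sub>k \<in> H\<close>. Colinearity of \<open>\<delta>\<close> expresses all
  \<open>c\<^sub>n\<^sub>k\<close> through the column \<open>k = 1\<close> and makes the matrix triangular with diagonal \<open>g\<^sup>n\<close>. The
  driving force is the weight under conjugation by \<open>g\<close>: it is \<open>q\<^sup>n\<^sup>-\<^sup>k\<close> for \<open>c\<^sub>n\<^sub>k\<close> and
  \<open>q\<^sup>a\<^sup>+\<^sup>b\<close> for \<open>X a b\<close>, and an element of weight \<open>\<noteq> 1\<close> acts on \<open>R\<close> as \<open>0\<close>
  (\<open>act_zero_if_weight\<close>). Hence the comultiplication of \<open>R \<otimes> R\<close> is that of a quantum plane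
  (\<open>sweedler2_d\<close>), and the twisted associativity of \<open>m\<close> is ordinary associativity in low
  degrees. If the order \<open>\<theta>\<close> of \<open>q\<close> were less than \<open>N\<close>, then \<open>d\<^sub>\<theta>\<close> would generate a divided
  power algebra, which cannot be cut off at degree \<open>N\<close> in characteristic \<open>0\<close>; so \<open>\<theta> = N\<close>
  (\<open>theta_eq_N\<close>), and the products \<open>d\<^sub>i d\<^sub>j\<close> are the Gaussian multiples of \<open>d\<^sub>i\<^sub>+\<^sub>j\<close>, or \<open>0\<close>.

  Let \<open>n = a + b < N\<close> be a degree below which \<open>\<xi>\<close> vanishes in positive degrees. Then
  \<open>z = X a b\<close> satisfies \<open>\<Delta> z = z \<otimes> 1 + g\<^sup>n \<otimes> z\<close>. The compatibility of \<open>g\<close> and \<open>\<chi>\<close>, applied to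
  \<open>z\<close>, gives \<open>(q\<^sup>2\<^sup>n - 1) z = 0\<close>, so \<open>z\<close> can only survive for \<open>n = p\<close> where \<open>2 p = N\<close>. Above
  degree \<open>p\<close> the comultiplication of \<open>X a b\<close> acquires no new terms, so the same argument goes on
  up to degree \<open>N\<close> (\<open>X_below\<close>). In degree \<open>p\<close> all values are multiples of \<open>x\<close>; if \<open>p\<close> is even or
  \<open>H\<close> is cosemisimple then \<open>x\<close> is a multiple of \<open>1 - g\<^sup>p\<close>, and its weight \<open>-1\<close> forces \<open>x = 0\<close>,
  while for odd \<open>p\<close> one has \<open>x\<^sup>2 = 0\<close> (\<open>X_half_eq_0\<close>, \<open>half_square\<close>).

  In degree \<open>N\<close> the element \<open>X 1 (N - 1)\<close> is still skew-primitive
  (\<open>X_top_skew_primitive\<close>) and commutes with \<open>g\<close>. The hypothesis on \<open>H\<close> makes such an element a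
  multiple of \<open>1 - g\<^sup>N\<close> (\<open>skew_primitive_trivial\<close>): in the cosemisimple case one projects onto
  simple subcoalgebras, in the finite-dimensional case one lowers the degree of a polynomial
  relation. The cocycle identity for \<open>d\<^sub>a, y, d\<^sub>c\<close> then shows that \<open>\<xi>(y\<^sup>a \<otimes> y\<^sup>N\<^sup>-\<^sup>a)\<close> does not
  depend on \<open>a\<close>, because \<open>x\<^sup>2 = 0\<close> removes its remaining terms. Left multiplication by \<open>Y\<close> in
  \<open>R #\<^sub>\<xi> H\<close> involves only \<open>x\<close> and \<open>X 1 (N - 1)\<close>, and the contribution of \<open>x\<close> to \<open>Y\<^sup>N\<close> carries
  the factor \<open>(N)\<^sub>q = 0\<close> (\<open>smash_pow_y\<close>). Finally, if \<open>x = 0\<close> or \<open>N\<close> is odd, all values in degrees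
  strictly between \<open>0\<close> and \<open>N\<close> vanish; then so do those of degree above \<open>N\<close> (\<open>X_above\<close>), the
  coaction is diagonal, and \<open>R\<close> is a quantum line.
\<close>

section \<open>Linear maps and Sweedler sums\<close>

lemma vector_space_tscale: "vector_space tscale"
  by unfold_locales (auto simp: tscale_def fun_eq_iff algebra_simps)

lemma tscale_simps: "tscale c 0 = 0" "tscale 1 t = t" "tscale a (tscale b t) = tscale (a * b) t"
  by (simp_all add: tscale_def fun_eq_iff)

lemma vector_space_mult: "vector_space ((*) :: 'k::field \<Rightarrow> 'k \<Rightarrow> 'k)"
  by unfold_locales (auto simp: algebra_simps)

lemma linear_simps:
  assumes "Vector_Spaces.linear s s' f"
  shows "f (a + b) = f a + f b" "f (s c a) = s' c (f a)" "f 0 = 0" "f (- a) = - f a"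
    "f (a - b) = f a - f b" "f (\<Sum>i\<in>I. v i) = (\<Sum>i\<in>I. f (v i))"
    "f (sum_list vs) = sum_list (map f vs)"
proof -
  interpret module_hom s s' f using assms by (rule Vector_Spaces.linear.axioms(3))
  show "f (a + b) = f a + f b" "f (s c a) = s' c (f a)" "f 0 = 0" "f (- a) = - f a"
    "f (a - b) = f a - f b" "f (\<Sum>i\<in>I. v i) = (\<Sum>i\<in>I. f (v i))"
    by (simp_all add: add scale zero neg diff sum)
  show "f (sum_list vs) = sum_list (map f vs)" by (induction vs) (simp_all add: add zero)
qed

lemma linear_map_ident: "vector_space s \<Longrightarrow> Vector_Spaces.linear s s (\<lambda>x. x)"
  by (simp add: Vector_Spaces.linear_iff)

lemma linear_comp:
  "Vector_Spaces.linear s' sU F \<Longrightarrow> Vector_Spaces.linear s s' f \<Longrightarrow>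
    Vector_Spaces.linear s sU (\<lambda>x. F (f x))"
  by (simp add: Vector_Spaces.linear_iff)

lemma bilinear_comp_left:
  "bilinear_map sV sW sU F \<Longrightarrow> Vector_Spaces.linear s sV f \<Longrightarrow>
    Vector_Spaces.linear s sU (\<lambda>x. F (f x) w)"
  unfolding bilinear_map_def by (rule linear_comp[where F = "\<lambda>v. F v w"]) auto

lemma bilinear_comp_right:
  "bilinear_map sV sW sU F \<Longrightarrow> Vector_Spaces.linear s sW f \<Longrightarrow>
    Vector_Spaces.linear s sU (\<lambda>x. F v (f x))"
  unfolding bilinear_map_def by (rule linear_comp[where F = "F v"]) auto

lemma bilinear_mapI:
  assumes "\<And>w. Vector_Spaces.linear sV sU (\<lambda>v. F v w)" "\<And>v. Vector_Spaces.linear sW sU (\<lambda>w. F v w)"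
  shows "bilinear_map sV sW sU F"
  using assms by (simp add: bilinear_map_def)

lemma bilinear_simps:
  assumes "bilinear_map sV sW sU F"
  shows "F (a + b) w = F a w + F b w" "F (sV c a) w = sU c (F a w)" "F 0 w = 0"
    "F (- a) w = - F a w" "F (a - b) w = F a w - F b w"
    "F (\<Sum>i\<in>I. v i) w = (\<Sum>i\<in>I. F (v i) w)"
    "F a (w + w') = F a w + F a w'" "F a (sW c w) = sU c (F a w)" "F a 0 = 0"
    "F a (- w) = - F a w" "F a (w - w') = F a w - F a w'"
    "F a (\<Sum>j\<in>J. z j) = (\<Sum>j\<in>J. F a (z j))"
  using assms[unfolded bilinear_map_def]
    linear_simps[of sV sU "\<lambda>v. F v w"] linear_simps[of sW sU "F a"]
  by auto

lemma linear_scale_fun: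
  assumes "Vector_Spaces.linear s sU f"
  shows "Vector_Spaces.linear s sU (\<lambda>x. sU c (f x))"
proof -
  interpret U: vector_space sU using assms by (rule Vector_Spaces.linear.axioms(2))
  show ?thesis using assms
    by (auto simp: Vector_Spaces.linear_iff U.scale_right_distrib mult.commute)
qed

lemma linear_scale_by:
  assumes "Vector_Spaces.linear s (*) f" "vector_space sU"
  shows "Vector_Spaces.linear s sU (\<lambda>x. sU (f x) u)"
proof -
  interpret U: vector_space sU by fact
  show ?thesis using assms
    by (auto simp: Vector_Spaces.linear_iff U.scale_left_distrib)
qed

lemma linear_mult_left: "Vector_Spaces.linear s (*) f \<Longrightarrow> Vector_Spaces.linear s (*) (\<lambda>x. f x * (c::'k::field))"
  by (auto simp: Vector_Spaces.linear_iff algebra_simps)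

lemma linear_mult_right: "Vector_Spaces.linear s (*) f \<Longrightarrow> Vector_Spaces.linear s (*) (\<lambda>x. (c::'k::field) * f x)"
  by (auto simp: Vector_Spaces.linear_iff algebra_simps)

lemma linear_eval: "Vector_Spaces.linear tscale (*) (\<lambda>t. t \<beta>)"
  by (simp add: Vector_Spaces.linear_iff vector_space_tscale vector_space_mult tscale_def)

lemma linear_sum_list_fun:
  assumes "\<And>v w. Vector_Spaces.linear s sU (\<lambda>x. F x v w)" "vector_space s" "vector_space sU"
  shows "Vector_Spaces.linear s sU (\<lambda>x. \<Sum>(v, w)\<leftarrow>xs. F x v w)"
proof -
  interpret U: vector_space sU by fact
  show ?thesis
  proof (induction xs)
    case Nil
    then show ?case using assms(2,3) by (simp add: Vector_Spaces.linear_iff)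
  next
    case (Cons p xs)
    then show ?case using assms(1)[of "fst p" "snd p"]
      by (auto simp: Vector_Spaces.linear_iff U.scale_right_distrib split_def algebra_simps)
  qed
qed

text \<open>Linear in the integrand: the chosen representation of the tensor does not depend on it.\<close>

lemma linear_tlift_integrand:
  assumes "\<And>v w. Vector_Spaces.linear s sU (\<lambda>x. F x v w)"
  shows "Vector_Spaces.linear s sU (\<lambda>x. tlift sV sW t (F x))"
  unfolding tlift_def
  by (rule linear_sum_list_fun)
     (use assms in \<open>auto simp: Vector_Spaces.linear_iff\<close>)

lemma (in vector_space) separating_functional:
  assumes "x \<notin> span A"
  obtains f where "Vector_Spaces.linear scale (*) f" "f x = 1" "\<And>a. a \<in> span A \<Longrightarrow> f a = 0"
proof -
  interpret P: vector_space_pair scale "(*)"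
    using vector_space_axioms vector_space_mult by (simp add: vector_space_pair_def)
  obtain B where B: "B \<subseteq> A" "independent B" "A \<subseteq> span B"
    using maximal_independent_subset by metis
  have sp: "span B = span A"
    using B by (metis span_mono span_span subset_antisym)
  have "independent (insert x B)"
    using B assms sp by (simp add: independent_insert)
  then obtain f where f: "Vector_Spaces.linear scale (*) f" "\<forall>b\<in>insert x B. f b = (if b = x then 1 else 0)"
    using P.linear_independent_extend[of "insert x B" "\<lambda>b. if b = x then 1 else 0"] by auto
  have 0: "f b = 0" if "b \<in> B" for b using f(2) that assms sp span_base[of b B] by auto
  have "f a = 0" if "a \<in> span A" for a
    using that[folded sp]
    by (induction rule: span_induct_alt) (auto simp: linear_simps[OF f(1)] 0)
  then show ?thesis using that f by auto
qed

lemma (in vector_space) functionals_separate: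
  assumes "\<And>f. Vector_Spaces.linear scale (*) f \<Longrightarrow> f a = f b"
  shows "a = b"
proof (rule ccontr)
  assume "a \<noteq> b"
  then have "a - b \<notin> span {}" by simp
  then obtain f where "Vector_Spaces.linear scale (*) f" "f (a - b) = 1"
    using separating_functional by metis
  then show False using assms[of f] by (simp add: linear_simps)
qed

lemma bilinear_tens:
  assumes "vector_space sV" "vector_space sW"
  shows "bilinear_map sV sW tscale (tens sV sW)"
  using assms
  by (auto simp: bilinear_map_def Vector_Spaces.linear_iff vector_space_tscale tens_def tscale_def fun_eq_iff)

lemma tens_apply: "bilinear_map sV sW (*) \<beta> \<Longrightarrow> (tens sV sW v w) \<beta> = \<beta> v w"
  by (simp add: tens_def)

lemma sum_list_tens_apply:
  "bilinear_map sV sW (*) \<beta> \<Longrightarrow> (\<Sum>(v, w)\<leftarrow>xs. tens sV sW v w) \<beta> = (\<Sum>(v, w)\<leftarrow>xs. \<beta> v w)"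
  by (induction xs) (auto simp: tens_apply)

text \<open>
  Linear functionals separate the points of the target of a bilinear map \<open>F\<close>, and composing \<open>F\<close>
  with one gives a bilinear form, at which a tensor may be evaluated. So a Sweedler sum can be
  computed from any expression of the tensor as a sum of pure tensors.
\<close>

lemma tlift_sum_list:
  assumes F: "bilinear_map sV sW sU F"
  shows "tlift sV sW (\<Sum>(v, w)\<leftarrow>xs. tens sV sW v w) F = (\<Sum>(v, w)\<leftarrow>xs. F v w)"
proof -
  interpret U: vector_space sU
    using F by (auto simp: bilinear_map_def Vector_Spaces.linear_iff)
  define ys where "ys = (SOME ys. (\<Sum>(v, w)\<leftarrow>xs. tens sV sW v w) = (\<Sum>(v, w)\<leftarrow>ys. tens sV sW v w))"
  have ys: "(\<Sum>(v, w)\<leftarrow>xs. tens sV sW v w) = (\<Sum>(v, w)\<leftarrow>ys. tens sV sW v w)"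
    unfolding ys_def by (rule someI[of _ xs]) simp
  have "(\<Sum>(v, w)\<leftarrow>ys. F v w) = (\<Sum>(v, w)\<leftarrow>xs. F v w)"
  proof (rule U.functionals_separate)
    fix f assume f: "Vector_Spaces.linear sU (*) f"
    have b: "bilinear_map sV sW (*) (\<lambda>v w. f (F v w))"
      by (intro bilinear_mapI linear_comp[OF f]) (use F in \<open>auto simp: bilinear_map_def\<close>)
    have "f (\<Sum>(v, w)\<leftarrow>zs. F v w) = (\<Sum>(v, w)\<leftarrow>zs. tens sV sW v w) (\<lambda>v w. f (F v w))" for zs
      unfolding sum_list_tens_apply[OF b] by (simp add: linear_simps[OF f] split_def o_def)
    then show "f (\<Sum>(v, w)\<leftarrow>ys. F v w) = f (\<Sum>(v, w)\<leftarrow>xs. F v w)" using ys by simp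
  qed
  then show ?thesis by (simp add: tlift_def ys_def)
qed

lemma tlift_sum:
  assumes F: "bilinear_map sV sW sU F"
  shows "tlift sV sW (\<Sum>i\<in>I. tens sV sW (v i) (w i)) F = (\<Sum>i\<in>I. F (v i) (w i))"
proof -
  have "finite (if finite I then I else {})" by simp
  from finite_distinct_list[OF this]
  obtain xs where xs: "set xs = (if finite I then I else {})" "distinct xs" by (elim exE conjE)
  have sum: "(\<Sum>(v, w)\<leftarrow>map (\<lambda>i. (v i, w i)) xs. G v w) = (\<Sum>i\<in>I. G (v i) (w i))"
    for G :: "_ \<Rightarrow> _ \<Rightarrow> 'x::ab_group_add"
    using xs by (cases "finite I") (simp_all add: sum_list_distinct_conv_sum_set o_def)
  show ?thesis
    using tlift_sum_list[OF F, of "map (\<lambda>i. (v i, w i)) xs"] unfolding sum .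
qed

lemma tlift_tens: "bilinear_map sV sW sU F \<Longrightarrow> tlift sV sW (tens sV sW v w) F = F v w"
  using tlift_sum[of sV sW sU F "\<lambda>_. v" "\<lambda>_. w" "{()}"] by simp

lemma tlift_zero: "bilinear_map sV sW sU F \<Longrightarrow> tlift sV sW 0 F = 0"
  using tlift_sum[of sV sW sU F "\<lambda>_. 0" "\<lambda>_. 0" "{}"] by simp

lemma tensor_space_rep:
  assumes "vector_space sV" "vector_space sW" "t \<in> tensor_space sV sW A B" "module.subspace sV A"
  obtains xs where "t = (\<Sum>(v, w)\<leftarrow>xs. tens sV sW v w)" "set xs \<subseteq> A \<times> B"
proof -
  interpret T: vector_space tscale by (rule vector_space_tscale)
  interpret V: vector_space sV by fact
  note bil = bilinear_tens[OF assms(1,2)]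
  have "\<exists>xs. t = (\<Sum>(v, w)\<leftarrow>xs. tens sV sW v w) \<and> set xs \<subseteq> A \<times> B"
    using assms(3)[unfolded tensor_space_def]
  proof (induction rule: T.span_induct_alt)
    case base
    show ?case by (intro exI[of _ "[]"]) simp
  next
    case (step c x y)
    then obtain v w xs where "x = tens sV sW v w" "v \<in> A" "w \<in> B"
      "y = (\<Sum>(v, w)\<leftarrow>xs. tens sV sW v w)" "set xs \<subseteq> A \<times> B" by auto
    then show ?case using V.subspace_scale[OF assms(4)]
      by (intro exI[of _ "(sV c v, w) # xs"]) (simp add: bilinear_simps[OF bil])
  qed
  then show ?thesis using that by blast
qed

lemma tensor_space_UNIV_rep:
  assumes "vector_space sV" "vector_space sW" "t \<in> tensor_space sV sW UNIV UNIV"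
  obtains xs where "t = (\<Sum>(v, w)\<leftarrow>xs. tens sV sW v w)"
proof -
  interpret V: vector_space sV by fact
  show ?thesis using tensor_space_rep[OF assms] that V.subspace_UNIV by metis
qed

text \<open>
  Linearity in the tensor requires \<open>F\<close> to be bilinear, since representations of two tensors as sums
  of pure tensors have to be concatenated. Outside the span of the pure tensors \<open>tlift\<close> has no
  meaning, hence the last hypothesis.
\<close>

lemma linear_tlift_tensor:
  assumes F: "bilinear_map sV sW sU F" and f: "Vector_Spaces.linear s tscale f"
    and in_T: "\<And>x. f x \<in> tensor_space sV sW UNIV UNIV"
  shows "Vector_Spaces.linear s sU (\<lambda>x. tlift sV sW (f x) F)"
proof -
  have V: "vector_space sV" "vector_space sW" "vector_space sU"
    using F by (auto simp: bilinear_map_def Vector_Spaces.linear_iff)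
  interpret T: vector_space tscale by (rule vector_space_tscale)
  interpret U: vector_space sU by fact
  note rep = tensor_space_UNIV_rep[OF V(1,2)]
  note bil = bilinear_tens[OF V(1,2)]
  have add: "tlift sV sW (t + t') F = tlift sV sW t F + tlift sV sW t' F"
    if t: "t \<in> tensor_space sV sW UNIV UNIV" and t': "t' \<in> tensor_space sV sW UNIV UNIV" for t t'
  proof -
    obtain xs where xs: "t = (\<Sum>(v, w)\<leftarrow>xs. tens sV sW v w)" using rep[OF t] .
    obtain ys where ys: "t' = (\<Sum>(v, w)\<leftarrow>ys. tens sV sW v w)" using rep[OF t'] .
    have "t + t' = (\<Sum>(v, w)\<leftarrow>xs @ ys. tens sV sW v w)" by (simp add: xs ys)
    then have "tlift sV sW (t + t') F = (\<Sum>(v, w)\<leftarrow>xs @ ys. F v w)"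
      by (simp only: tlift_sum_list[OF F])
    also have "\<dots> = tlift sV sW t F + tlift sV sW t' F"
      unfolding xs ys by (simp only: tlift_sum_list[OF F]) simp
    finally show ?thesis .
  qed
  have scl: "tlift sV sW (tscale c t) F = sU c (tlift sV sW t F)"
    if t: "t \<in> tensor_space sV sW UNIV UNIV" for t c
  proof -
    obtain xs where xs: "t = (\<Sum>(v, w)\<leftarrow>xs. tens sV sW v w)" using rep[OF t] .
    have "tscale c (\<Sum>(v, w)\<leftarrow>xs. tens sV sW v w) = (\<Sum>(v, w)\<leftarrow>map (\<lambda>(v, w). (sV c v, w)) xs. tens sV sW v w)"
      by (induction xs) (simp_all only: list.map sum_list.Cons sum_list.Nil T.scale_right_distrib
        T.scale_zero_right case_prod_beta bilinear_simps(2)[OF bil] fst_conv snd_conv)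
    then have "tlift sV sW (tscale c t) F = (\<Sum>(v, w)\<leftarrow>map (\<lambda>(v, w). (sV c v, w)) xs. F v w)"
      by (simp only: tlift_sum_list[OF F] xs)
    also have "\<dots> = sU c (\<Sum>(v, w)\<leftarrow>xs. F v w)"
      by (induction xs) (auto simp: U.scale_right_distrib bilinear_simps[OF F])
    finally show ?thesis by (simp only: tlift_sum_list[OF F] xs)
  qed
  show ?thesis using f V in_T
    by (auto simp: Vector_Spaces.linear_iff add scl)
qed

text \<open>Coefficients of a tensor are read off by evaluating it at a product of functionals.\<close>

lemma bilinear_mult_functionals:
  "Vector_Spaces.linear sV (*) f \<Longrightarrow> Vector_Spaces.linear sW (*) h \<Longrightarrow>
    bilinear_map sV sW (*) (\<lambda>v w. f v * h w)"
  by (intro bilinear_mapI linear_mult_left linear_mult_right)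

lemma bilinear_scale_right:
  "Vector_Spaces.linear sV (*) f \<Longrightarrow> vector_space sW \<Longrightarrow> bilinear_map sV sW sW (\<lambda>v w. sW (f v) w)"
  by (intro bilinear_mapI linear_scale_by linear_scale_fun linear_map_ident)

lemma bilinear_scale_left:
  "Vector_Spaces.linear sW (*) f \<Longrightarrow> vector_space sV \<Longrightarrow> bilinear_map sV sW sV (\<lambda>v w. sV (f w) v)"
  by (intro bilinear_mapI linear_scale_by linear_scale_fun linear_map_ident)

section \<open>Skew-primitive elements\<close>

text \<open>
  Extend a basis of \<open>D\<close> by elements of \<open>C\<close> to a basis of \<open>C + D\<close> and let \<open>p\<close> kill the added
  elements: then \<open>x - p x\<close> lies in \<open>C\<close> for every \<open>x \<in> C + D\<close>.
\<close>

lemma (in vector_space) projection_onto_subspace: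
  assumes "subspace C" "subspace D"
  obtains p where "Vector_Spaces.linear scale scale p" "\<And>x. x \<in> D \<Longrightarrow> p x = x"
    "\<And>x. x \<in> C \<Longrightarrow> p x \<in> C \<inter> D"
proof -
  interpret P: vector_space_pair scale scale ..
  obtain B where B: "B \<subseteq> D" "independent B" "D \<subseteq> span B"
    using maximal_independent_subset by metis
  have spB: "span B = D" using B assms(2) by (metis span_minimal subset_antisym)
  obtain E where E: "B \<subseteq> E" "E \<subseteq> B \<union> C" "independent E" "B \<union> C \<subseteq> span E"
    using maximal_independent_subset_extend[of B "B \<union> C"] B by blast
  obtain p where p: "Vector_Spaces.linear scale scale p" "\<forall>b\<in>E. p b = (if b \<in> B then b else 0)"
    using P.linear_independent_extend[OF E(3), of "\<lambda>b. if b \<in> B then b else 0"] by blast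
  note lin = linear_simps[OF p(1)]
  have 1: "p x = x" if "x \<in> D" for x
    using that[folded spB]
    by (induction rule: span_induct_alt) (use p(2) E(1) in \<open>auto simp: lin\<close>)
  have 2: "p x \<in> D \<and> x - p x \<in> C" if "x \<in> span E" for x
    using that
  proof (induction rule: span_induct_alt)
    case base
    then show ?case using assms by (simp add: lin subspace_0)
  next
    case (step c x y)
    have "p x \<in> D \<and> x - p x \<in> C"
      using step(1) p(2) E(2) B(1) assms by (auto simp: subspace_0)
    then have "scale c (p x) + p y \<in> D" "scale c (x - p x) + (y - p y) \<in> C"
      using step(2) assms by (auto intro: subspace_add subspace_scale)
    then show ?case by (simp add: lin algebra_simps)
  qed
  have 3: "p x \<in> C \<inter> D" if "x \<in> C" for x
  proof -
    have "x \<in> span E" using E(4) that by blast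
    with 2[OF this] subspace_diff[OF assms(1) that, of "x - p x"] show ?thesis by simp
  qed
  show ?thesis using that[OF p(1) 1 3] .
qed

lemma tensor_space_mono:
  "A \<subseteq> A' \<Longrightarrow> B \<subseteq> B' \<Longrightarrow> tensor_space sV sW A B \<subseteq> tensor_space sV sW A' B'"
proof -
  interpret T: vector_space tscale by (rule vector_space_tscale)
  show "A \<subseteq> A' \<Longrightarrow> B \<subseteq> B' \<Longrightarrow> ?thesis"
    unfolding tensor_space_def by (intro T.span_mono) auto
qed

lemma subspace_tensor_space: "module.subspace tscale (tensor_space sV sW A B)"
proof -
  interpret T: vector_space tscale by (rule vector_space_tscale)
  show ?thesis unfolding tensor_space_def by (rule T.subspace_span)
qed

lemma tens_in_tensor_space: "v \<in> A \<Longrightarrow> w \<in> B \<Longrightarrow> tens sV sW v w \<in> tensor_space sV sW A B"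
proof -
  interpret T: vector_space tscale by (rule vector_space_tscale)
  show "v \<in> A \<Longrightarrow> w \<in> B \<Longrightarrow> ?thesis"
    unfolding tensor_space_def by (rule T.span_base) auto
qed

context coalgebra
begin

lemma bilinear_tens_map:
  assumes "Vector_Spaces.linear s s p"
  shows "bilinear_map s s tscale (\<lambda>a b. tens s s (p a) (p b))"
  by (intro bilinear_mapI bilinear_comp_left[OF bilinear_tens] bilinear_comp_right[OF bilinear_tens]
      assms vector_space_axioms)

lemma tens_map_cong:
  assumes p: "Vector_Spaces.linear s s p" and t: "t \<in> tensor_space s s D D" and D: "subspace D"
    and p': "Vector_Spaces.linear s s p'" and eq: "\<And>x. x \<in> D \<Longrightarrow> p x = p' x"
  shows "tlift s s t (\<lambda>a b. tens s s (p a) (p b)) = tlift s s t (\<lambda>a b. tens s s (p' a) (p' b))"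
proof -
  obtain xs where xs: "t = (\<Sum>(v, w)\<leftarrow>xs. tens s s v w)" "set xs \<subseteq> D \<times> D"
    using tensor_space_rep[OF vector_space_axioms vector_space_axioms t D] .
  show ?thesis
    unfolding xs(1) tlift_sum_list[OF bilinear_tens_map[OF p]] tlift_sum_list[OF bilinear_tens_map[OF p']]
    by (rule arg_cong[where f = sum_list], rule map_cong) (use xs(2) eq in auto)
qed

lemma tens_map_ident:
  assumes p: "Vector_Spaces.linear s s p" and t: "t \<in> tensor_space s s D D" and D: "subspace D"
    and eq: "\<And>x. x \<in> D \<Longrightarrow> p x = x"
  shows "tlift s s t (\<lambda>a b. tens s s (p a) (p b)) = t"
proof -
  note lid = linear_map_ident[OF vector_space_axioms]
  obtain xs where xs: "t = (\<Sum>(v, w)\<leftarrow>xs. tens s s v w)"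
    using tensor_space_rep[OF vector_space_axioms vector_space_axioms t D] by metis
  have "tlift s s t (\<lambda>a b. tens s s (p a) (p b)) = tlift s s t (\<lambda>a b. tens s s a b)"
    using tens_map_cong[OF p t D lid] eq by simp
  also have "\<dots> = t"
    unfolding xs tlift_sum_list[OF bilinear_tens_map[OF lid]] ..
  finally show ?thesis .
qed

lemma tens_map_in:
  assumes p: "Vector_Spaces.linear s s p" and t: "t \<in> tensor_space s s C C" and C: "subspace C"
    and im: "\<And>x. x \<in> C \<Longrightarrow> p x \<in> E"
  shows "tlift s s t (\<lambda>a b. tens s s (p a) (p b)) \<in> tensor_space s s E E"
proof -
  interpret T: vector_space tscale by (rule vector_space_tscale)
  obtain xs where xs: "t = (\<Sum>(v, w)\<leftarrow>xs. tens s s v w)" "set xs \<subseteq> C \<times> C"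
    using tensor_space_rep[OF vector_space_axioms vector_space_axioms t C] .
  have "(\<Sum>(v, w)\<leftarrow>xs. tens s s (p v) (p w)) \<in> tensor_space s s E E"
    using xs(2)
  proof (induction xs)
    case Nil
    then show ?case using T.subspace_0[OF subspace_tensor_space] by (simp del: zero_fun_apply)
  next
    case (Cons x xs)
    have "tens s s (p (fst x)) (p (snd x)) + (\<Sum>(v, w)\<leftarrow>xs. tens s s (p v) (p w)) \<in> tensor_space s s E E"
      by (rule T.subspace_add[OF subspace_tensor_space tens_in_tensor_space Cons.IH])
         (use Cons.prems im in auto)
    then show ?case by (simp only: split_def list.map sum_list.Cons)
  qed
  then show ?thesis
    unfolding xs(1) tlift_sum_list[OF bilinear_tens_map[OF p]] .
qed

text \<open>
  Apply \<open>p \<otimes> p\<close>, where \<open>p\<close> projects onto \<open>D\<close> and maps \<open>C\<close> into \<open>C \<inter> D\<close>: it fixes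
  \<open>D \<otimes> D\<close> and sends \<open>C \<otimes> C\<close> into \<open>(C \<inter> D) \<otimes> (C \<inter> D)\<close>.
\<close>

lemma subcoalgebra_inter:
  assumes "subcoalgebra s \<delta> C" "subcoalgebra s \<delta> D"
  shows "subcoalgebra s \<delta> (C \<inter> D)"
proof -
  have sub: "subspace C" "subspace D" using assms by (auto simp: subcoalgebra_def)
  obtain p where p: "Vector_Spaces.linear s s p" "\<And>x. x \<in> D \<Longrightarrow> p x = x"
    "\<And>x. x \<in> C \<Longrightarrow> p x \<in> C \<inter> D"
    using projection_onto_subspace[OF sub] by blast
  have "\<delta> x \<in> tensor_space s s (C \<inter> D) (C \<inter> D)" if "x \<in> C \<inter> D" for x
  proof -
    have "\<delta> x \<in> tensor_space s s C C" "\<delta> x \<in> tensor_space s s D D"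
      using assms that by (auto simp: subcoalgebra_def)
    then show ?thesis
      using tens_map_in[OF p(1) _ sub(1) p(3)] tens_map_ident[OF p(1) _ sub(2) p(2)] by metis
  qed
  then show ?thesis using sub by (auto simp: subcoalgebra_def subspace_inter)
qed

lemma subcoalgebra_span:
  assumes "\<And>a. a \<in> A \<Longrightarrow> \<delta> a \<in> tensor_space s s (span A) (span A)"
  shows "subcoalgebra s \<delta> (span A)"
proof -
  interpret T: vector_space tscale by (rule vector_space_tscale)
  note T_sub = subspace_tensor_space[of s s "span A" "span A"]
  have "\<delta> x \<in> tensor_space s s (span A) (span A)" if "x \<in> span A" for x
    using that
  proof (induction rule: span_induct_alt)
    case base
    show ?case unfolding linear_simps(3)[OF comult_linear] by (rule T.subspace_0[OF T_sub])
  next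
    case (step c x y)
    show ?case unfolding linear_simps(1,2)[OF comult_linear]
      by (intro T.subspace_add[OF T_sub] T.subspace_scale[OF T_sub] step assms)
  qed
  then show ?thesis by (auto simp: subcoalgebra_def)
qed

lemma comult_eq_0: "\<delta> x = 0 \<Longrightarrow> x = 0"
  using counit_left[of x] tlift_zero[OF bilinear_scale_right[OF counit_linear vector_space_axioms]]
  by simp

text \<open>
  The coalgebra is a sum of simple subcoalgebras. They may be removed from a sum containing \<open>z\<close>
  one at a time: a simple subcoalgebra \<open>D\<close> either lies in the sum of the others or meets it in
  \<open>0\<close>, and then \<open>p \<otimes> p\<close>, for a projection \<open>p\<close> onto \<open>D\<close> that kills the others, kills
  \<open>\<delta> z = z \<otimes> e + \<gamma> \<otimes> z\<close>, so that \<open>z\<close> has no component in \<open>D\<close>.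
\<close>

lemma skew_primitive_in_span_if_cosemisimple:
  assumes "cosemisimple s \<delta>"
    and e: "\<delta> e = tens s s e e" and \<gamma>: "\<delta> \<gamma> = tens s s \<gamma> \<gamma>"
    and z: "\<delta> z = tens s s z e + tens s s \<gamma> z"
  shows "z \<in> span {e, \<gamma>}"
proof -
  have remove: "z \<in> span {e, \<gamma>}"
    if "finite F" "\<And>D. D \<in> F \<Longrightarrow> simple_subcoalgebra s \<delta> D" "z \<in> span ({e, \<gamma>} \<union> \<Union>F)" for F
    using that
  proof (induction F rule: finite_induct)
    case empty
    then show ?case by simp
  next
    case (insert D F)
    let ?A = "{e, \<gamma>} \<union> \<Union>F"
    have simple: "simple_subcoalgebra s \<delta> D" and D: "subcoalgebra s \<delta> D"
      using insert by (auto simp: simple_subcoalgebra_def)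
    have C: "subcoalgebra s \<delta> (span ?A)"
    proof (rule subcoalgebra_span)
      fix a assume a: "a \<in> ?A"
      consider "a = e" | "a = \<gamma>" | E where "E \<in> F" "a \<in> E" using a by auto
      then show "\<delta> a \<in> tensor_space s s (span ?A) (span ?A)"
      proof cases
        case 3
        then have "\<delta> a \<in> tensor_space s s E E"
          using insert.prems(1)[of E] by (auto simp: simple_subcoalgebra_def subcoalgebra_def)
        moreover have "E \<subseteq> span ?A" using 3 span_superset[of ?A] by blast
        ultimately show ?thesis using tensor_space_mono by blast
      qed (simp_all add: e \<gamma> tens_in_tensor_space span_base)
    qed
    have sub: "subspace (span ?A)" "subspace D" using D by (auto simp: subcoalgebra_def)
    have "span ?A \<inter> D = {0} \<or> span ?A \<inter> D = D"
      using subcoalgebra_inter[OF C D] simple by (auto simp: simple_subcoalgebra_def)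
    then show ?case
    proof
      assume "span ?A \<inter> D = D"
      then have "{e, \<gamma>} \<union> \<Union>(insert D F) \<subseteq> span ?A" using span_superset[of ?A] by auto
      then have "z \<in> span ?A"
        using insert.prems(2) span_minimal[OF _ sub(1)] by blast
      then show ?thesis using insert by simp
    next
      assume triv: "span ?A \<inter> D = {0}"
      obtain p where p: "Vector_Spaces.linear s s p" "\<And>x. x \<in> D \<Longrightarrow> p x = x"
        "\<And>x. x \<in> span ?A \<Longrightarrow> p x \<in> span ?A \<inter> D"
        using projection_onto_subspace[OF sub] by blast
      let ?P = "\<lambda>t. tlift s s t (\<lambda>a b. tens s s (p a) (p b))"
      note bil = bilinear_tens[OF vector_space_axioms vector_space_axioms]
      have p0: "p x = 0" if "x \<in> span ?A" for x using p(3)[OF that] triv by auto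
      have linP: "Vector_Spaces.linear s tscale (\<lambda>x. ?P (\<delta> x))"
        by (rule linear_tlift_tensor[OF bilinear_tens_map[OF p(1)] comult_linear comult_in])
      have "z \<in> span (?A \<union> D)"
        using insert.prems(2) by (simp add: Un_ac)
      then obtain c x where cx: "z = c + x" "c \<in> span ?A" "x \<in> D"
        using span_Un[of ?A D] span_eq_iff[of D] sub(2) by (auto simp only: mem_Collect_eq)
      have zero: "?P t = 0" if "t \<in> tensor_space s s (span ?A) (span ?A)" for t
      proof -
        have "Vector_Spaces.linear s s (\<lambda>_. 0)"
          by (simp add: Vector_Spaces.linear_iff vector_space_axioms)
        from tens_map_cong[OF p(1) that sub(1) this p0]
        have "?P t = tlift s s t (\<lambda>a b. tens s s 0 0)" by simp
        also have "\<dots> = 0"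
          by (simp only: tlift_def bilinear_simps(3)[OF bil] split_def sum_list_0)
        finally show ?thesis .
      qed
      have "\<delta> x = ?P (\<delta> x)"
        using tens_map_ident[OF p(1) _ sub(2) p(2)] D cx(3) by (auto simp: subcoalgebra_def)
      also have "\<dots> = ?P (\<delta> z) - ?P (\<delta> c)"
        unfolding linear_simps(1)[OF linP] cx(1) by simp
      also have "?P (\<delta> c) = 0"
        using C cx(2) by (intro zero) (auto simp: subcoalgebra_def)
      also have "?P (\<delta> z) = 0"
      proof -
        have "\<delta> z = (\<Sum>(v, w)\<leftarrow>[(z, e), (\<gamma>, z)]. tens s s v w)" by (simp add: z)
        then have "?P (\<delta> z) = (\<Sum>(v, w)\<leftarrow>[(z, e), (\<gamma>, z)]. tens s s (p v) (p w))"
          by (simp only: tlift_sum_list[OF bilinear_tens_map[OF p(1)]])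
        then show ?thesis using p0[of e] p0[of \<gamma>]
          by (simp add: span_base bilinear_simps[OF bil])
      qed
      finally have "x = 0" by (intro comult_eq_0) (simp only: diff_zero)
      then show ?thesis using insert cx by simp
    qed
  qed
  have "z \<in> span (\<Union>{D. simple_subcoalgebra s \<delta> D})"
    using assms(1) by (simp add: cosemisimple_def coradical_def)
  then have "\<exists>F. finite F \<and> F \<subseteq> {D. simple_subcoalgebra s \<delta> D} \<and> z \<in> span (\<Union>F)"
  proof (induction rule: span_induct_alt)
    case base
    show ?case by (intro exI[of _ "{}"]) simp
  next
    case (step c x y)
    then obtain F D where F: "finite F" "F \<subseteq> {D. simple_subcoalgebra s \<delta> D}" "y \<in> span (\<Union>F)"
      "simple_subcoalgebra s \<delta> D" "x \<in> D" by auto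
    have "s c x + y \<in> span (\<Union>(insert D F))"
      using F span_mono[of "\<Union>F" "\<Union>(insert D F)"] by (intro span_add span_scale) (auto intro: span_base)
    then show ?case using F by (intro exI[of _ "insert D F"]) auto
  qed
  then obtain F where "finite F" "F \<subseteq> {D. simple_subcoalgebra s \<delta> D}" "z \<in> span (\<Union>F)" by blast
  then show ?thesis using remove[of F] span_mono[of "\<Union>F" "{e, \<gamma>} \<union> \<Union>F"] by blast
qed

text \<open>
  The map \<open>(id \<otimes> f) \<circ> \<delta>\<close>, i.e. the action of a functional on the coalgebra. It turns identities
  between tensors into identities between elements.
\<close>

definition slice :: "('c \<Rightarrow> 'k) \<Rightarrow> 'c \<Rightarrow> 'c" where
  "slice f x = tlift s s (\<delta> x) (\<lambda>a b. s (f b) a)"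

lemma linear_slice: "Vector_Spaces.linear s (*) f \<Longrightarrow> Vector_Spaces.linear s s (slice f)"
  unfolding slice_def
  by (rule linear_tlift_tensor[OF bilinear_scale_left comult_linear comult_in])
     (auto simp: vector_space_axioms)

lemma slice_sum_list:
  assumes "Vector_Spaces.linear s (*) f" "\<delta> x = (\<Sum>(v, w)\<leftarrow>xs. tens s s v w)"
  shows "slice f x = (\<Sum>(v, w)\<leftarrow>xs. s (f w) v)"
  unfolding slice_def assms(2)
  by (rule tlift_sum_list[OF bilinear_scale_left[OF assms(1) vector_space_axioms]])

end

context hopf_algebra
begin

lemma comult_mult_sum_list:
  assumes h: "\<Delta> h = (\<Sum>(a, b)\<leftarrow>xs. tens sH sH a b)" and k: "\<Delta> k = (\<Sum>(c, e)\<leftarrow>ys. tens sH sH c e)"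
  shows "\<Delta> (h * k) = (\<Sum>(a, b)\<leftarrow>xs. \<Sum>(c, e)\<leftarrow>ys. tens sH sH (a * c) (b * e))"
proof -
  note bil = bilinear_tens[OF vector_space_axioms vector_space_axioms]
  note lin = bilinear_comp_left[OF bil] bilinear_comp_right[OF bil]
    bilinear_comp_left[OF mult_bilinear] bilinear_comp_right[OF mult_bilinear]
    linear_map_ident[OF vector_space_axioms]
  have 1: "bilinear_map sH sH tscale (\<lambda>c e. tens sH sH (a * c) (b * e))" for a b
    by (intro bilinear_mapI lin)
  have 2: "bilinear_map sH sH tscale (\<lambda>a b. \<Sum>(c, e)\<leftarrow>ys. tens sH sH (a * c) (b * e))"
    by (intro bilinear_mapI linear_sum_list_fun vector_space_axioms vector_space_tscale lin)
  show ?thesis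
    unfolding comult_mult h k tlift_sum_list[OF 1] tlift_sum_list[OF 2] ..
qed

lemma grouplike_one: "grouplike 1"
  by (simp add: grouplike_def comult_one counit_one)

lemma grouplike_mult: "grouplike a \<Longrightarrow> grouplike b \<Longrightarrow> grouplike (a * b)"
  using comult_mult_sum_list[of a "[(a, a)]" b "[(b, b)]"]
  by (simp add: grouplike_def counit_mult)

lemma grouplike_power: "grouplike a \<Longrightarrow> grouplike (a ^ n)"
  by (induction n) (auto simp: grouplike_one intro: grouplike_mult)

lemma grouplike_antipode:
  assumes "grouplike a"
  shows "S a * a = 1" "a * S a = 1"
proof -
  note lin = bilinear_comp_left[OF mult_bilinear] bilinear_comp_right[OF mult_bilinear]
    linear_map_ident[OF vector_space_axioms] antipode_linear
  have "bilinear_map sH sH sH (\<lambda>a b. S a * b)" "bilinear_map sH sH sH (\<lambda>a b. a * S b)"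
    by (intro bilinear_mapI lin)+
  then show "S a * a = 1" "a * S a = 1"
    using antipode_left[of a] antipode_right[of a] assms
    by (simp_all add: grouplike_def tlift_tens)
qed

lemma slice_grouplike:
  assumes "Vector_Spaces.linear sH (*) f" "grouplike a"
  shows "slice f a = sH (f a) a"
  using slice_sum_list[OF assms(1), of a "[(a, a)]"] assms(2) by (simp add: grouplike_def)

text \<open>
  Linear independence of group-like elements: in a relation \<open>e = \<Sum> r\<^sub>b b\<close>, slicing by the functional
  dual to \<open>b\<close> gives \<open>r\<^sub>b e = r\<^sub>b b\<close>.
\<close>

lemma grouplike_notin_span:
  assumes e: "grouplike e" and G: "\<And>a. a \<in> G \<Longrightarrow> grouplike a \<and> a \<noteq> e"
  shows "e \<notin> span G"
proof
  assume "e \<in> span G"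
  moreover obtain B where B: "B \<subseteq> G" "independent B" "G \<subseteq> span B"
    using maximal_independent_subset by metis
  ultimately have "e \<in> span B" by (metis span_mono span_span subsetD)
  then obtain t r where t: "finite t" "t \<subseteq> B" "e = (\<Sum>a\<in>t. sH (r a) a)"
    unfolding span_explicit by blast
  have "r b = 0" if b: "b \<in> t" for b
  proof -
    have "b \<notin> span (B - {b})" using B(2) b t(2) by (auto simp: dependent_def)
    then obtain f where f: "Vector_Spaces.linear sH (*) f" "f b = 1" "\<And>a. a \<in> span (B - {b}) \<Longrightarrow> f a = 0"
      using separating_functional by metis
    have f': "f a = (if a = b then 1 else 0)" if "a \<in> t" for a
      using f(2,3) t(2) that by (auto intro: span_base)
    have "f e = (\<Sum>a\<in>t. r a * f a)" unfolding t(3) by (simp add: linear_simps[OF f(1)])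
    also have "\<dots> = (\<Sum>a\<in>t. if a = b then r a else 0)" by (intro sum.cong) (auto simp: f')
    finally have fe: "f e = r b" using t(1) b by simp
    have "slice f e = (\<Sum>a\<in>t. sH (r a) (slice f a))"
      by (subst t(3)) (simp add: linear_simps[OF linear_slice[OF f(1)]])
    also have "\<dots> = (\<Sum>a\<in>t. if a = b then sH (r b) b else 0)"
      by (intro sum.cong) (use t(2) B(1) G in \<open>auto simp: f' slice_grouplike[OF f(1)]\<close>)
    finally have "sH (r b) e = sH (r b) b"
      using t(1) b by (simp add: slice_grouplike[OF f(1) e] fe)
    moreover have "e \<noteq> b" using G b t(2) B(1) by auto
    ultimately show ?thesis by (metis scale_cancel_left)
  qed
  then have "e = 0" using t(3) by simp
  then show False using e linear_simps(3)[OF counit_linear] by (simp add: grouplike_def)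
qed

definition skew_primitive :: "'h \<Rightarrow> 'h \<Rightarrow> bool" where
  "skew_primitive \<gamma> z \<longleftrightarrow> \<Delta> z = tens sH sH z 1 + tens sH sH \<gamma> z"

lemma skew_primitive_sum_list:
  "skew_primitive \<gamma> z \<Longrightarrow> \<Delta> z = (\<Sum>(v, w)\<leftarrow>[(z, 1), (\<gamma>, z)]. tens sH sH v w)"
  by (simp add: skew_primitive_def)

text \<open>
  Slice by a functional \<open>f\<close> with \<open>f 1 = 1\<close> that kills the other group-like elements: on the span of
  the group-like elements this picks out a multiple of \<open>1\<close>, and \<open>z\<close> is sent to \<open>z + f(z) \<gamma>\<close>.
\<close>

lemma skew_primitive_in_span_grouplikes:
  assumes z: "skew_primitive \<gamma> z" and span: "z \<in> span G" and G: "\<And>a. a \<in> G \<Longrightarrow> grouplike a"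
  obtains l where "z = sH l (1 - \<gamma>)"
proof -
  have "1 \<notin> span (G - {1})"
    using G by (intro grouplike_notin_span grouplike_one) auto
  then obtain f where f: "Vector_Spaces.linear sH (*) f" "f 1 = 1" "\<And>a. a \<in> span (G - {1}) \<Longrightarrow> f a = 0"
    using separating_functional by metis
  note lin = linear_simps[OF f(1)] linear_simps[OF linear_slice[OF f(1)]]
  have sl0: "slice f a = 0" if "a \<in> span (G - {1})" for a
    using that
    by (induction rule: span_induct_alt)
       (use f(3) G in \<open>auto simp: lin slice_grouplike[OF f(1)] span_base\<close>)
  have "z \<in> span (insert 1 (G - {1}))"
    using span span_mono[of G "insert 1 (G - {1})"] by auto
  then obtain l where l: "z - sH l 1 \<in> span (G - {1})"
    unfolding span_breakdown_eq by blast
  have "f z = l" using f(3)[OF l] by (simp add: lin f(2))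
  moreover have "slice f z = sH l 1"
    using sl0[OF l] by (simp add: lin slice_grouplike[OF f(1) grouplike_one] f(2))
  moreover have "slice f z = z + sH (f z) \<gamma>"
    using slice_sum_list[OF f(1) skew_primitive_sum_list[OF z]] f(2) by simp
  ultimately have "z = sH l (1 - \<gamma>)" by (simp add: scale_right_diff_distrib algebra_simps)
  then show ?thesis by (rule that)
qed

text \<open>
  Read as a recursion over the power of \<open>z\<close>, this computes slices of \<open>\<gamma>\<^sup>i z\<^sup>j\<close> without
  expanding \<open>\<Delta> (z\<^sup>j)\<close>; the functional changes along the way.
\<close>

lemma slice_mult_skew_primitive:
  assumes f: "Vector_Spaces.linear sH (*) f" and z: "skew_primitive \<gamma> z"
  shows "slice f (h * z) = slice f h * z + slice (\<lambda>b. f (b * z)) h * \<gamma>"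
proof -
  have f': "Vector_Spaces.linear sH (*) (\<lambda>b. f (b * z))"
    by (rule linear_comp[OF f bilinear_comp_left[OF mult_bilinear linear_map_ident[OF vector_space_axioms]]])
  obtain xs where xs: "\<Delta> h = (\<Sum>(v, w)\<leftarrow>xs. tens sH sH v w)"
    using tensor_space_UNIV_rep[OF vector_space_axioms vector_space_axioms comult_in] .
  have "\<Delta> (h * z) = (\<Sum>(v, w)\<leftarrow>xs. \<Sum>(c, e)\<leftarrow>[(z, 1), (\<gamma>, z)]. tens sH sH (v * c) (w * e))"
    by (rule comult_mult_sum_list[OF xs skew_primitive_sum_list[OF z]])
  also have "\<dots> = (\<Sum>(v, w)\<leftarrow>concat (map (\<lambda>(v, w). [(v * z, w), (v * \<gamma>, w * z)]) xs). tens sH sH v w)"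
    by (induction xs) (auto simp: algebra_simps)
  finally have "slice f (h * z)
      = (\<Sum>(v, w)\<leftarrow>concat (map (\<lambda>(v, w). [(v * z, w), (v * \<gamma>, w * z)]) xs). sH (f w) v)"
    by (rule slice_sum_list[OF f])
  also have "\<dots> = (\<Sum>(v, w)\<leftarrow>xs. sH (f w) v) * z + (\<Sum>(v, w)\<leftarrow>xs. sH (f (w * z)) v) * \<gamma>"
    by (induction xs) (auto simp: algebra_simps bilinear_simps[OF mult_bilinear])
  finally show ?thesis by (simp add: slice_sum_list[OF f xs] slice_sum_list[OF f' xs])
qed

end

locale hopf_algebra_char_0 = hopf_algebra sH \<Delta> \<epsilon>H S
  for sH :: "'k::field_char_0 \<Rightarrow> 'h::ring_1 \<Rightarrow> 'h"
    and \<Delta> :: "'h \<Rightarrow> ('k, 'h, 'h) tensor" and \<epsilon>H :: "'h \<Rightarrow> 'k" and S :: "'h \<Rightarrow> 'h"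
begin

text \<open>
  Being linearly independent, the group-like elements are finite in number.
\<close>

lemma finite_order_grouplike:
  assumes "finite_dimensional sH" "grouplike a"
  obtains n where "n > 0" "a ^ n = 1"
proof -
  obtain B where B: "finite B" "span B = UNIV" using assms(1) by (auto simp: finite_dimensional_def)
  have "independent {b. grouplike b}"
    unfolding dependent_def
  proof clarify
    fix e assume "e \<in> span ({b. grouplike b} - {e})" "grouplike e"
    then show False using grouplike_notin_span[of e "{b. grouplike b} - {e}"] by auto
  qed
  then have "finite {b. grouplike b}"
    using independent_span_bound[OF B(1)] B(2) by auto
  then have "finite (range (\<lambda>n. a ^ n))"
    by (rule rev_finite_subset) (auto intro: grouplike_power assms(2))
  then have "\<not> inj (\<lambda>n. a ^ n)" using finite_imageD infinite_UNIV_nat by blast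
  then obtain i j where "a ^ i = a ^ j" "i \<noteq> j" by (auto simp: inj_on_def)
  then obtain i j where ij: "a ^ i = a ^ j" "i < j" by (metis nat_neq_iff)
  have inv: "S a ^ i * a ^ i = 1"
    using left_right_inverse_power[OF grouplike_antipode(1)[OF assms(2)]] .
  have "a ^ j = a ^ i * a ^ (j - i)" using ij(2) by (simp flip: power_add)
  then have "S a ^ i * a ^ i = (S a ^ i * a ^ i) * a ^ (j - i)"
    using ij(1) by (metis mult.assoc)
  then show ?thesis using that[of "j - i"] ij inv by simp
qed

text \<open>
  Let \<open>V n\<close> be spanned by the \<open>\<gamma>\<^sup>i z\<^sup>j\<close> with \<open>j < n\<close>. A functional \<open>f\<close> that kills the powers of
  \<open>\<gamma>\<close> makes \<open>slice f\<close> lower the degree in \<open>z\<close>, with leading term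
  \<open>z\<^sup>n \<mapsto> n f(z) \<gamma> z\<^sup>n\<^sup>-\<^sup>1\<close>. In characteristic \<open>0\<close> a relation \<open>z\<^sup>n \<in> V n\<close>, which exists in
  finite dimension, thus descends to \<open>z \<in> V 1\<close>.
\<close>

lemma skew_primitive_in_span_powers:
  assumes fd: "finite_dimensional sH" and \<gamma>: "grouplike \<gamma>" and z: "skew_primitive \<gamma> z"
    and comm: "\<gamma> * z = z * \<gamma>"
  shows "z \<in> span (range (\<lambda>i. \<gamma> ^ i))"
proof (rule ccontr)
  define V where "V n = span {\<gamma> ^ i * z ^ j | i j. j < n}" for n :: nat
  have comm': "\<gamma> ^ i * z ^ j = z ^ j * \<gamma> ^ i" for i j
    by (metis comm power_commuting_commutes)
  have V_mem: "\<gamma> ^ i * z ^ j \<in> V n" if "j < n" for i j n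
    unfolding V_def using that by (intro span_base) auto
  have V_mult: "h * k \<in> V n'" if h: "h \<in> V n" and k: "\<And>i j. j < n \<Longrightarrow> (\<gamma> ^ i * z ^ j) * k \<in> V n'" for h k n n'
    using h unfolding V_def[of n]
  proof (induction rule: span_induct_alt)
    case base
    then show ?case by (simp add: V_def span_zero del: mem_Collect_eq)
  next
    case (step c x y)
    then have "x * k \<in> V n'" using k by auto
    then have "sH c (x * k) + y * k \<in> V n'"
      using step(2) unfolding V_def by (intro span_add span_scale)
    then show ?case by (simp only: distrib_right bilinear_simps(2)[OF mult_bilinear])
  qed
  have V_mono: "V n \<subseteq> V n'" if "n \<le> n'" for n n'
    unfolding V_def using that by (intro span_mono) (auto intro: less_le_trans)
  have V_z: "h * z \<in> V (Suc n)" if "h \<in> V n" for h n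
  proof (rule V_mult[OF that])
    fix i j :: nat assume "j < n"
    then show "\<gamma> ^ i * z ^ j * z \<in> V (Suc n)"
      using V_mem[of "Suc j" "Suc n" i] by (simp only: mult.assoc power_Suc2)
  qed
  have V_\<gamma>: "h * \<gamma> ^ m \<in> V n" if "h \<in> V n" for h n m
  proof (rule V_mult[OF that])
    fix i j :: nat assume "j < n"
    then show "\<gamma> ^ i * z ^ j * \<gamma> ^ m \<in> V n"
      using V_mem[of j n "i + m"] by (simp add: mult.assoc power_add flip: comm')
  qed
  have lead: "slice f (\<gamma> ^ i * z ^ j) - sH (f (\<gamma> ^ i)) (\<gamma> ^ i * z ^ j)
      - sH (of_nat j * f (\<gamma> ^ i * z)) (\<gamma> ^ Suc i * z ^ (j - 1)) \<in> V (j - 1)"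
    if "Vector_Spaces.linear sH (*) f" for f i j
    using that
  proof (induction j arbitrary: f)
    case 0
    then show ?case by (simp add: V_def slice_grouplike[OF 0 grouplike_power[OF \<gamma>]])
  next
    case (Suc j)
    let ?f = "\<lambda>b. f (b * z)"
    have lf: "Vector_Spaces.linear sH (*) ?f"
      by (rule linear_comp[OF Suc.prems bilinear_comp_left[OF mult_bilinear linear_map_ident[OF vector_space_axioms]]])
    define A where "A = slice f (\<gamma> ^ i * z ^ j) - sH (f (\<gamma> ^ i)) (\<gamma> ^ i * z ^ j)
      - sH (of_nat j * f (\<gamma> ^ i * z)) (\<gamma> ^ Suc i * z ^ (j - 1))"
    define B where "B = slice ?f (\<gamma> ^ i * z ^ j) - sH (?f (\<gamma> ^ i)) (\<gamma> ^ i * z ^ j)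
      - sH (of_nat j * ?f (\<gamma> ^ i * z)) (\<gamma> ^ Suc i * z ^ (j - 1))"
    have AB: "A \<in> V (j - 1)" "B \<in> V (j - 1)"
      using Suc.IH[OF Suc.prems] Suc.IH[OF lf] by (simp_all add: A_def B_def)
    have A: "A * z \<in> V j"
    proof (cases j)
      case 0
      then show ?thesis using AB(1) by (simp add: V_def)
    next
      case (Suc k)
      then show ?thesis using V_z[OF AB(1)] by simp
    qed
    have B: "B * \<gamma> \<in> V j"
      using V_\<gamma>[OF AB(2), of 1] V_mono[of "j - 1" j] by auto
    let ?r = "sH (of_nat j * f (\<gamma> ^ i * z * z)) (\<gamma> ^ Suc (Suc i) * z ^ (j - 1))"
    have r: "?r \<in> V j"
    proof (cases j)
      case 0
      then show ?thesis by (simp add: V_def)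
    next
      case (Suc k)
      then have "\<gamma> ^ Suc (Suc i) * z ^ (j - 1) \<in> V j" using V_mem[of "j - 1" j "Suc (Suc i)"] by simp
      then show ?thesis unfolding V_def by (rule span_scale)
    qed
    have j1: "sH (of_nat j * c) (\<gamma> ^ Suc i * z ^ (j - 1)) * z = sH (of_nat j * c) (\<gamma> ^ Suc i * z ^ j)" for c
      by (cases j) (simp_all add: bilinear_simps[OF mult_bilinear] mult.assoc power_commutes)
    have c1: "\<gamma> ^ a * z ^ b * \<gamma> = \<gamma> ^ Suc a * z ^ b" for a b
      using comm'[of 1 b] by (simp add: mult.assoc power_commutes)
         (metis mult.assoc power_commutes)
    have "slice f (\<gamma> ^ i * z ^ Suc j) = slice f (\<gamma> ^ i * z ^ j) * z + slice ?f (\<gamma> ^ i * z ^ j) * \<gamma>"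
      using slice_mult_skew_primitive[OF Suc.prems z, of "\<gamma> ^ i * z ^ j"]
      by (simp only: mult.assoc power_Suc2)
    also have "slice f (\<gamma> ^ i * z ^ j) * z = A * z + sH (f (\<gamma> ^ i)) (\<gamma> ^ i * z ^ Suc j)
        + sH (of_nat j * f (\<gamma> ^ i * z)) (\<gamma> ^ Suc i * z ^ j)"
      unfolding A_def left_diff_distrib j1
      by (simp add: bilinear_simps[OF mult_bilinear] mult.assoc power_commutes)
    also have "slice ?f (\<gamma> ^ i * z ^ j) * \<gamma> = B * \<gamma> + sH (f (\<gamma> ^ i * z)) (\<gamma> ^ Suc i * z ^ j) + ?r"
      unfolding B_def left_diff_distrib bilinear_simps(2)[OF mult_bilinear] c1 by simp
    finally have "slice f (\<gamma> ^ i * z ^ Suc j) - sH (f (\<gamma> ^ i)) (\<gamma> ^ i * z ^ Suc j)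
      - sH (of_nat (Suc j) * f (\<gamma> ^ i * z)) (\<gamma> ^ Suc i * z ^ (Suc j - 1)) = A * z + B * \<gamma> + ?r"
      by (simp add: scale_left_distrib distrib_right)
    then show ?case using A B r by (simp only: diff_Suc_1 V_def) (intro span_add)
  qed
  assume notin: "z \<notin> span (range (\<lambda>i. \<gamma> ^ i))"
  then obtain f where f: "Vector_Spaces.linear sH (*) f" "f z = 1"
    "\<And>a. a \<in> span (range (\<lambda>i. \<gamma> ^ i)) \<Longrightarrow> f a = 0"
    using separating_functional by metis
  have f\<gamma>: "f (\<gamma> ^ i) = 0" for i using f(3) by (simp add: span_base)
  have lower: "slice f h \<in> V n" if "h \<in> V (Suc n)" for h n
    using that unfolding V_def[of "Suc n"]
  proof (induction rule: span_induct_alt)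
    case base
    then show ?case by (simp add: V_def span_zero linear_simps(3)[OF linear_slice[OF f(1)]])
  next
    case (step c x y)
    then obtain i j where ij: "x = \<gamma> ^ i * z ^ j" "j < Suc n" by auto
    have "slice f x - sH (of_nat j * f (\<gamma> ^ i * z)) (\<gamma> ^ Suc i * z ^ (j - 1)) \<in> V n"
      using lead[OF f(1), of i j] subsetD[OF V_mono, of "j - 1" n] ij by (simp add: f\<gamma>)
    moreover have "sH (of_nat j * f (\<gamma> ^ i * z)) (\<gamma> ^ Suc i * z ^ (j - 1)) \<in> V n"
    proof (cases j)
      case 0
      then show ?thesis by (simp add: V_def span_zero)
    next
      case (Suc k)
      then have "\<gamma> ^ Suc i * z ^ (j - 1) \<in> V n" using V_mem[of "j - 1" n "Suc i"] ij(2) by simp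
      then show ?thesis unfolding V_def by (rule span_scale)
    qed
    ultimately have "slice f x \<in> V n"
      unfolding V_def using span_add by fastforce
    then have "sH c (slice f x) + slice f y \<in> V n"
      using step(2) unfolding V_def by (intro span_add span_scale)
    then show ?case by (simp only: linear_simps[OF linear_slice[OF f(1)]])
  qed
  obtain M where M: "M > 0" "\<gamma> ^ M = 1" using finite_order_grouplike[OF fd \<gamma>] .
  (* The factor \<gamma> of the leading term is removed by multiplying with \<gamma>\<^sup>M\<^sup>-\<^sup>1. *)
  have desc: "z ^ n \<in> V n" if "z ^ Suc n \<in> V (Suc n)" "n \<ge> 1" for n
  proof -
    have "slice f (z ^ Suc n) \<in> V n" by (rule lower[OF that(1)])
    moreover have "slice f (z ^ Suc n) - sH (of_nat (Suc n)) (\<gamma> * z ^ n) \<in> V n"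
      using lead[OF f(1), of 0 "Suc n"] f\<gamma>[of 0] by (simp add: f(2))
    ultimately have "slice f (z ^ Suc n) - (slice f (z ^ Suc n) - sH (of_nat (Suc n)) (\<gamma> * z ^ n)) \<in> V n"
      unfolding V_def by (rule span_diff)
    then have "sH (of_nat (Suc n)) (\<gamma> * z ^ n) \<in> V n" by simp
    then have "sH (inverse (of_nat (Suc n))) (sH (of_nat (Suc n)) (\<gamma> * z ^ n)) \<in> V n"
      unfolding V_def by (rule span_scale)
    then have "\<gamma> * z ^ n \<in> V n" by (simp del: of_nat_Suc)
    moreover have "\<gamma> * z ^ n * \<gamma> ^ (M - 1) = z ^ n * \<gamma> ^ M"
      using M(1) comm'[of 1 n] by (cases M) (simp_all add: mult.assoc)
    ultimately have "z ^ n * \<gamma> ^ M \<in> V n" using V_\<gamma> by metis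
    then show ?thesis using M(2) by simp
  qed
  obtain B where B: "finite B" "span B = UNIV" using fd by (auto simp: finite_dimensional_def)
  have "\<exists>n\<ge>1. z ^ n \<in> V n"
  proof (rule ccontr)
    assume "\<not> ?thesis"
    then have no: "z ^ n \<notin> V n" if "n \<ge> 1" for n using that by blast
    have "independent ((\<lambda>j. z ^ j) ` {1..n}) \<and> card ((\<lambda>j. z ^ j) ` {1..n}) = n" for n
    proof (induction n)
      case (Suc n)
      have "(\<lambda>j. z ^ j) ` {1..n} \<subseteq> V (Suc n)" using V_mem[of _ "Suc n" 0] by auto
      then have "span ((\<lambda>j. z ^ j) ` {1..n}) \<subseteq> V (Suc n)"
        unfolding V_def by (intro span_minimal) auto
      then have n: "z ^ Suc n \<notin> span ((\<lambda>j. z ^ j) ` {1..n})" using no[of "Suc n"] by auto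
      then have "z ^ Suc n \<notin> (\<lambda>j. z ^ j) ` {1..n}" using span_base by blast
      moreover have "(\<lambda>j. z ^ j) ` {1..Suc n} = insert (z ^ Suc n) ((\<lambda>j. z ^ j) ` {1..n})"
        by (simp add: atLeastAtMostSuc_conv)
      ultimately show ?case using Suc n by (simp add: independent_insert del: power_Suc)
    qed (simp add: independent_empty)
    then have "Suc (card B) \<le> card B"
      using independent_span_bound[OF B(1)] B(2) by (metis subset_UNIV)
    then show False by simp
  qed
  then obtain n where "n \<ge> 1" "z ^ n \<in> V n" by blast
  then have "z ^ 1 \<in> V 1"
  proof (induction n rule: nat_induct_at_least)
    case (Suc n)
    then show ?case using desc by simp
  qed simp
  moreover have "V 1 = span (range (\<lambda>i. \<gamma> ^ i))"
    unfolding V_def by (intro arg_cong[where f = span]) auto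
  ultimately show False using notin by simp
qed

text \<open>
  In a cosemisimple \<open>H\<close> every skew-primitive element is trivial; in a finite-dimensional one this
  requires that it commutes with the group-like element, as the Taft algebras show.
\<close>

lemma skew_primitive_trivial:
  assumes "finite_dimensional sH \<or> cosemisimple sH \<Delta>" and \<gamma>: "grouplike \<gamma>"
    and z: "skew_primitive \<gamma> z" and "cosemisimple sH \<Delta> \<or> \<gamma> * z = z * \<gamma>"
  obtains l where "z = sH l (1 - \<gamma>)"
proof (cases "cosemisimple sH \<Delta>")
  case True
  have "z \<in> span {1, \<gamma>}"
    using skew_primitive_in_span_if_cosemisimple[OF True] z \<gamma>
    by (auto simp: comult_one grouplike_def skew_primitive_def)
  then show ?thesis
    by (rule skew_primitive_in_span_grouplikes[OF z]) (use that \<gamma> grouplike_one in auto)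
next
  case False
  have "z \<in> span (range (\<lambda>i. \<gamma> ^ i))"
    using skew_primitive_in_span_powers[OF _ \<gamma> z] assms(1,4) False by blast
  then show ?thesis
    by (rule skew_primitive_in_span_grouplikes[OF z]) (use that grouplike_power[OF \<gamma>] in auto)
qed

end

section \<open>The divided power basis\<close>

text \<open>
  The condition on an integrand \<open>F\<close> under which a Sweedler sum over \<open>\<delta>(r \<otimes> s) = \<Sum> (a \<otimes> b) \<otimes> (c \<otimes> e)\<close>
  may be evaluated on a basis.
\<close>

definition quadrilinear ::
  "('k::field \<Rightarrow> 'r::ab_group_add \<Rightarrow> 'r) \<Rightarrow> ('k \<Rightarrow> 'u::ab_group_add \<Rightarrow> 'u) \<Rightarrow>
    ('r \<Rightarrow> 'r \<Rightarrow> 'r \<Rightarrow> 'r \<Rightarrow> 'u) \<Rightarrow> bool" where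
  "quadrilinear s sU F \<longleftrightarrow>
    (\<forall>b c e. Vector_Spaces.linear s sU (\<lambda>a. F a b c e)) \<and>
    (\<forall>a c e. Vector_Spaces.linear s sU (\<lambda>b. F a b c e)) \<and>
    (\<forall>a b e. Vector_Spaces.linear s sU (\<lambda>c. F a b c e)) \<and>
    (\<forall>a b c. Vector_Spaces.linear s sU (\<lambda>e. F a b c e))"

lemma quadrilinearI:
  assumes "\<And>b c e. Vector_Spaces.linear s sU (\<lambda>a. F a b c e)"
    "\<And>a c e. Vector_Spaces.linear s sU (\<lambda>b. F a b c e)"
    "\<And>a b e. Vector_Spaces.linear s sU (\<lambda>c. F a b c e)"
    "\<And>a b c. Vector_Spaces.linear s sU (\<lambda>e. F a b c e)"
  shows "quadrilinear s sU F"
  using assms by (simp add: quadrilinear_def)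

text \<open>
  Here \<open>\<theta>\<close> is the order of \<open>q\<close>; that it equals the dimension \<open>N\<close> is a theorem.
\<close>

locale divided_power_cocycle = pre_bialgebra_with_cocycle sH \<Delta> \<epsilon>H S sR act \<rho> \<delta> \<epsilon> m u \<xi>
  for sH :: "'k::field_char_0 \<Rightarrow> 'h::ring_1 \<Rightarrow> 'h"
    and \<Delta> :: "'h \<Rightarrow> ('k, 'h, 'h) tensor" and \<epsilon>H :: "'h \<Rightarrow> 'k" and S :: "'h \<Rightarrow> 'h"
    and sR :: "'k \<Rightarrow> 'r::ab_group_add \<Rightarrow> 'r"
    and act :: "'h \<Rightarrow> 'r \<Rightarrow> 'r" and \<rho> :: "'r \<Rightarrow> ('k, 'h, 'r) tensor"
    and \<delta> :: "'r \<Rightarrow> ('k, 'r, 'r) tensor" and \<epsilon> :: "'r \<Rightarrow> 'k"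
    and m :: "'r \<Rightarrow> 'r \<Rightarrow> 'r" and u :: "'k \<Rightarrow> 'r" and \<xi> :: "'r \<Rightarrow> 'r \<Rightarrow> 'h" +
  fixes N :: nat and y :: 'r and g :: 'h and \<chi> :: "'h \<Rightarrow> 'k" and q :: 'k and d :: "nat \<Rightarrow> 'r"
    and \<theta> :: nat
  assumes order_bounds: "2 \<le> \<theta>" "\<theta> \<le> N"
    and datum: "yd_datum \<theta> q g \<chi>"
    and coact_y: "\<rho> y = tens sH sR g y"
    and act_y: "act h y = sR (\<chi> h) y"
    and basis: "divided_power_basis N q g \<chi> y d"
begin

sublocale H: hopf_algebra_char_0 ..

lemmas H_space = vector_space_axioms
lemmas R_space = V.vector_space_axioms

subsection \<open>Coordinates\<close>

lemma basis_facts: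
  shows "inj_on d {..<N}" "V.independent (d ` {..<N})" "V.span (d ` {..<N}) = UNIV"
    "d 0 = u 1" "d 1 = y"
    "n < N \<Longrightarrow> \<delta> (d n) = (\<Sum>t\<le>n. tens sR sR (d t) (d (n - t)))"
    "n < N \<Longrightarrow> act g (d n) = sR (q ^ n) (d n)"
    "n < N \<Longrightarrow> act h (d n) = sR (conv_pow \<chi> n h) (d n)"
    "1 \<le> n \<Longrightarrow> n < N \<Longrightarrow> m y (d (n - 1)) = sR (\<Sum>i<n. q ^ i) (d n)"
  using basis unfolding divided_power_basis_def by auto

definition coord :: "nat \<Rightarrow> 'r \<Rightarrow> 'k" where
  "coord k r = (if k < N then V.representation (d ` {..<N}) r (d k) else 0)"

lemma linear_coord: "Vector_Spaces.linear sR (*) (coord k)"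
  unfolding Vector_Spaces.linear_iff coord_def using basis_facts(2,3)
  by (auto simp: vector_space_mult R_space V.representation_add V.representation_scale)

lemma coord_d: "i < N \<Longrightarrow> coord k (d i) = (if k = i then 1 else 0)"
  using basis_facts(1,2) by (auto simp: coord_def V.representation_basis inj_on_def)

lemma coord_expand: "r = (\<Sum>k<N. sR (coord k r) (d k))"
proof -
  have "(\<Sum>b\<in>d ` {..<N}. sR (V.representation (d ` {..<N}) r b) b) = r"
    using basis_facts(2,3) by (intro V.sum_representation_eq) auto
  then show ?thesis by (simp add: coord_def sum.reindex[OF basis_facts(1)])
qed

lemma coord_eqI: "(\<And>k. k < N \<Longrightarrow> coord k r = coord k r') \<Longrightarrow> r = r'"
  using coord_expand[of r] coord_expand[of r'] by (metis (mono_tags, lifting) lessThan_iff sum.cong)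

lemmas coord_simps = linear_simps[OF linear_coord]

lemma R_zero_less: "0 < N" "1 < N" using order_bounds by auto

lemma counit_d: "n < N \<Longrightarrow> \<epsilon> (d n) = (if n = 0 then 1 else 0)"
proof -
  assume n: "n < N"
  have "d n = (\<Sum>t\<le>n. sR (\<epsilon> (d t)) (d (n - t)))"
    using R.counit_left[of "d n"] n
    by (simp add: basis_facts(6) tlift_sum[OF bilinear_scale_right[OF R.counit_linear R_space]])
  then have "coord 0 (d n) = coord 0 (\<Sum>t\<le>n. sR (\<epsilon> (d t)) (d (n - t)))" by simp
  also have "\<dots> = (\<Sum>t\<le>n. \<epsilon> (d t) * coord 0 (d (n - t)))" by (simp add: coord_simps)
  also have "\<dots> = (\<Sum>t\<le>n. if t = n then \<epsilon> (d n) else 0)"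
    using n by (intro sum.cong) (auto simp: coord_d)
  finally show ?thesis using n by (simp add: coord_d)
qed

lemma counit_eq_coord: "\<epsilon> r = coord 0 r"
proof -
  have "\<epsilon> r = (\<Sum>k<N. coord k r * \<epsilon> (d k))"
    by (subst coord_expand[of r]) (simp add: linear_simps[OF R.counit_linear])
  also have "\<dots> = (\<Sum>k<N. if k = 0 then coord 0 r else 0)"
    by (intro sum.cong) (auto simp: counit_d)
  finally show ?thesis using R_zero_less(1) by simp
qed

text \<open>
  As \<open>\<delta>(d\<^sub>k) = \<Sum> d\<^sub>i \<otimes> d\<^sub>k\<^sub>-\<^sub>i\<close>, the coefficient of \<open>d\<^sub>t \<otimes> d\<^sub>s\<close> only sees the coordinate \<open>t + s\<close>, and
  vanishes if there is no such coordinate. This last case is what forces \<open>q\<close> to have order \<open>N\<close>.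
\<close>

lemma comult_coord:
  assumes "t < N" "s < N"
  shows "\<delta> r (\<lambda>a b. coord t a * coord s b) = (if t + s < N then coord (t + s) r else 0)"
proof -
  define \<beta> where "\<beta> = (\<lambda>a b. coord t a * coord s b)"
  have \<beta>: "bilinear_map sR sR (*) \<beta>"
    unfolding \<beta>_def by (rule bilinear_mult_functionals[OF linear_coord linear_coord])
  have d: "\<delta> (d k) \<beta> = (if k = t + s then 1 else 0)" if k: "k < N" for k
  proof -
    have "\<delta> (d k) \<beta> = (\<Sum>i\<le>k. tens sR sR (d i) (d (k - i)) \<beta>)"
      unfolding basis_facts(6)[OF k] by (simp add: linear_simps(6)[OF linear_eval])
    also have "\<dots> = (\<Sum>i\<le>k. if i = t then (if k = t + s then 1 else 0) else 0)"
      using k unfolding tens_apply[OF \<beta>] by (intro sum.cong) (auto simp: \<beta>_def coord_d)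
    finally show ?thesis by auto
  qed
  have "\<delta> r \<beta> = (\<Sum>k<N. coord k r * \<delta> (d k) \<beta>)"
    by (subst coord_expand[of r])
       (simp add: linear_simps[OF linear_comp[OF linear_eval R.comult_linear]])
  also have "\<dots> = (\<Sum>k<N. if k = t + s then coord (t + s) r else 0)"
    by (intro sum.cong) (auto simp: d)
  finally show ?thesis by (simp add: \<beta>_def)
qed

subsection \<open>Linearity rules\<close>

lemmas H_tens = bilinear_tens[OF H_space H_space]
lemmas HR_tens = bilinear_tens[OF H_space R_space]
lemmas RR_tens = bilinear_tens[OF R_space R_space]
lemmas RH_tens = bilinear_tens[OF R_space H_space]

lemma linear_tlift_coact:
  "bilinear_map sH sR sU F \<Longrightarrow> Vector_Spaces.linear s sR f \<Longrightarrow>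
    Vector_Spaces.linear s sU (\<lambda>x. tlift sH sR (\<rho> (f x)) F)"
  by (rule linear_tlift_tensor[where f = "\<lambda>x. \<rho> (f x)", OF _ linear_comp[OF coact_linear]])
     (auto intro: coact_in)

lemma linear_tlift_comult_H:
  "bilinear_map sH sH sU F \<Longrightarrow> Vector_Spaces.linear s sH f \<Longrightarrow>
    Vector_Spaces.linear s sU (\<lambda>x. tlift sH sH (\<Delta> (f x)) F)"
  by (rule linear_tlift_tensor[where f = "\<lambda>x. \<Delta> (f x)", OF _ linear_comp[OF comult_linear]])
     (auto intro: comult_in)

lemma linear_tlift_comult_R:
  "bilinear_map sR sR sU F \<Longrightarrow> Vector_Spaces.linear s sR f \<Longrightarrow>
    Vector_Spaces.linear s sU (\<lambda>x. tlift sR sR (\<delta> (f x)) F)"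
  by (rule linear_tlift_tensor[where f = "\<lambda>x. \<delta> (f x)", OF _ linear_comp[OF R.comult_linear]])
     (auto intro: R.comult_in)

text \<open>
  Introduction rules that decompose the linearity of a Sweedler expression in one of its variables.
  For a bilinear operation, the variable occurs in at most one argument, so that at most one of the
  two rules applies.
\<close>

lemmas lin_rules =
  linear_map_ident[OF H_space] linear_map_ident[OF R_space]
  bilinear_comp_left[OF mult_bilinear] bilinear_comp_right[OF mult_bilinear]
  bilinear_comp_left[OF act_bilinear] bilinear_comp_right[OF act_bilinear]
  bilinear_comp_left[OF m_bilinear] bilinear_comp_right[OF m_bilinear]
  bilinear_comp_left[OF xi_bilinear] bilinear_comp_right[OF xi_bilinear]
  bilinear_comp_left[OF H_tens] bilinear_comp_right[OF H_tens]
  bilinear_comp_left[OF HR_tens] bilinear_comp_right[OF HR_tens]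
  bilinear_comp_left[OF RR_tens] bilinear_comp_right[OF RR_tens]
  bilinear_comp_left[OF RH_tens] bilinear_comp_right[OF RH_tens]
  linear_comp[OF antipode_linear] linear_comp[OF linear_coord]
  linear_tlift_coact linear_tlift_comult_H linear_tlift_comult_R linear_tlift_integrand
  linear_scale_fun linear_scale_by[OF _ H_space] linear_scale_by[OF _ R_space]
  bilinear_mapI quadrilinearI

subsection \<open>The coaction\<close>

text \<open>
  The matrix of the comodule \<open>R\<close>: the coefficient of \<open>d\<^sub>k\<close> in \<open>\<rho>(d\<^sub>n)\<close>.
\<close>

definition coact_entry :: "nat \<Rightarrow> nat \<Rightarrow> 'h" where
  "coact_entry n k = tlift sH sR (\<rho> (d n)) (\<lambda>h r. sH (coord k r) h)"

lemma bilinear_coord_H: "bilinear_map sH sR sH (\<lambda>h r. sH (coord k r) h)"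
  by (intro lin_rules)

lemma coact_d: "\<rho> (d n) = (\<Sum>k<N. tens sH sR (coact_entry n k) (d k))"
proof -
  obtain xs where xs: "\<rho> (d n) = (\<Sum>(h, r)\<leftarrow>xs. tens sH sR h r)"
    using tensor_space_UNIV_rep[OF H_space R_space coact_in] .
  have pure: "tens sH sR h r = (\<Sum>k<N. tens sH sR (sH (coord k r) h) (d k))" for h r
    by (subst coord_expand[of r])
       (simp only: bilinear_simps[OF HR_tens])
  have "(\<Sum>(h, r)\<leftarrow>xs. tens sH sR h r)
      = (\<Sum>k<N. tens sH sR (\<Sum>(h, r)\<leftarrow>xs. sH (coord k r) h) (d k))"
  proof (induction xs)
    case Nil
    then show ?case by (simp only: list.map sum_list.Nil bilinear_simps[OF HR_tens] sum.neutral_const)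
  next
    case (Cons p xs)
    then show ?case
      by (cases p) (simp only: list.map sum_list.Cons split_conv bilinear_simps(1)[OF HR_tens]
          sum.distrib pure[symmetric])
  qed
  then show ?thesis
    unfolding coact_entry_def xs tlift_sum_list[OF bilinear_coord_H] .
qed

lemma tlift_coact_d:
  "bilinear_map sH sR sU F \<Longrightarrow> tlift sH sR (\<rho> (d n)) F = (\<Sum>k<N. F (coact_entry n k) (d k))"
  unfolding coact_d by (rule tlift_sum)

lemma tlift_comult_d:
  "bilinear_map sR sR sU F \<Longrightarrow> n < N \<Longrightarrow> tlift sR sR (\<delta> (d n)) F = (\<Sum>t\<le>n. F (d t) (d (n - t)))"
  by (simp only: basis_facts(6) tlift_sum)

lemma coact_entry_eqI:
  assumes "\<rho> (d n) = (\<Sum>k<N. tens sH sR (h k) (d k))" "k < N"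
  shows "coact_entry n k = h k"
proof -
  have "coact_entry n k = (\<Sum>i<N. sH (coord k (d i)) (h i))"
    unfolding coact_entry_def assms(1) by (rule tlift_sum[OF bilinear_coord_H])
  also have "\<dots> = (\<Sum>i<N. if i = k then h k else 0)"
    by (intro sum.cong) (auto simp: coord_d)
  finally show ?thesis using assms(2) by simp
qed

lemma coact_entry_0_left: "k < N \<Longrightarrow> coact_entry 0 k = (if k = 0 then 1 else 0)"
proof -
  assume k: "k < N"
  have "\<rho> (d 0) = (\<Sum>k<N. if k = 0 then tens sH sR 1 (d 0) else 0)"
    using R_zero_less coact_unit by (simp add: basis_facts(4))
  also have "\<dots> = (\<Sum>k<N. tens sH sR (if k = 0 then 1 else 0) (d k))"
    by (intro sum.cong) (auto simp: bilinear_simps[OF HR_tens])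
  finally show ?thesis by (rule coact_entry_eqI) (rule k)
qed

lemma coact_entry_1_left: "k < N \<Longrightarrow> coact_entry 1 k = (if k = 1 then g else 0)"
proof -
  assume k: "k < N"
  have "\<rho> (d 1) = (\<Sum>k<N. if k = 1 then tens sH sR g (d 1) else 0)"
    using R_zero_less coact_y by (simp add: basis_facts(5)[unfolded One_nat_def])
  also have "\<dots> = (\<Sum>k<N. tens sH sR (if k = 1 then g else 0) (d k))"
    by (intro sum.cong) (auto simp: bilinear_simps[OF HR_tens])
  finally show ?thesis by (rule coact_entry_eqI) (rule k)
qed

lemma coact_entry_0_right:
  assumes n: "n < N"
  shows "coact_entry n 0 = (if n = 0 then 1 else 0)"
proof -
  note bil = bilinear_tens[OF H_space vector_space_mult]
  have 1: "bilinear_map sH sR tscale (\<lambda>h r. tens sH (*) h (\<epsilon> r))"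
    by (intro bilinear_mapI bilinear_comp_left[OF bil] bilinear_comp_right[OF bil]
        R.counit_linear linear_map_ident[OF H_space])
  have "(\<Sum>k<N. tens sH (*) (coact_entry n k) (\<epsilon> (d k))) = tens sH (*) 1 (\<epsilon> (d n))"
    using counit_comodule_hom[of "d n"] unfolding coact_d tlift_sum[OF 1] .
  also have "(\<Sum>k<N. tens sH (*) (coact_entry n k) (\<epsilon> (d k)))
      = (\<Sum>k<N. if k = 0 then tens sH (*) (coact_entry n 0) (1::'k) else 0)"
    by (intro sum.cong) (auto simp: counit_d bilinear_simps[OF bil])
  also have "\<dots> = tens sH (*) (coact_entry n 0) (1::'k)" using R_zero_less(1) by simp
  finally have "tens sH (*) (coact_entry n 0) (1::'k) = tens sH (*) 1 (\<epsilon> (d n))" .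
  moreover have "tlift sH (*) (tens sH (*) h c) (\<lambda>h c. sH c h) = sH c h" for h c
    by (rule tlift_tens[OF bilinear_scale_left])
       (rule linear_map_ident[OF vector_space_mult], rule H_space)
  ultimately have "sH 1 (coact_entry n 0) = sH (\<epsilon> (d n)) 1" by metis
  then show ?thesis using counit_d[OF n] by (auto split: if_splits)
qed

text \<open>
  Colinearity of the comultiplication, read off at \<open>d\<^sub>i \<otimes> d\<^sub>j\<close>. For \<open>j = 1\<close> it expresses each column
  of the matrix through the previous one and column \<open>1\<close>.
\<close>

lemma coact_entry_add:
  assumes n: "n < N" and ij: "i + j < N"
  shows "coact_entry n (i + j) = (\<Sum>t\<le>n. coact_entry t i * coact_entry (n - t) j)"
proof -
  note bil = bilinear_tens[OF H_space vector_space_tscale]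
  note rules = bilinear_comp_left[OF bil] bilinear_comp_right[OF bil] lin_rules
    linear_comp[OF R.comult_linear]
  (* The bilinear form that takes the coefficient of d_i \<otimes> d_j. *)
  define \<beta> where "\<beta> = (\<lambda>r s. coord i r * coord j s)"
  have \<beta>: "bilinear_map sR sR (*) \<beta>"
    unfolding \<beta>_def by (rule bilinear_mult_functionals[OF linear_coord linear_coord])
  have ev: "bilinear_map sH tscale sH (\<lambda>h t. sH (t \<beta>) h)"
    by (rule bilinear_scale_left[OF linear_eval H_space])
  have b1: "bilinear_map sR sR tscale (\<lambda>v w. coact_sum2 v w (\<lambda>a v0 w0. tens sH tscale a (tens sR sR v0 w0)))"
    unfolding coact_sum2_def by (intro rules)
  have b2: "bilinear_map sH sR tscale (\<lambda>a v0. tlift sH sR (\<rho> w) (\<lambda>b w0. tens sH tscale (a * b) (tens sR sR v0 w0)))" for w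
    by (intro rules)
  have b3: "bilinear_map sH sR tscale (\<lambda>b w0. tens sH tscale (a * b) (tens sR sR v0 w0))" for a v0
    by (intro rules)
  have b4: "bilinear_map sH sR tscale (\<lambda>a r0. tens sH tscale a (\<delta> r0))"
    by (intro rules)
  have "(\<Sum>t\<le>n. \<Sum>k<N. \<Sum>l<N. tens sH tscale (coact_entry t k * coact_entry (n - t) l) (tens sR sR (d k) (d l)))
      = (\<Sum>k<N. tens sH tscale (coact_entry n k) (\<delta> (d k)))"
    using comult_comodule_hom[of "d n"]
    unfolding coact2_def tlift_comult_d[OF b1 n] tlift_coact_d[OF b4]
    unfolding coact_sum2_def tlift_coact_d[OF b2]
    unfolding tlift_coact_d[OF b3] .
  then have "tlift sH tscale (\<Sum>t\<le>n. \<Sum>k<N. \<Sum>l<N. tens sH tscale (coact_entry t k * coact_entry (n - t) l) (tens sR sR (d k) (d l)))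
      (\<lambda>h t. sH (t \<beta>) h) = tlift sH tscale (\<Sum>k<N. tens sH tscale (coact_entry n k) (\<delta> (d k))) (\<lambda>h t. sH (t \<beta>) h)"
    by (rule arg_cong)
  then have eq: "(\<Sum>t\<le>n. \<Sum>k<N. \<Sum>l<N. sH (tens sR sR (d k) (d l) \<beta>) (coact_entry t k * coact_entry (n - t) l))
      = (\<Sum>k<N. sH (\<delta> (d k) \<beta>) (coact_entry n k))"
    unfolding sum.cartesian_product split_def
    unfolding tlift_sum[OF ev] .
  have \<beta>_d: "tens sR sR (d k) (d l) \<beta> = (if k = i \<and> l = j then 1 else 0)" if "k < N" "l < N" for k l
    using that unfolding tens_apply[OF \<beta>] by (auto simp: \<beta>_def coord_d)
  have \<delta>_d: "\<delta> (d k) \<beta> = (if k = i + j then 1 else 0)" if k: "k < N" for k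
    using comult_coord[of i j "d k"] ij k by (simp add: \<beta>_def coord_d)
  have "(\<Sum>k<N. sH (\<delta> (d k) \<beta>) (coact_entry n k)) = (\<Sum>k<N. if k = i + j then coact_entry n (i + j) else 0)"
    by (intro sum.cong) (auto simp: \<delta>_d)
  then have rhs: "(\<Sum>k<N. sH (\<delta> (d k) \<beta>) (coact_entry n k)) = coact_entry n (i + j)" using ij by simp
  have "(\<Sum>k<N. \<Sum>l<N. sH (tens sR sR (d k) (d l) \<beta>) (coact_entry t k * coact_entry (n - t) l))
      = coact_entry t i * coact_entry (n - t) j" for t
  proof -
    have "(\<Sum>k<N. \<Sum>l<N. sH (tens sR sR (d k) (d l) \<beta>) (coact_entry t k * coact_entry (n - t) l))
      = (\<Sum>k<N. if k = i then (\<Sum>l<N. if l = j then coact_entry t i * coact_entry (n - t) j else 0) else 0)"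
    proof (intro sum.cong refl)
      fix k assume k: "k \<in> {..<N}"
      have "sH (tens sR sR (d k) (d l) \<beta>) (coact_entry t k * coact_entry (n - t) l)
        = (if k = i then if l = j then coact_entry t i * coact_entry (n - t) j else 0 else 0)" if "l \<in> {..<N}" for l
        using k that by (auto simp: \<beta>_d)
      then show "(\<Sum>l<N. sH (tens sR sR (d k) (d l) \<beta>) (coact_entry t k * coact_entry (n - t) l))
        = (if k = i then (\<Sum>l<N. if l = j then coact_entry t i * coact_entry (n - t) j else 0) else 0)"
        by (cases "k = i") (simp_all only: refl if_True if_False sum.neutral_const cong: sum.cong)
    qed
    also have "\<dots> = coact_entry t i * coact_entry (n - t) j" using ij by simp
    finally show ?thesis .
  qed
  then show ?thesis using eq rhs by simp
qed

lemma coact_entry_eq_0: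
  assumes "n < k" "k < N"
  shows "coact_entry n k = 0"
  using assms
proof (induction k arbitrary: n)
  case (Suc k)
  have "coact_entry n (Suc k) = (\<Sum>t\<le>n. coact_entry t k * coact_entry (n - t) 1)"
    using coact_entry_add[of n k 1] Suc.prems by simp
  also have "\<dots> = 0"
  proof (intro sum.neutral ballI)
    fix t assume "t \<in> {..n}"
    then show "coact_entry t k * coact_entry (n - t) 1 = 0"
      using Suc coact_entry_0_left[of 1] by (cases "t < k") auto
  qed
  finally show ?case .
qed simp

lemma coact_entry_diag: "n < N \<Longrightarrow> coact_entry n n = g ^ n"
proof (induction n)
  case 0
  then show ?case by (simp add: coact_entry_0_left)
next
  case (Suc n)
  have "coact_entry (Suc n) (Suc n) = (\<Sum>t\<le>Suc n. coact_entry t n * coact_entry (Suc n - t) 1)"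
    using coact_entry_add[of "Suc n" n 1] Suc.prems by simp
  also have "\<dots> = (\<Sum>t\<le>Suc n. if t = n then g ^ n * g else 0)"
  proof (intro sum.cong refl)
    fix t assume "t \<in> {..Suc n}"
    then consider "t < n" | "t = n" | "t = Suc n" by force
    then show "coact_entry t n * coact_entry (Suc n - t) 1 = (if t = n then g ^ n * g else 0)"
      using Suc coact_entry_0_left[of 1] coact_entry_1_left[of 1] coact_entry_eq_0[of t n] by cases auto
  qed
  finally show ?case by (simp add: power_commutes)
qed

subsection \<open>Weights\<close>

lemma root: "q ^ \<theta> = 1" "0 < j \<Longrightarrow> j < \<theta> \<Longrightarrow> q ^ j \<noteq> 1"
  using datum by (auto simp: yd_datum_def primitive_root_of_unity_def)

lemma q_neq: "q \<noteq> 0" "q \<noteq> 1"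
  using root(1) root(2)[of 1] order_bounds by (auto simp: power_0_left)

lemma grouplike_g: "grouplike g" using datum by (simp add: yd_datum_def)
lemma character: "Vector_Spaces.linear sH (*) \<chi>" "\<chi> 1 = 1" "\<chi> (h * k) = \<chi> h * \<chi> k" "\<chi> g = q"
  using datum by (auto simp: yd_datum_def hopf_character_def)

lemma act_linear_simps: "act (sH c h) r = sR c (act h r)" "act h (sR c r) = sR c (act h r)"
  using act_bilinear by (auto simp: bilinear_map_def Vector_Spaces.linear_iff)

text \<open>
  Both \<open>g\<close> and \<open>h\<close> act on \<open>d\<^sub>n\<close> by scalars, so \<open>g h\<close> and \<open>h g\<close> act in the same way.
\<close>

lemma act_zero_if_weight:
  assumes "g * h = sH \<zeta> (h * g)" "\<zeta> \<noteq> 1" "n < N"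
  shows "act h (d n) = 0"
proof -
  define c where "c = conv_pow \<chi> n h"
  have c: "act h (d n) = sR c (d n)" using assms(3) by (simp add: basis_facts(8) c_def)
  have "act (g * h) (d n) = sR (c * q ^ n) (d n)"
    using assms(3) by (simp add: act_mult c basis_facts(7) act_linear_simps)
  moreover have "act (g * h) (d n) = sR (\<zeta> * (q ^ n * c)) (d n)"
    using assms(1,3) by (simp add: act_mult c basis_facts(7) act_linear_simps)
  ultimately have "coord n (sR (c * q ^ n) (d n)) = coord n (sR (\<zeta> * (q ^ n * c)) (d n))"
    by (rule arg_cong[OF trans[OF sym]])
  then have "c * q ^ n = \<zeta> * (q ^ n * c)"
    using assms(3) by (simp add: coord_simps coord_d)
  then have "c = 0" using assms(2) q_neq(1) by auto
  then show ?thesis by (simp add: c)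
qed

lemma antipode_g: "S g * g = 1" "g * S g = 1"
  using grouplike_antipode[OF grouplike_g] .

lemma comult_g: "\<Delta> g = tens sH sH g g" using grouplike_g by (simp add: grouplike_def)

lemma conj_g_iff: "g * h * S g = k \<longleftrightarrow> g * h = k * g"
  using antipode_g by (metis mult.assoc mult.right_neutral)

text \<open>
  The Yetter-Drinfeld condition for the action of \<open>g\<close>.
\<close>

lemma coact_entry_weight:
  assumes "n < N" "k < N"
  shows "g * coact_entry n k = sH (q ^ n / q ^ k) (coact_entry n k * g)"
proof -
  have b1: "bilinear_map sH sH tscale (\<lambda>h1 h'. tlift sH sH (\<Delta> h') (\<lambda>h2 h3.
        tlift sH sR (\<rho> v) (\<lambda>a v0. tens sH sR (h1 * a * S h3) (act h2 v0))))" for v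
    by (intro lin_rules)
  have b2: "bilinear_map sH sH tscale (\<lambda>h2 h3.
        tlift sH sR (\<rho> v) (\<lambda>a v0. tens sH sR (h1 * a * S h3) (act h2 v0)))" for h1 v
    by (intro lin_rules)
  have b3: "bilinear_map sH sR tscale (\<lambda>a v0. tens sH sR (g * a * S g) (act g v0))"
    by (intro lin_rules)
  have "\<rho> (act g (d n)) = (\<Sum>k<N. tens sH sR (g * coact_entry n k * S g) (act g (d k)))"
    unfolding yd_compat comult_g tlift_tens[OF b1] tlift_tens[OF b2]
    unfolding tlift_coact_d[OF b3] ..
  also have "\<dots> = (\<Sum>k<N. tens sH sR (sH (q ^ k) (g * coact_entry n k * S g)) (d k))"
    by (intro sum.cong) (auto simp: basis_facts(7) bilinear_simps[OF HR_tens])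
  also have "\<rho> (act g (d n)) = tscale (q ^ n) (\<rho> (d n))"
    using assms by (simp add: basis_facts(7) linear_simps[OF coact_linear])
  finally have eq: "tscale (q ^ n) (\<rho> (d n)) = (\<Sum>k<N. tens sH sR (sH (q ^ k) (g * coact_entry n k * S g)) (d k))" .
  interpret T: vector_space tscale by (rule vector_space_tscale)
  have "\<rho> (d n) = tscale (1 / q ^ n) (tscale (q ^ n) (\<rho> (d n)))"
    using q_neq(1) by simp
  also have "\<dots> = (\<Sum>k<N. tens sH sR (sH (q ^ k / q ^ n) (g * coact_entry n k * S g)) (d k))"
    unfolding eq by (simp add: T.scale_sum_right flip: bilinear_simps(2)[OF HR_tens])
  finally have "coact_entry n k = sH (q ^ k / q ^ n) (g * coact_entry n k * S g)"
    by (rule coact_entry_eqI) (rule assms(2))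
  then have "sH (q ^ n / q ^ k) (coact_entry n k) = sH (q ^ n / q ^ k) (sH (q ^ k / q ^ n) (g * coact_entry n k * S g))"
    by (rule arg_cong)
  then have "g * coact_entry n k * S g = sH (q ^ n / q ^ k) (coact_entry n k)"
    using q_neq(1) by simp
  then show ?thesis by (simp add: conj_g_iff bilinear_simps[OF mult_bilinear])
qed

lemma q_power_eq_iff: "i \<le> j \<Longrightarrow> q ^ i = q ^ j \<longleftrightarrow> q ^ (j - i) = 1"
  using q_neq(1) by (metis (no_types) le_add_diff_inverse mult_cancel_left mult.right_neutral
      power_add power_not_zero)

lemma act_coeff:
  assumes "n \<le> \<theta>" "n < N" "k < N" "j < N"
  shows "act (coact_entry n k) (d j) = (if k = n then sR (q ^ (n * j)) (d j) else 0)"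
proof -
  consider "k = n" | "n < k" | "k < n" "k > 0" | "k < n" "k = 0" by force
  then show ?thesis
  proof cases
    case 1
    have "act (g ^ i) (d j) = sR (q ^ (i * j)) (d j)" for i
      by (induction i) (use assms in \<open>auto simp: act_one act_mult basis_facts(7) act_linear_simps power_add mult.commute\<close>)
    then show ?thesis using 1 assms by (simp add: coact_entry_diag)
  next
    case 2
    then show ?thesis using assms by (simp add: coact_entry_eq_0 bilinear_simps[OF act_bilinear])
  next
    case 3
    have "q ^ k \<noteq> q ^ n" using 3 assms root(2)[of "n - k"] q_power_eq_iff[of k n] by auto
    then have "act (coact_entry n k) (d j) = 0"
      using q_neq(1) by (intro act_zero_if_weight[OF coact_entry_weight] assms) auto
    then show ?thesis using 3 by simp
  next
    case 4
    then show ?thesis using assms by (simp add: coact_entry_0_right bilinear_simps[OF act_bilinear])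
  qed
qed

text \<open>
  On the span of the \<open>d\<^sub>a \<otimes> d\<^sub>b\<close> with \<open>a \<le> \<theta>\<close> the comultiplication of \<open>R \<otimes> R\<close> is that of
  a quantum plane: the entries of the coaction off the diagonal have weight different from \<open>1\<close>
  and act as \<open>0\<close>.
\<close>

lemma sweedler2_d:
  assumes F: "quadrilinear sR sU F" and a: "a \<le> \<theta>" "a < N" and b: "b < N"
  shows "sweedler2 (d a) (d b) F =
    (\<Sum>i\<le>a. \<Sum>j\<le>b. sU (q ^ ((a - i) * j)) (F (d i) (d j) (d (a - i)) (d (b - j))))"
proof -
  note L = F[unfolded quadrilinear_def, THEN conjunct1, rule_format]
    F[unfolded quadrilinear_def, THEN conjunct2, THEN conjunct1, rule_format]
    F[unfolded quadrilinear_def, THEN conjunct2, THEN conjunct2, THEN conjunct1, rule_format]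
    F[unfolded quadrilinear_def, THEN conjunct2, THEN conjunct2, THEN conjunct2, rule_format]
  have L2: "Vector_Spaces.linear s sU (\<lambda>x. F r1 (f x) r2 s2)" if "Vector_Spaces.linear s sR f" for s :: "'k \<Rightarrow> 'x::ab_group_add \<Rightarrow> 'x" and r1 r2 s2 f
    by (rule linear_comp[OF L(2) that])
  have b1: "bilinear_map sR sR sU (\<lambda>r1 r2. tlift sR sR (\<delta> s) (\<lambda>s1 s2. tlift sH sR (\<rho> r2) (\<lambda>a r20.
       F r1 (act a s1) r20 s2)))" for s
    by (intro L L2 lin_rules)
  have b2: "bilinear_map sR sR sU (\<lambda>s1 s2. tlift sH sR (\<rho> r2) (\<lambda>a r20. F r1 (act a s1) r20 s2))" for r1 r2
    by (intro L L2 lin_rules)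
  have b3: "bilinear_map sH sR sU (\<lambda>a r20. F r1 (act a s1) r20 s2)" for r1 s1 s2
    by (intro L L2 lin_rules)
  have "sweedler2 (d a) (d b) F =
    (\<Sum>i\<le>a. \<Sum>j\<le>b. \<Sum>k<N. F (d i) (act (coact_entry (a - i) k) (d j)) (d k) (d (b - j)))"
    unfolding sweedler2_def tlift_comult_d[OF b1 a(2)]
    unfolding tlift_comult_d[OF b2 b]
    unfolding tlift_coact_d[OF b3] ..
  also have "\<dots> = (\<Sum>i\<le>a. \<Sum>j\<le>b. sU (q ^ ((a - i) * j)) (F (d i) (d j) (d (a - i)) (d (b - j))))"
  proof (intro sum.cong refl)
    fix i j assume ij: "i \<in> {..a}" "j \<in> {..b}"
    have "(\<Sum>k<N. F (d i) (act (coact_entry (a - i) k) (d j)) (d k) (d (b - j)))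
      = (\<Sum>k<N. if k = a - i then sU (q ^ ((a - i) * j)) (F (d i) (d j) (d (a - i)) (d (b - j))) else 0)"
      using ij a b by (intro sum.cong refl) (auto simp: act_coeff linear_simps[OF L(2)])
    then show "(\<Sum>k<N. F (d i) (act (coact_entry (a - i) k) (d j)) (d k) (d (b - j)))
      = sU (q ^ ((a - i) * j)) (F (d i) (d j) (d (a - i)) (d (b - j)))"
      using a by (simp add: less_imp_diff_less)
  qed
  finally show ?thesis .
qed

end

section \<open>Double sums with few nonzero terms\<close>

lemma sum_atMost_supported:
  fixes f :: "nat \<Rightarrow> nat \<Rightarrow> 'a::comm_monoid_add"
  assumes "T \<subseteq> {..a} \<times> {..b}"
    and "\<And>i j. i \<le> a \<Longrightarrow> j \<le> b \<Longrightarrow> (i, j) \<notin> T \<Longrightarrow> f i j = 0"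
  shows "(\<Sum>i\<le>a. \<Sum>j\<le>b. f i j) = (\<Sum>(i, j)\<in>T. f i j)"
  unfolding sum.cartesian_product using assms by (intro sum.mono_neutral_right) auto

lemma sum_atMost_single:
  fixes f :: "nat \<Rightarrow> nat \<Rightarrow> 'a::comm_monoid_add"
  assumes "i0 \<le> a" "j0 \<le> b"
    and "\<And>i j. i \<le> a \<Longrightarrow> j \<le> b \<Longrightarrow> (i, j) \<noteq> (i0, j0) \<Longrightarrow> f i j = 0"
  shows "(\<Sum>i\<le>a. \<Sum>j\<le>b. f i j) = f i0 j0"
  using sum_atMost_supported[of "{(i0, j0)}" a b f] assms by simp

lemma sum_atMost_pair:
  fixes f :: "nat \<Rightarrow> nat \<Rightarrow> 'a::comm_monoid_add"
  assumes "i0 \<le> a" "j0 \<le> b" "i1 \<le> a" "j1 \<le> b" "(i0, j0) \<noteq> (i1, j1)"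
    and "\<And>i j. i \<le> a \<Longrightarrow> j \<le> b \<Longrightarrow> (i, j) \<noteq> (i0, j0) \<Longrightarrow> (i, j) \<noteq> (i1, j1) \<Longrightarrow> f i j = 0"
  shows "(\<Sum>i\<le>a. \<Sum>j\<le>b. f i j) = f i0 j0 + f i1 j1"
  using sum_atMost_supported[of "{(i0, j0), (i1, j1)}" a b f] assms by simp

lemma sum_double_single:
  fixes f :: "'i \<Rightarrow> 'j \<Rightarrow> 'a::comm_monoid_add"
  assumes "finite A" "finite B" "i0 \<in> A" "j0 \<in> B"
    and "\<And>i j. i \<in> A \<Longrightarrow> j \<in> B \<Longrightarrow> (i, j) \<noteq> (i0, j0) \<Longrightarrow> f i j = 0"
  shows "(\<Sum>i\<in>A. \<Sum>j\<in>B. f i j) = f i0 j0"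
proof -
  have "(\<Sum>(i, j)\<in>A \<times> B. f i j) = (\<Sum>(i, j)\<in>{(i0, j0)}. f i j)"
    using assms by (intro sum.mono_neutral_right) auto
  then show ?thesis by (simp add: sum.cartesian_product)
qed

context divided_power_cocycle
begin

section \<open>The algebra R and the order of q\<close>

subsection \<open>q-numbers\<close>

definition qnum :: "nat \<Rightarrow> 'k" where "qnum n = (\<Sum>i<n. q ^ i)"

lemma qnum_simps: "qnum 0 = 0" "qnum 1 = 1" "qnum (Suc n) = qnum n + q ^ n"
  by (simp_all add: qnum_def)

lemma qnum_times: "(q - 1) * qnum n = q ^ n - 1"
  by (induction n) (auto simp: qnum_simps algebra_simps)

lemma qnum_cong: "q ^ a = q ^ b \<Longrightarrow> qnum a = qnum b"
  using qnum_times[of a] qnum_times[of b] q_neq(2)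
  by (metis eq_iff_diff_eq_0 mult_left_cancel)

lemma qnum_eq_0_iff: "qnum n = 0 \<longleftrightarrow> q ^ n = 1"
  using qnum_times[of n] q_neq(2) by auto

lemma q_power_eq_1_iff: "q ^ n = 1 \<longleftrightarrow> \<theta> dvd n"
proof -
  have "q ^ n = q ^ (\<theta> * (n div \<theta>) + n mod \<theta>)" by simp
  also have "\<dots> = q ^ (n mod \<theta>)" by (simp only: power_add power_mult root power_one mult_1)
  finally have "q ^ n = q ^ (n mod \<theta>)" .
  then show ?thesis
    using root(2)[of "n mod \<theta>"] order_bounds by (cases "n mod \<theta> = 0") (auto simp: dvd_eq_mod_eq_0)
qed

lemma qnum_nonzero: "0 < n \<Longrightarrow> n < \<theta> \<Longrightarrow> qnum n \<noteq> 0"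
  by (simp add: qnum_eq_0_iff root(2))

subsection \<open>The values of the cocycle on the basis\<close>

definition X :: "nat \<Rightarrow> nat \<Rightarrow> 'h" where "X a b = \<xi> (d a) (d b)"

lemma X_unit:
  "b < N \<Longrightarrow> X 0 b = (if b = 0 then 1 else 0)" "a < N \<Longrightarrow> X a 0 = (if a = 0 then 1 else 0)"
  by (auto simp: X_def basis_facts(4) xi_unit_left xi_unit_right counit_d)

lemma X_weight:
  assumes "a < N" "b < N"
  shows "g * X a b = sH (q ^ (a + b)) (X a b * g)"
proof -
  have b1: "bilinear_map sH sH sH (\<lambda>h1 h2. \<xi> (act h1 r) (act h2 s))" for r s
    by (intro lin_rules)
  have b2: "bilinear_map sH sH sH (\<lambda>h1 h2. h1 * \<xi> r s * S h2)" for r s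
    by (intro lin_rules)
  have "g * X a b * S g = \<xi> (act g (d a)) (act g (d b))"
    using xi_act[of g "d a" "d b"] unfolding comult_g tlift_tens[OF b1] tlift_tens[OF b2] by (simp add: X_def)
  also have "\<dots> = sH (q ^ (a + b)) (X a b)"
    using assms by (simp add: basis_facts(7) bilinear_simps[OF xi_bilinear] X_def power_add mult.commute)
  finally show ?thesis by (simp add: conj_g_iff bilinear_simps[OF mult_bilinear])
qed

lemma act_X:
  assumes "a < N" "b < N" "n < N" "\<not> \<theta> dvd a + b"
  shows "act (X a b) (d n) = 0"
  using assms by (intro act_zero_if_weight[OF X_weight]) (auto simp: q_power_eq_1_iff)

subsection \<open>The multiplication on the basis\<close>

text \<open>
  The coefficient of \<open>d\<^sub>t \<otimes> d\<^sub>s\<close> in \<open>\<delta>(d\<^sub>a d\<^sub>b)\<close>, computed in two ways.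
\<close>

lemma coord_m:
  assumes "a \<le> \<theta>" "a < N" "b < N" "t < N" "s < N"
  shows "(if t + s < N then coord (t + s) (m (d a) (d b)) else 0) =
    (\<Sum>i\<le>a. \<Sum>j\<le>b. q ^ ((a - i) * j) * (coord t (m (d i) (d j)) * coord s (m (d (a - i)) (d (b - j)))))"
proof -
  define \<beta> where "\<beta> = (\<lambda>r r'. coord t r * coord s r')"
  have \<beta>: "bilinear_map sR sR (*) \<beta>"
    unfolding \<beta>_def by (rule bilinear_mult_functionals[OF linear_coord linear_coord])
  have F: "quadrilinear sR tscale (\<lambda>a b c e. tens sR sR (m a b) (m c e))"
    by (intro lin_rules)
  have "\<delta> (m (d a) (d b)) \<beta> = (\<Sum>i\<le>a. \<Sum>j\<le>b.
      tscale (q ^ ((a - i) * j)) (tens sR sR (m (d i) (d j)) (m (d (a - i)) (d (b - j)))) \<beta>)"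
    unfolding comult_m sweedler2_d[OF F assms(1-3)] linear_simps(6)[OF linear_eval] ..
  then show ?thesis
    using comult_coord[OF assms(4,5)] by (simp add: \<beta>_def[symmetric] tscale_def tens_apply[OF \<beta>])
       (simp add: \<beta>_def)
qed

lemma m_d_unit: "m (d 0) r = r" "m r (d 0) = r"
  by (simp_all add: basis_facts(4) m_unit_left m_unit_right)

lemma m_y_d: "n + 1 < N \<Longrightarrow> m (d 1) (d n) = sR (qnum (n + 1)) (d (n + 1))"
  using basis_facts(9)[of "n + 1"] basis_facts(5) by (simp add: qnum_def del: sum.lessThan_Suc)

lemma coord_act_g: "k < N \<Longrightarrow> coord k (act g r) = q ^ k * coord k r"
proof -
  assume k: "k < N"
  have "coord k (act g r) = (\<Sum>i<N. coord i r * coord k (act g (d i)))"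
    by (subst coord_expand[of r])
       (simp add: linear_simps[OF linear_comp[OF linear_coord bilinear_comp_right[OF act_bilinear linear_map_ident[OF R_space]]]])
  also have "\<dots> = (\<Sum>i<N. if i = k then q ^ k * coord k r else 0)"
    by (intro sum.cong) (auto simp: basis_facts(7) coord_simps coord_d)
  finally show ?thesis using k by simp
qed

text \<open>
  Compare the coefficients of \<open>d\<^sub>t \<otimes> d\<^sub>1\<close> in \<open>\<delta>(y d\<^sub>N\<^sub>-\<^sub>1)\<close>. For \<open>t = N - 1\<close> there is no \<open>d\<^sub>N\<close> on the one
  side and \<open>(N)\<^sub>q\<close> on the other. For smaller \<open>t\<close> the coordinates of \<open>y d\<^sub>N\<^sub>-\<^sub>1\<close> from \<open>2\<close> on vanish.
  Coordinate \<open>1\<close> has the wrong weight, since \<open>q\<^sup>N = 1 \<noteq> q\<close>, and coordinate \<open>0\<close> is the counit.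
\<close>

lemma m_y_last: "m (d 1) (d (N - 1)) = 0" and qnum_N: "qnum N = 0"
proof -
  define w where "w = m (d 1) (d (N - 1))"
  have main: "(if t + 1 < N then coord (t + 1) w else 0) = (if t = N - 1 then qnum N else 0)"
    if t: "1 \<le> t" "t < N" for t
  proof -
    let ?f = "\<lambda>(i::nat) (j::nat). q ^ ((1 - i) * j) * (coord t (m (d i) (d j)) * coord 1 (m (d (1 - i)) (d (N - 1 - j))))"
    have "(\<Sum>i\<le>1. \<Sum>j\<le>N - 1. ?f i j) = ?f 0 t + ?f 1 (N - 2)"
    proof (rule sum_atMost_pair)
      fix i j :: nat assume ij: "i \<le> 1" "j \<le> N - 1" "(i, j) \<noteq> (0, t)" "(i, j) \<noteq> (1, N - 2)"
      have "i = 0 \<or> i = 1" using ij(1) by auto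
      then show "?f i j = 0"
        using ij R_zero_less by (elim disjE) (auto simp: m_d_unit coord_d)
    qed (use t R_zero_less in auto)
    moreover have "?f 0 t = (if t = N - 1 then q ^ (N - 1) else 0)"
    proof (cases "t = N - 1")
      case True
      then show ?thesis using t R_zero_less by (simp add: m_d_unit coord_d)
    next
      case False
      then have "m (d 1) (d (N - 1 - t)) = sR (qnum (N - t)) (d (N - t))"
        using m_y_d[of "N - 1 - t"] t by (simp add: Suc_diff_Suc)
      then show ?thesis using False t by (simp add: coord_simps coord_d)
    qed
    moreover have "?f 1 (N - 2) = (if t = N - 1 then qnum (N - 1) else 0)"
    proof -
      have "m (d 1) (d (N - 2)) = sR (qnum (N - 1)) (d (N - 1))"
        using m_y_d[of "N - 2"] R_zero_less by (simp add: numeral_2_eq_2 Suc_diff_Suc)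
      moreover have "N - 1 - (N - 2) = 1" using R_zero_less by simp
      ultimately show ?thesis using R_zero_less by (simp add: m_d_unit coord_d coord_simps)
    qed
    moreover have "qnum N = q ^ (N - 1) + qnum (N - 1)"
      using qnum_simps(3)[of "N - 1"] R_zero_less by simp
    ultimately show ?thesis
      using coord_m[of 1 "N - 1" t 1] t order_bounds R_zero_less by (auto simp: w_def)
  qed
  show N0: "qnum N = 0" using main[of "N - 1"] R_zero_less by simp
  have b: "bilinear_map sH sH sR (\<lambda>h1 h2. m (act h1 r) (act h2 s))" for r s
    by (intro lin_rules)
  have "act g w = sR (q * q ^ (N - 1)) w"
    using R_zero_less basis_facts(7)[of 1] unfolding w_def act_m comult_g tlift_tens[OF b]
    by (simp add: basis_facts(7) bilinear_simps[OF m_bilinear] mult.commute)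
  then have "act g w = w" using N0 R_zero_less by (simp add: qnum_eq_0_iff flip: power_Suc)
  then have 1: "coord 1 w = 0" using coord_act_g[of 1 w] R_zero_less q_neq(2) by simp
  have 0: "coord 0 w = 0"
    using R_zero_less by (simp add: w_def counit_m coord_d flip: counit_eq_coord)
       (simp add: counit_d)
  have "coord k w = 0" if k: "k < N" for k
  proof -
    consider "k = 0" | "k = 1" | "1 \<le> k - 1" "k - 1 + 1 = k" "k - 1 < N" "k - 1 \<noteq> N - 1"
      using k by linarith
    then show ?thesis using 0 1 main[of "k - 1"] k by cases auto
  qed
  then show "m (d 1) (d (N - 1)) = 0"
    by (intro coord_eqI) (simp add: w_def coord_simps)
qed

lemma theta_dvd_N: "\<theta> dvd N" using qnum_N by (simp add: qnum_eq_0_iff q_power_eq_1_iff)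

lemma m_y: "n < N \<Longrightarrow> m (d 1) (d n) = (if n + 1 < N then sR (qnum (n + 1)) (d (n + 1)) else 0)"
  using m_y_d[of n] m_y_last by (cases "n = N - 1") auto

text \<open>The Gaussian binomial coefficient of \<open>i + j\<close> over \<open>i\<close>, for \<open>i < \<theta>\<close>.\<close>

definition qbin :: "nat \<Rightarrow> nat \<Rightarrow> 'k" where
  "qbin i j = (\<Prod>s<i. qnum (j + s + 1)) / (\<Prod>s<i. qnum (s + 1))"

text \<open>
  In degrees strictly between \<open>0\<close> and \<open>\<theta>\<close> the values of \<open>\<xi>\<close> act as \<open>0\<close> by weight. So
  the twisted associativity for \<open>y, d\<^sub>i, d\<^sub>j\<close> with \<open>i + 1 < \<theta>\<close> reads \<open>y (d\<^sub>i d\<^sub>j) = (y d\<^sub>i) d\<^sub>j\<close>, and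
  \<open>d\<^sub>i\<close> acts like \<open>y\<^sup>i / (i)\<^sub>q!\<close>.
\<close>

lemma m_d:
  assumes "i < \<theta>" "j < N"
  shows "m (d i) (d j) = (if i + j < N then sR (qbin i j) (d (i + j)) else 0)"
  using assms(1)
proof (induction i)
  case 0
  then show ?case using assms(2) by (simp add: m_d_unit qbin_def)
next
  case (Suc i)
  have i: "i < N" "Suc i < N" using Suc.prems order_bounds by auto
  have F: "quadrilinear sR sR (\<lambda>a b c e. m (m a b) (act (\<xi> c e) (d j)))"
    by (intro lin_rules)
  have "m (d 1) (m (d i) (d j)) = (\<Sum>i'\<le>(1::nat). \<Sum>j'\<le>i. sR (q ^ ((1 - i') * j'))
      (m (m (d i') (d j')) (act (X (1 - i') (i - j')) (d j))))"
    using order_bounds R_zero_less i unfolding X_def xi_assoc by (intro sweedler2_d[OF F]) auto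
  also have "\<dots> = sR (q ^ ((1 - 1) * i)) (m (m (d 1) (d i)) (act (X (1 - 1) (i - i)) (d j)))"
  proof (rule sum_atMost_single)
    fix i' j' :: nat assume ij: "i' \<le> 1" "j' \<le> i" "(i', j') \<noteq> (1, i)"
    have "\<not> \<theta> dvd (1 - i' + (i - j'))"
    proof (rule nat_dvd_not_less)
      show "0 < 1 - i' + (i - j')" using ij by (cases "i' = 1") auto
      show "1 - i' + (i - j') < \<theta>" using ij Suc.prems by auto
    qed
    then show "sR (q ^ ((1 - i') * j')) (m (m (d i') (d j')) (act (X (1 - i') (i - j')) (d j))) = 0"
      using ij i assms(2) R_zero_less by (simp add: act_X bilinear_simps[OF m_bilinear])
  qed auto
  also have "\<dots> = sR (qnum (Suc i)) (m (d (Suc i)) (d j))"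
    using i m_y[of i] by (simp add: X_unit act_one bilinear_simps[OF m_bilinear])
  finally have eq: "sR (qnum (Suc i)) (m (d (Suc i)) (d j)) = m (d 1) (m (d i) (d j))" ..
  have nz: "qnum (Suc i) \<noteq> 0" using qnum_nonzero[of "Suc i"] Suc.prems by simp
  have "m (d (Suc i)) (d j) = sR (inverse (qnum (Suc i))) (sR (qnum (Suc i)) (m (d (Suc i)) (d j)))"
    using nz by simp
  also have "\<dots> = (if Suc i + j < N then sR (qbin (Suc i) j) (d (Suc i + j)) else 0)"
    unfolding eq using Suc.IH Suc.prems m_y[of "i + j"] nz
    by (auto simp: bilinear_simps[OF m_bilinear] qbin_def field_simps Suc_lessD)
  finally show ?case .
qed

subsection \<open>The order of q\<close>

text \<open>
  For \<open>\<theta> dvd b\<close> the numerator equals the denominator, as \<open>q\<^sup>b = 1\<close>; otherwise one of the \<open>\<theta> - 1\<close>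
  consecutive numbers above \<open>b\<close> is divisible by \<open>\<theta>\<close>.
\<close>

lemma qbin_pred_order: "qbin (\<theta> - 1) b = (if \<theta> dvd b then 1 else 0)"
proof (cases "\<theta> dvd b")
  case True
  then have "qnum (b + s + 1) = qnum (s + 1)" for s
    using q_power_eq_1_iff[of b] by (intro qnum_cong) (simp add: power_add)
  moreover have "(\<Prod>s<\<theta> - 1. qnum (s + 1)) \<noteq> 0"
    using qnum_nonzero by simp
  ultimately show ?thesis using True by (simp add: qbin_def)
next
  case False
  then have "b mod \<theta> \<noteq> 0" "b mod \<theta> < \<theta>" using order_bounds by (auto simp: dvd_eq_mod_eq_0)
  then have s: "\<theta> - 1 - b mod \<theta> < \<theta> - 1" "b + (\<theta> - 1 - b mod \<theta>) + 1 = \<theta> * (b div \<theta>) + \<theta>"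
    using mult_div_mod_eq[of \<theta> b] by linarith+
  have "\<theta> dvd b + (\<theta> - 1 - b mod \<theta>) + 1" unfolding s(2) by simp
  then have "qnum (b + (\<theta> - 1 - b mod \<theta>) + 1) = 0" by (simp only: qnum_eq_0_iff q_power_eq_1_iff)
  then have "(\<Prod>s<\<theta> - 1. qnum (b + s + 1)) = 0" using s(1) by (intro prod_zero) auto
  then show ?thesis using False by (simp add: qbin_def)
qed

text \<open>
  If \<open>\<theta> < N\<close>, the coefficient of \<open>d\<^sub>\<theta>\<^sub>+\<^sub>b\<close> in \<open>d\<^sub>\<theta> d\<^sub>b\<close> is a positive integer, computed recursively
  from the coefficient of \<open>d\<^sub>\<theta>\<^sub>+\<^sub>b\<^sub>-\<^sub>1 \<otimes> d\<^sub>1\<close> in \<open>\<delta> (d\<^sub>\<theta> d\<^sub>b)\<close>. For \<open>\<theta> + b = N\<close> there is no basis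
  element to carry it, although it is still positive: a contradiction in characteristic \<open>0\<close>.
\<close>

lemma coord_m_theta:
  assumes "\<theta> < N" "1 \<le> b" "\<theta> + b \<le> N"
  shows "(if \<theta> + b < N then coord (\<theta> + b) (m (d \<theta>) (d b)) else 0) =
    (if \<theta> dvd b then 1 else 0) + coord (\<theta> + (b - 1)) (m (d \<theta>) (d (b - 1)))"
proof -
  define t where "t = \<theta> + b - 1"
  have t: "t < N" "b < N" "t + 1 = \<theta> + b" "b < t" using assms order_bounds by (auto simp: t_def)
  let ?f = "\<lambda>i j. q ^ ((\<theta> - i) * j) * (coord t (m (d i) (d j)) * coord 1 (m (d (\<theta> - i)) (d (b - j))))"
  have "(\<Sum>i\<le>\<theta>. \<Sum>j\<le>b. ?f i j) = ?f (\<theta> - 1) b + ?f \<theta> (b - 1)"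
  proof (rule sum_atMost_pair)
    fix i j assume ij: "i \<le> \<theta>" "j \<le> b" "(i, j) \<noteq> (\<theta> - 1, b)" "(i, j) \<noteq> (\<theta>, b - 1)"
    consider "i = 0" | "0 < i" "i < \<theta>" | "i = \<theta>" using ij(1) by force
    then show "?f i j = 0"
    proof cases
      case 1
      then show ?thesis using ij t by (simp add: m_d_unit coord_d)
    next
      case 2
      then have "\<theta> - i + (b - j) \<noteq> 1" using ij by auto
      then have "coord 1 (m (d (\<theta> - i)) (d (b - j))) = 0"
        using 2 ij t m_d[of "\<theta> - i" "b - j"] by (auto simp: coord_simps coord_d)
      then show ?thesis by simp
    next
      case 3
      then show ?thesis using ij t by (auto simp: m_d_unit coord_d)
    qed
  qed (use assms order_bounds in auto)
  moreover have "?f (\<theta> - 1) b = (if \<theta> dvd b then 1 else 0)"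
  proof -
    have "m (d (\<theta> - 1)) (d b) = sR (qbin (\<theta> - 1) b) (d t)"
      using m_d[of "\<theta> - 1" b] t order_bounds by (auto simp: t_def)
    moreover have "\<theta> - (\<theta> - 1) = 1" using order_bounds by simp
    ultimately show ?thesis
      using t R_zero_less by (auto simp: m_d_unit coord_d coord_simps qbin_pred_order[simplified] q_power_eq_1_iff)
  qed
  moreover have "?f \<theta> (b - 1) = coord (\<theta> + (b - 1)) (m (d \<theta>) (d (b - 1)))"
  proof -
    have "b - (b - 1) = 1" "t = \<theta> + (b - 1)" using assms by (auto simp: t_def)
    then show ?thesis using R_zero_less by (simp add: m_d_unit coord_d)
  qed
  ultimately show ?thesis
    using coord_m[of \<theta> b t 1, unfolded t(3)] assms t R_zero_less by simp
qed

lemma theta_eq_N: "\<theta> = N"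
proof (rule ccontr)
  assume "\<theta> \<noteq> N"
  then have lt: "\<theta> < N" using order_bounds by simp
  have pos: "\<exists>k. coord (\<theta> + b) (m (d \<theta>) (d b)) = of_nat (Suc k)" if "\<theta> + b < N" for b
    using that
  proof (induction b)
    case 0
    then show ?case by (intro exI[of _ 0]) (simp add: m_d_unit coord_d)
  next
    case (Suc b)
    then obtain k where k: "coord (\<theta> + b) (m (d \<theta>) (d b)) = of_nat (Suc k)" by auto
    have "coord (\<theta> + Suc b) (m (d \<theta>) (d (Suc b))) = (if \<theta> dvd Suc b then 1 else 0) + of_nat (Suc k)"
      using coord_m_theta[OF lt, of "Suc b"] Suc.prems k by simp
    also have "\<dots> = of_nat (Suc ((if \<theta> dvd Suc b then 1 else 0) + k))" by simp
    finally show ?case by blast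
  qed
  define b where "b = N - \<theta>"
  have b: "1 \<le> b" "\<theta> + b = N" "\<theta> + (b - 1) < N" "\<theta> dvd b"
    using lt theta_dvd_N by (auto simp: b_def dvd_diff_nat)
  obtain k where "coord (\<theta> + (b - 1)) (m (d \<theta>) (d (b - 1))) = of_nat (Suc k)" using pos[OF b(3)] by auto
  then have "of_nat (Suc (Suc k)) = (0::'k)"
    using coord_m_theta[OF lt, of b] b by simp
  then show False by (metis of_nat_eq_0_iff nat.distinct(2))
qed


section \<open>The values of the cocycle\<close>

subsection \<open>The cocycle conditions on the basis\<close>

lemma q_power_1_iff: "q ^ n = 1 \<longleftrightarrow> N dvd n"
  using q_power_eq_1_iff theta_eq_N by simp

lemma qbin_simps: "qbin 1 j = qnum (j + 1)" "a < N \<Longrightarrow> qbin a 1 = qnum (a + 1)"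
proof -
  show "qbin 1 j = qnum (j + 1)" using qnum_simps(2) by (simp add: qbin_def)
  have shift: "(\<Prod>s<a. qnum (1 + s + 1)) = (\<Prod>s<a. qnum (s + 1)) * qnum (a + 1)" for a
    using qnum_simps(2) by (induction a) (simp_all add: algebra_simps)
  assume "a < N"
  then have "(\<Prod>s<a. qnum (s + 1)) \<noteq> 0" using qnum_nonzero theta_eq_N by simp
  then show "qbin a 1 = qnum (a + 1)" unfolding qbin_def shift by simp
qed

lemma xi_m:
  assumes "i < N" "j < N"
  shows "\<xi> r (m (d i) (d j)) = (if i + j < N then sH (qbin i j) (\<xi> r (d (i + j))) else 0)"
    and "\<xi> (m (d i) (d j)) r = (if i + j < N then sH (qbin i j) (\<xi> (d (i + j)) r) else 0)"
  using assms theta_eq_N by (auto simp: m_d bilinear_simps[OF xi_bilinear])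

lemma comult_X:
  assumes "a < N" "b < N"
  shows "\<Delta> (X a b) = (\<Sum>i\<le>a. \<Sum>j\<le>b. tscale (q ^ ((a - i) * j))
    (\<Sum>k<N. \<Sum>l<N. tens sH sH (X i j * (coact_entry (a - i) k * coact_entry (b - j) l)) (X k l)))"
proof -
  have F: "quadrilinear sR tscale (\<lambda>a b c e. coact_sum2 c e (\<lambda>h c0 d0. tens sH sH (\<xi> a b * h) (\<xi> c0 d0)))"
    unfolding coact_sum2_def by (intro lin_rules)
  have b1: "bilinear_map sH sR tscale (\<lambda>a v0. tlift sH sR (\<rho> w) (\<lambda>b w0. tens sH sH (x * (a * b)) (\<xi> v0 w0)))" for w x
    by (intro lin_rules)
  have b2: "bilinear_map sH sR tscale (\<lambda>b w0. tens sH sH (x * (a * b)) (\<xi> v0 w0))" for a v0 x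
    by (intro lin_rules)
  show ?thesis
    unfolding X_def xi_comult sweedler2_d[OF F assms(1)[folded theta_eq_N, THEN less_imp_le] assms]
    unfolding coact_sum2_def tlift_coact_d[OF b1]
    unfolding tlift_coact_d[OF b2] ..
qed

lemma cocycle_d:
  assumes "a < N" "b < N" "c < N"
  shows "(\<Sum>i\<le>b. \<Sum>j\<le>c. sH (q ^ ((b - i) * j)) (\<xi> (d a) (m (d i) (d j)) * X (b - i) (c - j))) =
    (\<Sum>i\<le>a. \<Sum>j\<le>b. sH (q ^ ((a - i) * j))
      (tlift sH sH (\<Delta> (X (a - i) (b - j))) (\<lambda>h1 h2. \<xi> (m (d i) (d j)) (act h1 (d c)) * h2)))"
proof -
  have F: "quadrilinear sR sH (\<lambda>a' b c e. \<xi> (d a) (m a' b) * \<xi> c e)"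
    by (intro lin_rules)
  have G: "quadrilinear sR sH (\<lambda>a b c' e. tlift sH sH (\<Delta> (\<xi> c' e)) (\<lambda>h1 h2. \<xi> (m a b) (act h1 (d c)) * h2))"
    by (intro lin_rules)
  have le: "a \<le> \<theta>" "b \<le> \<theta>" using assms theta_eq_N by auto
  show ?thesis
    using xi_cocycle[of "d b" "d c" "d a"]
    unfolding sweedler2_d[OF F le(2) assms(2,3)] sweedler2_d[OF G le(1) assms(1,2)] by (simp add: X_def)
qed

lemma bilinear_cocycle_integrand:
  "bilinear_map sH sH sH (\<lambda>h1 h2. \<xi> r (act h1 t) * h2)"
  by (intro lin_rules)

subsection \<open>Degrees below N\<close>

text \<open>
  Take the coefficient of \<open>d\<^sub>1\<close> in the twisted colinearity of \<open>m\<close> for \<open>y\<close> and \<open>d\<^sub>n\<^sub>-\<^sub>1\<close>. If \<open>\<xi>\<close> vanishes in the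
  degrees strictly between \<open>0\<close> and \<open>n\<close>, only \<open>\<rho>(y d\<^sub>n\<^sub>-\<^sub>1) = (n)\<^sub>q \<rho>(d\<^sub>n)\<close> contributes, and \<open>(n)\<^sub>q \<noteq> 0\<close>.
\<close>

lemma coact_entry_1_eq_0:
  assumes van: "\<And>i j. i < N \<Longrightarrow> j < N \<Longrightarrow> 0 < i + j \<Longrightarrow> i + j < n \<Longrightarrow> X i j = 0"
    and n: "2 \<le> n" "n < N"
  shows "coact_entry n 1 = 0"
proof (rule functionals_separate)
  fix f :: "'h \<Rightarrow> 'k" assume f: "Vector_Spaces.linear sH (*) f"
  define \<beta> where "\<beta> = (\<lambda>h r. f h * coord 1 r)"
  have \<beta>: "bilinear_map sH sR (*) \<beta>"
    unfolding \<beta>_def by (rule bilinear_mult_functionals[OF f linear_coord])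
  have F: "quadrilinear sR tscale (\<lambda>a b c e. tlift sH sR (\<rho> (m a b)) (\<lambda>h r0. tens sH sR (h * \<xi> c e) r0))"
    by (intro lin_rules)
  have F1: "bilinear_map sH sR tscale (\<lambda>h r0. tens sH sR (h * x) r0)" for x
    by (intro lin_rules)
  have G: "quadrilinear sR tscale (\<lambda>a b c e. coact_sum2 c e (\<lambda>h c0 d0. tens sH sR (\<xi> a b * h) (m c0 d0)))"
    unfolding coact_sum2_def by (intro lin_rules)
  have G1: "bilinear_map sH sR tscale (\<lambda>a v0. tlift sH sR (\<rho> w) (\<lambda>b w0. tens sH sR (x * (a * b)) (m v0 w0)))" for w x
    by (intro lin_rules)
  have G2: "bilinear_map sH sR tscale (\<lambda>b w0. tens sH sR (x * (a * b)) (m v0 w0))" for a v0 x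
    by (intro lin_rules)
  have lt: "1 \<le> \<theta>" "1 < N" "n - 1 < N" "0 < N" using n theta_eq_N by auto
  let ?f = "\<lambda>i j. tscale (q ^ ((1 - i) * j)) (tlift sH sR (\<rho> (m (d i) (d j)))
    (\<lambda>h r0. tens sH sR (h * X (1 - i) (n - 1 - j)) r0))"
  let ?g = "\<lambda>i j. tscale (q ^ ((1 - i) * j)) (\<Sum>k<N. \<Sum>l<N.
    tens sH sR (X i j * (coact_entry (1 - i) k * coact_entry (n - 1 - j) l)) (m (d k) (d l)))"
  have "(\<Sum>i\<le>1. \<Sum>j\<le>n - 1. ?f i j) = (\<Sum>i\<le>1. \<Sum>j\<le>n - 1. ?g i j)"
    using xi_coact[of "d 1" "d (n - 1)"]
    unfolding sweedler2_d[OF F lt(1-3)] sweedler2_d[OF G lt(1-3)]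
    unfolding coact_sum2_def tlift_coact_d[OF G1]
    unfolding tlift_coact_d[OF G2] by (simp only: X_def)
  moreover have "(\<Sum>i\<le>1. \<Sum>j\<le>n - 1. ?f i j) = ?f 0 0 + ?f 1 (n - 1)"
  proof (rule sum_atMost_pair)
    fix i j :: nat assume ij: "i \<le> 1" "j \<le> n - 1" "(i, j) \<noteq> (0, 0)" "(i, j) \<noteq> (1, n - 1)"
    have "X (1 - i) (n - 1 - j) = 0"
    proof (rule van)
      show "0 < 1 - i + (n - 1 - j)" using ij n by (cases "i = 1") auto
      show "1 - i + (n - 1 - j) < n" using ij n by (cases "i = 1") auto
    qed (use ij n in auto)
    then show "?f i j = 0"
      by (simp only: mult_zero_right bilinear_simps(3)[OF HR_tens] tlift_def split_def sum_list_0
          tscale_simps)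
  qed (use n in auto)
  moreover have "(\<Sum>i\<le>1. \<Sum>j\<le>n - 1. ?g i j) = ?g 0 0 + ?g 1 (n - 1)"
  proof (rule sum_atMost_pair)
    fix i j :: nat assume ij: "i \<le> 1" "j \<le> n - 1" "(i, j) \<noteq> (0, 0)" "(i, j) \<noteq> (1, n - 1)"
    have "X i j = 0"
    proof (rule van)
      show "0 < i + j" "i + j < n" using ij n by (cases "i = 1"; force)+
    qed (use ij n in auto)
    then show "?g i j = 0"
      by (simp only: mult_zero_left bilinear_simps(3)[OF HR_tens] sum.neutral_const
          tscale_simps)
  qed (use n in auto)
  ultimately have eq: "(?f 0 0 + ?f 1 (n - 1)) \<beta> = (?g 0 0 + ?g 1 (n - 1)) \<beta>" by simp
  have f00: "?f 0 0 \<beta> = 0"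
  proof -
    have "?f 0 0 \<beta> = (\<Sum>k<N. tens sH sR (coact_entry 0 k * X 1 (n - 1)) (d k) \<beta>)"
      by (simp add: tscale_def m_d_unit tlift_coact_d[OF F1] linear_simps(6)[OF linear_eval])
    also have "\<dots> = 0"
      unfolding tens_apply[OF \<beta>]
      using lt by (intro sum.neutral) (auto simp: \<beta>_def coord_d coact_entry_0_left linear_simps[OF f])
    finally show ?thesis .
  qed
  have f1: "?f 1 (n - 1) \<beta> = qnum n * f (coact_entry n 1)"
  proof -
    have md: "m (d 1) (d (n - 1)) = sR (qnum n) (d n)" using m_y[of "n - 1"] n by simp
    have lin: "Vector_Spaces.linear sR (*) (\<lambda>r. tlift sH sR (\<rho> r) (\<lambda>h r0. tens sH sR (h * 1) r0) \<beta>)"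
      by (rule linear_comp[OF linear_eval linear_tlift_coact[OF F1 linear_map_ident[OF R_space]]])
    have "?f 1 (n - 1) \<beta> = tlift sH sR (\<rho> (sR (qnum n) (d n))) (\<lambda>h r0. tens sH sR (h * 1) r0) \<beta>"
      using lt by (simp add: tscale_def md[unfolded One_nat_def] X_unit)
    also have "\<dots> = qnum n * (\<Sum>k<N. tens sH sR (coact_entry n k) (d k) \<beta>)"
      unfolding linear_simps(2)[OF lin] tlift_coact_d[OF F1] by (simp add: linear_simps(6)[OF linear_eval])
    also have "(\<Sum>k<N. tens sH sR (coact_entry n k) (d k) \<beta>) = (\<Sum>k<N. if k = 1 then f (coact_entry n 1) else 0)"
      unfolding tens_apply[OF \<beta>] by (intro sum.cong) (auto simp: \<beta>_def coord_d)
    finally show ?thesis using lt by simp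
  qed
  have g00: "?g 0 0 \<beta> = 0"
  proof -
    have "?g 0 0 \<beta> = (\<Sum>k<N. \<Sum>l<N. \<beta> (coact_entry 1 k * coact_entry (n - 1) l) (m (d k) (d l)))"
      using lt by (simp add: tscale_def X_unit linear_simps(6)[OF linear_eval] tens_apply[OF \<beta>])
    also have "\<dots> = 0"
    proof (intro sum.neutral ballI)
      fix k l assume kl: "k \<in> {..<N}" "l \<in> {..<N}"
      show "\<beta> (coact_entry 1 k * coact_entry (n - 1) l) (m (d k) (d l)) = 0"
      proof (cases "k = 1 \<and> l \<noteq> 0")
        case True
        then show ?thesis using kl m_y[of l] by (auto simp: \<beta>_def coord_simps coord_d)
      next
        case False
        then show ?thesis
          using kl n coact_entry_1_left[of k] coact_entry_0_right[of "n - 1"]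
          by (auto simp: \<beta>_def linear_simps[OF f])
      qed
    qed
    finally show ?thesis .
  qed
  have g1: "?g 1 (n - 1) \<beta> = 0"
  proof -
    have "?g 1 (n - 1) \<beta> = (\<Sum>k<N. \<Sum>l<N. \<beta> (X 1 (n - 1) * (coact_entry 0 k * coact_entry 0 l)) (m (d k) (d l)))"
      by (simp add: tscale_def linear_simps(6)[OF linear_eval] tens_apply[OF \<beta>])
    also have "\<dots> = 0"
      by (intro sum.neutral ballI)
         (auto simp: \<beta>_def coact_entry_0_left linear_simps[OF f] m_d_unit coord_d)
    finally show ?thesis .
  qed
  have "qnum n * f (coact_entry n 1) = 0"
    using eq f00 f1 g00 g1 by (simp only: plus_fun_apply) simp
  then show "f (coact_entry n 1) = f 0"
    using qnum_nonzero[of n] n theta_eq_N by (simp add: linear_simps[OF f])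
qed

text \<open>
  An entry in position \<open>(n, k)\<close> is a sum of products of \<open>k\<close> entries of column \<open>1\<close> whose rows add up to
  \<open>n\<close>. If \<open>0 < n - k \<le> e\<close> and no row is \<open>0\<close>, one of them lies between \<open>2\<close> and \<open>e + 1\<close>.
\<close>

lemma coact_entry_off_diagonal:
  assumes "\<And>k. 2 \<le> k \<Longrightarrow> k \<le> e + 1 \<Longrightarrow> k < N \<Longrightarrow> coact_entry k 1 = 0"
    and "k < n" "n \<le> k + e" "n < N"
  shows "coact_entry n k = 0"
  using assms(2-)
proof (induction k arbitrary: n)
  case 0
  then show ?case by (simp add: coact_entry_0_right)
next
  case (Suc k)
  have "coact_entry n (Suc k) = (\<Sum>t\<le>n. coact_entry t k * coact_entry (n - t) 1)"
    using coact_entry_add[of n k 1] Suc.prems by simp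
  also have "\<dots> = 0"
  proof (intro sum.neutral ballI)
    fix t assume "t \<in> {..n}"
    then consider "t < k" | "t = k" | "k < t" "t \<le> k + e" | "t = n"
      using Suc.prems by force
    then show "coact_entry t k * coact_entry (n - t) 1 = 0"
    proof cases
      case 1
      then show ?thesis using Suc.prems by (simp add: coact_entry_eq_0)
    next
      case 2
      then show ?thesis using assms(1)[of "n - t"] Suc.prems by simp
    next
      case 3
      then show ?thesis using Suc.IH[of t] \<open>t \<in> {..n}\<close> Suc.prems by simp
    next
      case 4
      then show ?thesis using coact_entry_0_left[of 1] Suc.prems by simp
    qed
  qed
  finally show ?case .
qed

text \<open>
  One exceptional degree \<open>p\<close> is allowed in which \<open>\<xi>\<close> need not vanish, provided that \<open>a + b < 2 p\<close>. In a
  mixed term of \<open>\<Delta> (X a b)\<close> a factor of degree \<open>p\<close> leaves a remaining degree less than \<open>p\<close>, in which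
  \<open>\<xi>\<close> vanishes and the coaction matrix is diagonal.
\<close>

lemma X_skew_primitive:
  assumes ab: "a < N" "b < N" and n: "0 < a + b" "a + b \<le> N" "a + b < 2 * p"
    and van: "\<And>i j. i < N \<Longrightarrow> j < N \<Longrightarrow> 0 < i + j \<Longrightarrow> i + j < a + b \<Longrightarrow> i + j \<noteq> p \<Longrightarrow> X i j = 0"
  shows "skew_primitive (g ^ (a + b)) (X a b)"
proof -
  have one: "coact_entry k 1 = 0" if "2 \<le> k" "k \<le> p" "k \<le> a + b" "k < N" for k
    using that by (intro coact_entry_1_eq_0 van) auto
  have off: "coact_entry n' k = 0" if "k < n'" "n' - k < p" "n' - k < a + b" "n' < N" for n' k
    by (rule coact_entry_off_diagonal[where e = "n' - k", OF one]) (use that in auto)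
  have zero: "tens sH sH 0 z = 0" "tens sH sH z 0 = 0" for z
    by (simp_all only: bilinear_simps[OF H_tens])
  let ?t = "\<lambda>i j k l. tens sH sH (X i j * (coact_entry (a - i) k * coact_entry (b - j) l)) (X k l)"
  let ?f = "\<lambda>i j. tscale (q ^ ((a - i) * j)) (\<Sum>k<N. \<Sum>l<N. ?t i j k l)"
  have "(\<Sum>i\<le>a. \<Sum>j\<le>b. ?f i j) = ?f 0 0 + ?f a b"
  proof (rule sum_atMost_pair)
    fix i j assume ij: "i \<le> a" "j \<le> b" "(i, j) \<noteq> (0, 0)" "(i, j) \<noteq> (a, b)"
    have deg: "0 < i + j" "i + j < a + b" using ij by auto
    have t0: "?t i j k l = 0" if kl: "k < N" "l < N" for k l
    proof (cases "i + j = p")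
      case False
      then have "X i j = 0" using van ij ab deg by simp
      then show ?thesis by (simp only: mult_zero_left zero)
    next
      case True
      consider "k = 0" "l = 0" | "a - i < k" | "b - j < l" | "k \<le> a - i" "l \<le> b - j" "0 < k + l"
        by force
      then show ?thesis
      proof cases
        case 1
        have "coact_entry (a - i) 0 * coact_entry (b - j) 0 = 0"
          using deg ij ab coact_entry_0_right[of "a - i"] coact_entry_0_right[of "b - j"] by auto
        then show ?thesis using 1 by (simp only: mult_zero_right zero)
      next
        case 2
        then show ?thesis using kl by (simp only: coact_entry_eq_0 mult_zero_left mult_zero_right zero)
      next
        case 3
        then show ?thesis using kl by (simp only: coact_entry_eq_0 mult_zero_left mult_zero_right zero)
      next
        case 4
        then have "X k l = 0" using van[of k l] kl True deg n ij by simp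
        then show ?thesis by (simp only: zero)
      qed
    qed
    have "(\<Sum>k<N. \<Sum>l<N. ?t i j k l) = 0" by (intro sum.neutral ballI t0) auto
    then show "?f i j = 0" by (simp only: tscale_simps)
  qed (use n in auto)
  moreover have "?f 0 0 = tens sH sH (g ^ (a + b)) (X a b)"
  proof -
    have "(\<Sum>k<N. \<Sum>l<N. ?t 0 0 k l) = ?t 0 0 a b"
    proof (rule sum_double_single)
      fix k l assume "k \<in> {..<N}" "l \<in> {..<N}" "(k, l) \<noteq> (a, b)"
      then have kl: "k < N" "l < N" "(k, l) \<noteq> (a, b)" by auto
      consider "k = 0" "l = 0" | "a < k" | "b < l" | "k \<le> a" "l \<le> b" "0 < k + l" "k + l < a + b"
        using kl(3) by force
      then show "?t 0 0 k l = 0"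
      proof cases
        case 1
        have "coact_entry (a - 0) 0 * coact_entry (b - 0) 0 = 0"
          using n ab coact_entry_0_right[of a] coact_entry_0_right[of b] by auto
        then show ?thesis using 1 by (simp only: mult_zero_right zero)
      next
        case 2
        then have "coact_entry (a - 0) k = 0" using kl by (simp add: coact_entry_eq_0)
        then show ?thesis by (simp only: mult_zero_left mult_zero_right zero)
      next
        case 3
        then have "coact_entry (b - 0) l = 0" using kl by (simp add: coact_entry_eq_0)
        then show ?thesis by (simp only: mult_zero_right zero)
      next
        case 4
        show ?thesis
        proof (cases "k + l = p")
          case False
          then have "X k l = 0" using van[of k l] kl 4 by simp
          then show ?thesis by (simp only: zero)
        next
          case True
          consider "k < a" | "l < b" using 4 by force
          then have "coact_entry (a - 0) k * coact_entry (b - 0) l = 0"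
          proof cases
            case 1
            then have "coact_entry a k = 0" using 4 True n ab by (intro off) auto
            then show ?thesis by simp
          next
            case 2
            then have "coact_entry b l = 0" using 4 True n ab by (intro off) auto
            then show ?thesis by simp
          qed
          then show ?thesis by (simp only: mult_zero_right zero)
        qed
      qed
    qed (use ab in auto)
    also have "\<dots> = tens sH sH (g ^ (a + b)) (X a b)"
      using ab R_zero_less by (simp add: X_unit coact_entry_diag power_add)
    finally show ?thesis by (simp add: tscale_simps)
  qed
  moreover have "?f a b = tens sH sH (X a b) 1"
  proof -
    have "(\<Sum>k<N. \<Sum>l<N. ?t a b k l) = ?t a b 0 0"
    proof (rule sum_double_single)
      fix k l assume kl: "k \<in> {..<N}" "l \<in> {..<N}" "(k, l) \<noteq> (0, 0)"
      then have "coact_entry (a - a) k * coact_entry (b - b) l = 0"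
        by (auto simp: coact_entry_0_left)
      then show "?t a b k l = 0" by (simp only: mult_zero_right zero)
    qed (use R_zero_less in auto)
    also have "\<dots> = tens sH sH (X a b) 1"
      using R_zero_less by (simp add: X_unit coact_entry_0_left)
    finally show ?thesis by (simp add: tscale_simps)
  qed
  ultimately show ?thesis
    unfolding skew_primitive_def comult_X[OF ab] by (simp only: add.commute)
qed

lemma tlift_skew_primitive:
  assumes "skew_primitive \<gamma> z" "bilinear_map sH sH sU F"
  shows "tlift sH sH (\<Delta> z) F = F z 1 + F \<gamma> z"
  using tlift_sum_list[OF assms(2)] unfolding skew_primitive_sum_list[OF assms(1)]
  by (simp del: sum_list.Cons sum_list.Nil list.map) simp

lemma power_g_X:
  assumes "a < N" "b < N"
  shows "g ^ i * X a b = sH (q ^ ((a + b) * i)) (X a b * g ^ i)"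
proof (induction i)
  case (Suc i)
  have "g ^ Suc i * X a b = g * sH (q ^ ((a + b) * i)) (X a b * g ^ i)"
    using Suc by (simp add: mult.assoc)
  also have "\<dots> = sH (q ^ ((a + b) * i)) (g * X a b * g ^ i)"
    by (simp add: bilinear_simps[OF mult_bilinear] mult.assoc)
  also have "\<dots> = sH (q ^ ((a + b) * Suc i)) (X a b * g ^ Suc i)"
    by (simp add: X_weight[OF assms] bilinear_simps[OF mult_bilinear] mult.assoc algebra_simps power_add[symmetric])
  finally show ?case .
qed simp

lemma character_power: "\<chi> (g ^ n) = q ^ n"
  by (induction n) (auto simp: character)

lemma sH_eq_imp_zero:
  assumes "sH c (z * g) = z * g" "c \<noteq> 1"
  shows "z = 0"
proof -
  have "sH (c - 1) (z * g) = 0" using assms(1) by (simp add: scale_left_diff_distrib)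
  then have "z * g = 0" using assms(2) by simp
  then have "z * g * S g = 0" by simp
  then show ?thesis by (simp add: mult.assoc antipode_g)
qed

text \<open>
  The compatibility of \<open>g\<close> and \<open>\<chi>\<close>, for the skew-primitive element \<open>z = \<xi>(d\<^sub>a \<otimes> d\<^sub>b)\<close>, says that
  \<open>q\<^sup>n g z = z g\<close> with \<open>n = a + b\<close>, whereas \<open>g z = q\<^sup>n z g\<close> by equivariance.
\<close>

lemma X_eq_0_or_half:
  assumes ab: "a < N" "b < N" "0 < a + b" "a + b < N" and skew: "skew_primitive (g ^ (a + b)) (X a b)"
    and half: "2 * (a + b) \<noteq> N"
  shows "X a b = 0"
proof -
  define z where "z = X a b"
  define n where "n = a + b"
  have nd: "\<not> N dvd n" using ab by (auto simp: n_def dest: dvd_imp_le)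
  have "act z (d 1) = 0"
    using act_X[of a b 1] ab nd R_zero_less theta_eq_N by (simp add: z_def n_def)
  then have "coord 1 (sR (\<chi> z) (d 1)) = 0"
    using act_y[of z] linear_simps(3)[OF linear_coord] by (simp only: basis_facts(5))
  then have \<chi>z: "\<chi> z = 0" using R_zero_less by (simp only: coord_simps coord_d) simp
  have b: "bilinear_map sH sH sH (\<lambda>h1 h2. sH (\<chi> h1) h2)" "bilinear_map sH sH sH (\<lambda>h1 h2. sH (\<chi> h2) h1)"
    by (rule bilinear_scale_right[OF character(1) H_space], rule bilinear_scale_left[OF character(1) H_space])
  have skew': "skew_primitive (g ^ n) z" using skew by (simp add: z_def n_def)
  have "g * tlift sH sH (\<Delta> z) (\<lambda>h1 h2. sH (\<chi> h1) h2) = tlift sH sH (\<Delta> z) (\<lambda>h1 h2. sH (\<chi> h2) h1) * g"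
    using datum by (simp add: yd_datum_def)
  then have "sH (q ^ n) (g * z) = z * g"
    unfolding tlift_skew_primitive[OF skew' b(1)] tlift_skew_primitive[OF skew' b(2)]
    by (simp add: \<chi>z character(2) character_power bilinear_simps[OF mult_bilinear])
  moreover have "g * z = sH (q ^ n) (z * g)" using X_weight ab by (simp add: z_def n_def)
  ultimately have "sH (q ^ (2 * n)) (z * g) = z * g" by (simp add: mult_2 power_add)
  moreover have "q ^ (2 * n) \<noteq> 1"
  proof
    assume "q ^ (2 * n) = 1"
    then obtain k where k: "2 * n = N * k" by (auto simp: q_power_1_iff elim: dvdE)
    have "0 < N * k" "N * k < N * 2" unfolding k[symmetric] using ab by (simp_all add: n_def)
    then have "k = 1" by simp
    then show False using k half by (simp add: n_def)
  qed
  ultimately show ?thesis using sH_eq_imp_zero by (simp add: z_def)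
qed

text \<open>
  Induction on the degree, with half of \<open>N\<close> as the exceptional degree. For odd \<open>N\<close> there is none, and
  \<open>p = N\<close> excepts nothing.
\<close>

lemma X_below:
  assumes "a < N" "b < N" "0 < a + b" "a + b < N"
  shows "skew_primitive (g ^ (a + b)) (X a b)" "2 * (a + b) \<noteq> N \<Longrightarrow> X a b = 0"
proof -
  define p where "p = (if even N then N div 2 else N)"
  have *: "skew_primitive (g ^ (a + b)) (X a b) \<and> (2 * (a + b) \<noteq> N \<longrightarrow> X a b = 0)"
    using assms
  proof (induction "a + b" arbitrary: a b rule: less_induct)
    case less
    have "skew_primitive (g ^ (a + b)) (X a b)"
    proof (rule X_skew_primitive[where p = p])
      fix i j assume "i < N" "j < N" "0 < i + j" "i + j < a + b" "i + j \<noteq> p"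
      moreover have "2 * (i + j) \<noteq> N" using \<open>i + j \<noteq> p\<close> by (auto simp: p_def split: if_splits)
      ultimately show "X i j = 0" using less.hyps[of i j] less.prems by auto
    qed (use less.prems in \<open>auto simp: p_def\<close>)
    then show ?case using X_eq_0_or_half less.prems by blast
  qed
  then show "skew_primitive (g ^ (a + b)) (X a b)" "2 * (a + b) \<noteq> N \<Longrightarrow> X a b = 0" by auto
qed

text \<open>
  For even \<open>p\<close> the element commutes with \<open>g\<^sup>p\<close>, as \<open>q\<^sup>p\<^sup>p = 1\<close>. So in both cases it is a multiple of
  \<open>1 - g\<^sup>p\<close>; then it commutes with \<open>g\<close>, although its weight is \<open>q\<^sup>p \<noteq> 1\<close>.
\<close>

lemma X_half_eq_0:
  assumes H: "finite_dimensional sH \<or> cosemisimple sH \<Delta>" and N: "2 * p = N" and ab: "a + b = p"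
    and "even p \<or> cosemisimple sH \<Delta>"
  shows "X a b = 0"
proof -
  have lt: "a < N" "b < N" "0 < a + b" "a + b < N" using N ab R_zero_less by auto
  have "cosemisimple sH \<Delta> \<or> g ^ p * X a b = X a b * g ^ p"
  proof (cases "cosemisimple sH \<Delta>")
    case False
    then obtain k where "p = 2 * k" using assms(4) by auto
    then have "(a + b) * p = N * k" using N ab by simp
    then have "q ^ ((a + b) * p) = 1" by (simp only: q_power_1_iff dvd_triv_left)
    then show ?thesis using power_g_X[OF lt(1,2), of p] by simp
  qed simp
  then obtain l where l: "X a b = sH l (1 - g ^ p)"
    using H.skew_primitive_trivial[OF H grouplike_power[OF grouplike_g] X_below(1)[OF lt]] ab by auto
  have "g * X a b = X a b * g"
    by (simp add: l bilinear_simps[OF mult_bilinear] algebra_simps power_commutes)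
  then have "sH (q ^ (a + b)) (X a b * g) = X a b * g" using X_weight[OF lt(1,2)] by simp
  moreover have "q ^ (a + b) \<noteq> 1" using lt by (auto simp: q_power_1_iff dest: dvd_imp_le)
  ultimately show ?thesis by (rule sH_eq_imp_zero)
qed


subsection \<open>Degree N\<close>

text \<open>
  The cocycle identity for \<open>d\<^sub>a, y, d\<^sub>c\<close>, with \<open>n = a + 1 + c\<close>: beyond the two leading terms it only
  involves products of two values of \<open>\<xi>\<close> in complementary degrees.
\<close>

lemma cocycle_step:
  assumes ac: "1 \<le> a" "1 \<le> c" "a + 1 + c \<le> N"
    and prod: "\<And>i j k l. i < N \<Longrightarrow> j < N \<Longrightarrow> k < N \<Longrightarrow> l < N \<Longrightarrow> 0 < i + j \<Longrightarrow> 0 < k + l \<Longrightarrow>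
      i + j + (k + l) = a + 1 + c \<Longrightarrow> X i j * X k l = 0"
  shows "sH (qnum (c + 1)) (X a (c + 1)) = sH (qnum (a + 1)) (X (a + 1) c)"
proof -
  have lt: "a < N" "1 < N" "c < N" "a + 1 < N" "c + 1 < N" "0 < N" using ac by auto
  let ?f = "\<lambda>i j. sH (q ^ ((1 - i) * j)) (\<xi> (d a) (m (d i) (d j)) * X (1 - i) (c - j))"
  let ?g = "\<lambda>i j. sH (q ^ ((a - i) * j))
      (tlift sH sH (\<Delta> (X (a - i) (1 - j))) (\<lambda>h1 h2. \<xi> (m (d i) (d j)) (act h1 (d c)) * h2))"
  have "(\<Sum>i\<le>1. \<Sum>j\<le>c. ?f i j) = (\<Sum>i\<le>a. \<Sum>j\<le>1. ?g i j)"
    using cocycle_d[OF lt(1-3)] .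
  moreover have "(\<Sum>i\<le>1. \<Sum>j\<le>c. ?f i j) = ?f 1 c"
  proof (rule sum_atMost_single)
    fix i j :: nat assume ij: "i \<le> 1" "j \<le> c" "(i, j) \<noteq> (1, c)"
    have "X a (i + j) * X (1 - i) (c - j) = 0"
    proof (rule prod)
      show "0 < 1 - i + (c - j)" using ij by (cases "i = 1") auto
    qed (use ij ac in auto)
    then show "?f i j = 0"
      using xi_m(1)[of i j "d a"] ij lt by (simp add: X_def[symmetric] bilinear_simps[OF mult_bilinear])
  qed auto
  moreover have "?f 1 c = sH (qnum (c + 1)) (X a (c + 1))"
    using xi_m(1)[of 1 c "d a"] qbin_simps(1)[of c] lt by (simp add: X_def[symmetric] X_unit)
  moreover have "(\<Sum>i\<le>a. \<Sum>j\<le>1. ?g i j) = ?g a 1"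
  proof (rule sum_atMost_single)
    fix i j :: nat assume ij: "i \<le> a" "j \<le> 1" "(i, j) \<noteq> (a, 1)"
    define D where "D = a - i + (1 - j)"
    have D: "0 < D" "D < N" "i + j + D = a + 1" using ij lt by (auto simp: D_def)
    have b: "a - i < N" "1 - j < N" "i < N" "j < N" using ij lt by auto
    have sk: "skew_primitive (g ^ D) (X (a - i) (1 - j))"
      using X_below(1)[OF b(1,2)] D(1,2) unfolding D_def by blast
    have "act (X (a - i) (1 - j)) (d c) = 0"
      using b lt D by (intro act_X) (auto simp: theta_eq_N D_def[symmetric] dest: dvd_imp_le)
    moreover have "\<xi> (m (d i) (d j)) (act (g ^ D) (d c)) * X (a - i) (1 - j) = 0"
    proof -
      have "act (g ^ k) (d c) = sR (q ^ (c * k)) (d c)" for k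
        by (induction k) (use lt in \<open>auto simp: act_one act_mult basis_facts(7) act_linear_simps power_add mult.commute\<close>)
      moreover have "i + j < N \<Longrightarrow> X (i + j) c * X (a - i) (1 - j) = 0"
        using D ac b lt by (intro prod) (auto simp: D_def)
      ultimately show ?thesis
        using xi_m(2)[OF b(3,4)]
        by (simp add: X_def[symmetric] bilinear_simps[OF xi_bilinear] bilinear_simps[OF mult_bilinear])
    qed
    ultimately show "?g i j = 0"
      unfolding tlift_skew_primitive[OF sk bilinear_cocycle_integrand]
      by (simp add: bilinear_simps[OF xi_bilinear])
  qed auto
  moreover have "?g a 1 = sH (qnum (a + 1)) (X (a + 1) c)"
    using xi_m(2)[of a 1 "d c"] qbin_simps(2)[of a] lt
    by (simp add: X_unit comult_one tlift_tens[OF bilinear_cocycle_integrand] act_one X_def[symmetric])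
  ultimately show ?thesis by simp
qed

definition qfact :: "nat \<Rightarrow> 'k" where "qfact n = (\<Prod>s<n. qnum (s + 1))"

lemma qfact_simps: "qfact 0 = 1" "qfact (Suc n) = qfact n * qnum (n + 1)"
  by (simp_all add: qfact_def)

lemma qfact_nonzero: "n < N \<Longrightarrow> qfact n \<noteq> 0"
  using qnum_nonzero theta_eq_N by (auto simp: qfact_def)

lemma qfact_eq_0: "N \<le> n \<Longrightarrow> qfact n = 0"
  unfolding qfact_def using qnum_N R_zero_less by (intro prod_zero) (auto intro!: bexI[of _ "N - 1"])

text \<open>
  Equivalently, \<open>\<xi>(y\<^sup>a \<otimes> y\<^sup>n\<^sup>-\<^sup>a)\<close> does not depend on \<open>a\<close>, because \<open>y\<^sup>k = (k)\<^sub>q! d\<^sub>k\<close>.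
\<close>

lemma X_ratio:
  assumes a: "1 \<le> a" "a < n" and n: "n \<le> N"
    and prod: "\<And>i j k l. i < N \<Longrightarrow> j < N \<Longrightarrow> k < N \<Longrightarrow> l < N \<Longrightarrow> 0 < i + j \<Longrightarrow> 0 < k + l \<Longrightarrow>
      i + j + (k + l) = n \<Longrightarrow> X i j * X k l = 0"
  shows "sH (qfact a * qfact (n - a)) (X a (n - a)) = sH (qfact (n - 1)) (X 1 (n - 1))"
  using a
proof (induction a rule: nat_induct_at_least)
  case base
  then show ?case using qnum_simps by (simp add: qfact_def)
next
  case (Suc a)
  define c where "c = n - Suc a"
  have c: "1 \<le> c" "n - a = c + 1" "a + 1 + c = n" using Suc by (auto simp: c_def)
  have step: "sH (qnum (c + 1)) (X a (c + 1)) = sH (qnum (a + 1)) (X (a + 1) c)"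
    using Suc.hyps c n prod by (intro cocycle_step) auto
  have "sH (qfact (Suc a) * qfact c) (X (Suc a) c)
      = sH (qfact a * qfact c) (sH (qnum (a + 1)) (X (a + 1) c))"
    by (simp add: qfact_simps mult_ac)
  also have "\<dots> = sH (qfact a * qfact (c + 1)) (X a (c + 1))"
    by (subst step[symmetric]) (simp add: qfact_simps mult_ac)
  also have "\<dots> = sH (qfact (n - 1)) (X 1 (n - 1))" using Suc c by simp
  finally show ?case by (simp add: c_def)
qed

text \<open>
  In degree \<open>p\<close> all values are multiples of \<open>x = X 1 (p - 1)\<close>. For odd \<open>p\<close>, equivariance of \<open>\<xi>\<close> under
  the skew-primitive element \<open>x\<close> itself, which acts on \<open>R\<close> as \<open>0\<close>, reads
  \<open>x x + g\<^sup>p x S(x) = 0\<close>. Here \<open>g\<^sup>p S(x) = -x\<close> and \<open>g\<^sup>p x = -x g\<^sup>p\<close>, so that \<open>2 x\<^sup>2 = 0\<close>.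
\<close>

lemma half_square:
  assumes H: "finite_dimensional sH \<or> cosemisimple sH \<Delta>" and N: "2 * p = N"
    and ab: "a + b = p" and ce: "c + e = p"
  shows "X a b * X c e = 0"
proof (cases "even p \<or> a = 0 \<or> b = 0 \<or> c = 0 \<or> e = 0")
  case True
  have "X i j = 0" if "i + j = p" "i = 0 \<or> j = 0" for i j
    using that N R_zero_less X_unit by auto
  then show ?thesis using True X_half_eq_0[OF H N ab] ab ce by (elim disjE) auto
next
  case False
  define x where "x = X 1 (p - 1)"
  have lt: "1 < N" "p - 1 < N" "0 < 1 + (p - 1)" "1 + (p - 1) < N" and p: "p < N" "0 < p" "1 + (p - 1) = p"
    using N R_zero_less False ab by auto
  have low: "X i j = 0" if "i < N" "j < N" "0 < i + j" "i + j < p" for i j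
    using X_below(2)[of i j] that N by simp
  have mult: "\<exists>\<kappa>. X i j = sH \<kappa> x" if "i + j = p" "i \<noteq> 0" "j \<noteq> 0" for i j
  proof -
    have eq: "sH (qfact i * qfact (p - i)) (X i (p - i)) = sH (qfact (p - 1)) (X 1 (p - 1))"
    proof (rule X_ratio)
      fix i' j' k l assume "i' < N" "j' < N" "0 < i' + j'" "0 < k + l" "i' + j' + (k + l) = p"
      then have "X i' j' = 0" by (intro low) auto
      then show "X i' j' * X k l = 0" by simp
    qed (use that p in auto)
    define c where "c = qfact i * qfact (p - i)"
    have "c \<noteq> 0" using qfact_nonzero p that by (simp add: c_def)
    then have "X i (p - i) = sH (inverse c) (sH c (X i (p - i)))" by simp
    also have "\<dots> = sH (inverse c * qfact (p - 1)) x" using eq by (simp add: c_def x_def)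
    finally have "X i (p - i) = sH (inverse c * qfact (p - 1)) x" .
    then show ?thesis using that by auto
  qed
  have skew: "skew_primitive (g ^ p) x"
    using X_below(1)[OF lt] p by (simp add: x_def)
  have nd: "\<not> N dvd p" using p by (auto dest: dvd_imp_le)
  have act0: "act x (d n) = 0" if "n < N" for n
    unfolding x_def using lt that nd p theta_eq_N by (intro act_X) auto
  have S1: "S 1 = 1" using grouplike_antipode(1)[OF grouplike_one] by simp
  have bS: "bilinear_map sH sH sH (\<lambda>h1 h2. h1 * S h2)" by (intro lin_rules)
  have "\<epsilon>H x = 0" using lt by (simp add: x_def X_def xi_counit counit_d)
  then have Sx: "g ^ p * S x = - x"
    using antipode_right[of x] unfolding tlift_skew_primitive[OF skew bS]
    by (simp add: S1 eq_neg_iff_add_eq_0 add.commute)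
  have bl: "bilinear_map sH sH sH (\<lambda>h1 h2. \<xi> (act h1 r) (act h2 s))"
    and br: "bilinear_map sH sH sH (\<lambda>h1 h2. h1 * \<xi> r s * S h2)" for r s
    by (intro lin_rules)+
  have x_eq: "\<xi> (d 1) (d (p - 1)) = x" by (simp only: x_def X_def)
  have "x * x + g ^ p * x * S x = 0"
    using xi_act[of x "d 1" "d (p - 1)"] act0[of 1] act0[of "p - 1"] lt
    unfolding tlift_skew_primitive[OF skew bl] tlift_skew_primitive[OF skew br]
    unfolding x_eq
    by (simp add: bilinear_simps[OF xi_bilinear] S1)
  moreover have "g ^ p * x = - (x * g ^ p)"
  proof -
    have "(q ^ p) ^ 2 = 1" using N q_power_1_iff[of N] by (simp flip: power_mult add: mult.commute)
    moreover have "q ^ p \<noteq> 1" using nd by (simp add: q_power_1_iff)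
    ultimately have "q ^ p = - 1" by (simp add: power2_eq_1_iff)
    then have "q ^ (p * p) = - 1" using False by (simp add: power_mult)
    moreover have "g ^ p * x = sH (q ^ (p * p)) (x * g ^ p)"
      using power_g_X[OF lt(1,2), of p] unfolding p(3) x_def .
    ultimately show ?thesis by simp
  qed
  then have "g ^ p * x * S x = x * x" using Sx by (simp add: mult.assoc)
  ultimately have "x * x + x * x = 0" by simp
  moreover have "sH (1 + 1) (x * x) = x * x + x * x" unfolding scale_left_distrib by simp
  ultimately have "sH 2 (x * x) = 0" by simp
  then have "x * x = 0" by simp
  moreover obtain \<kappa> where "X a b = sH \<kappa> x" using mult[of a b] False ab by auto
  moreover obtain \<kappa>' where "X c e = sH \<kappa>' x" using mult[of c e] False ce by auto
  ultimately show ?thesis by (simp add: bilinear_simps[OF mult_bilinear])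
qed

text \<open>
  At distance \<open>p\<close> from the diagonal only the entry \<open>A\<close> in position \<open>(p + 1, 1)\<close> matters, and entry
  \<open>k\<close> is the sum of the \<open>g\<^sup>i A g\<^sup>k\<^sup>-\<^sup>1\<^sup>-\<^sup>i\<close> with \<open>i < k\<close>. It alternates because \<open>g A = -A g\<close>.
\<close>

lemma coact_entry_half:
  assumes N: "2 * p = N" and k: "p + k < N"
  shows "coact_entry (p + k) k = (if odd k then coact_entry (p + 1) 1 * g ^ (k - 1) else 0)"
  using k
proof (induction k)
  case 0
  then show ?case using N by (simp add: coact_entry_0_right)
next
  case (Suc k)
  define A where "A = coact_entry (p + 1) 1"
  have p: "0 < p" "p + 1 < N" "k < p" using Suc.prems N R_zero_less by auto
  have "coact_entry n 1 = 0" if "2 \<le> n" "n \<le> p" for n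
  proof (rule coact_entry_1_eq_0)
    fix i j assume "i < N" "j < N" "0 < i + j" "i + j < n"
    then show "X i j = 0" using X_below(2)[of i j] that N by simp
  qed (use that N R_zero_less in auto)
  then have off: "coact_entry n l = 0" if "l < n" "n < l + p" "n < N" for n l
    by (rule coact_entry_off_diagonal[where e = "p - 1"]) (use that in auto)
  have "coact_entry (p + Suc k) (Suc k) = (\<Sum>t\<le>p + Suc k. coact_entry t k * coact_entry (p + Suc k - t) 1)"
    using coact_entry_add[of "p + Suc k" k 1] Suc.prems by simp
  also have "\<dots> = (\<Sum>t\<in>{k, p + k}. coact_entry t k * coact_entry (p + Suc k - t) 1)"
  proof (rule sum.mono_neutral_right)
    show "\<forall>t\<in>{..p + Suc k} - {k, p + k}. coact_entry t k * coact_entry (p + Suc k - t) 1 = 0"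
    proof
      fix t assume "t \<in> {..p + Suc k} - {k, p + k}"
      then consider "t < k" | "k < t" "t < k + p" | "t = p + Suc k" by force
      then show "coact_entry t k * coact_entry (p + Suc k - t) 1 = 0"
        by cases (use Suc.prems off[of k t] coact_entry_eq_0[of t k] coact_entry_0_left[of 1] in auto)
    qed
  qed auto
  also have "\<dots> = g ^ k * A + coact_entry (p + k) k * g"
    using p Suc.prems coact_entry_1_left[of 1] by (simp add: coact_entry_diag A_def)
  also have "g ^ k * A = (if even k then A * g ^ k else - (A * g ^ k))"
  proof -
    have "(q ^ p) ^ 2 = 1" using N q_power_1_iff[of N] by (simp flip: power_mult add: mult.commute)
    moreover have "q ^ p \<noteq> 1" using p N by (auto simp: q_power_1_iff dest: dvd_imp_le)
    ultimately have "q ^ p = - 1" by (simp add: power2_eq_1_iff)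
    then have "q ^ (p + 1) / q ^ 1 = - 1" using q_neq(1) by simp
    then have gA: "g * A = - (A * g)"
      using coact_entry_weight[of "p + 1" 1] p unfolding A_def by simp
    show ?thesis
    proof (induction k)
      case (Suc k)
      have "g ^ Suc k * A = g * (g ^ k * A)" by (simp add: mult.assoc)
      also have "\<dots> = (if even (Suc k) then A * g ^ Suc k else - (A * g ^ Suc k))"
        unfolding Suc by (simp add: gA mult.assoc[symmetric])
      finally show ?case .
    qed simp
  qed
  also have "coact_entry (p + k) k = (if odd k then A * g ^ (k - 1) else 0)"
    using Suc by (simp add: A_def)
  also have "(if even k then A * g ^ k else - (A * g ^ k)) + (if odd k then A * g ^ (k - 1) else 0) * g
      = (if odd (Suc k) then A * g ^ (Suc k - 1) else 0)"
    by (cases k) (auto simp: mult.assoc power_commutes)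
  finally show ?case by (simp add: A_def)
qed

text \<open>
  If \<open>\<xi>\<close> vanishes in all degrees strictly between \<open>0\<close> and \<open>N\<close>, this is the general argument with \<open>p = N\<close>.
  Otherwise \<open>N = 2 p\<close> with \<open>p\<close> odd, and the only further term of \<open>\<Delta> (X 1 (N - 1))\<close> that could
  survive contains the entry \<open>(N - 1, p - 1)\<close> of the coaction matrix, which vanishes because
  \<open>p - 1\<close> is even.
\<close>

lemma X_top_skew_primitive:
  assumes H: "finite_dimensional sH \<or> cosemisimple sH \<Delta>"
  shows "skew_primitive (g ^ N) (X 1 (N - 1))"
proof (cases "\<forall>a b. 2 * (a + b) = N \<longrightarrow> X a b = 0")
  case True
  have "skew_primitive (g ^ (1 + (N - 1))) (X 1 (N - 1))"
  proof (rule X_skew_primitive[where p = N])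
    fix i j assume "i < N" "j < N" "0 < i + j" "i + j < 1 + (N - 1)"
    then show "X i j = 0" using X_below(2)[of i j] True by (cases "2 * (i + j) = N") auto
  qed (use R_zero_less in auto)
  then show ?thesis using R_zero_less by simp
next
  case False
  then obtain p where N: "2 * p = N" by blast
  have odd: "odd p" using False X_half_eq_0[OF H N] N by auto
  have lt: "1 < N" "N - 1 < N" "0 < N" "0 < p" "p < N" and Np: "N - 1 - (p - 1) = p" "N - 1 = p + (p - 1)"
    using R_zero_less N by auto
  have zero: "tens sH sH 0 z = 0" "tens sH sH z 0 = 0" for z
    by (simp_all only: bilinear_simps[OF H_tens])
  let ?t = "\<lambda>i j k l. tens sH sH (X i j * (coact_entry (1 - i) k * coact_entry (N - 1 - j) l)) (X k l)"
  let ?f = "\<lambda>i j. tscale (q ^ ((1 - i) * j)) (\<Sum>k<N. \<Sum>l<N. ?t i j k l)"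
  have "(\<Sum>i\<le>1. \<Sum>j\<le>N - 1. ?f i j) = ?f 0 0 + ?f 1 (N - 1)"
  proof (rule sum_atMost_pair)
    fix i j :: nat assume ij: "i \<le> 1" "j \<le> N - 1" "(i, j) \<noteq> (0, 0)" "(i, j) \<noteq> (1, N - 1)"
    have "?t i j k l = 0" if kl: "k < N" "l < N" for k l
    proof (cases "i = 1 \<and> j = p - 1")
      case False
      have "X i j = 0"
      proof (cases "i = 0")
        case True
        then show ?thesis using ij lt X_unit(1)[of j] by auto
      next
        case i: False
        then have "i = 1" using ij by auto
        then show ?thesis using X_below(2)[of i j] ij False lt N by auto
      qed
      then show ?thesis by (simp only: mult_zero_left zero)
    next
      case True
      show ?thesis
      proof (cases "k = 0 \<and> l \<noteq> 0")
        case True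
        then have "X k l = 0" using X_unit(1)[of l] kl by simp
        then show ?thesis by (simp only: zero)
      next
        case False
        have "coact_entry (1 - i) k * coact_entry (N - 1 - j) l = 0"
          using False True Np(1) lt kl by (auto simp: coact_entry_0_left coact_entry_0_right)
        then show ?thesis by (simp only: mult_zero_right zero)
      qed
    qed
    then have "(\<Sum>k<N. \<Sum>l<N. ?t i j k l) = 0" by (intro sum.neutral ballI) auto
    then show "?f i j = 0" by (simp only: tscale_simps)
  qed (use lt in auto)
  moreover have "?f 0 0 = tens sH sH (g ^ N) (X 1 (N - 1))"
  proof -
    have "(\<Sum>k<N. \<Sum>l<N. ?t 0 0 k l) = ?t 0 0 1 (N - 1)"
    proof (rule sum_double_single)
      fix k l assume "k \<in> {..<N}" "l \<in> {..<N}" "(k, l) \<noteq> (1, N - 1)"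
      then have kl: "k < N" "l < N" "(k, l) \<noteq> (1, N - 1)" by auto
      consider "k \<noteq> 1" | "k = 1" "l = p - 1" | "k = 1" "l \<noteq> p - 1" using kl by blast
      then show "?t 0 0 k l = 0"
      proof cases
        case 1
        then have "coact_entry (1 - 0) k = 0" using coact_entry_1_left[of k] kl by simp
        then show ?thesis by (simp only: mult_zero_left mult_zero_right zero)
      next
        case 2
        have "coact_entry (p + (p - 1)) (p - 1) = 0"
          using coact_entry_half[OF N, of "p - 1"] lt odd Np by auto
        then have "coact_entry (N - 1 - 0) l = 0" using 2 Np by simp
        then show ?thesis by (simp only: mult_zero_right zero)
      next
        case 3
        then have "X k l = 0"
          using X_below(2)[of k l] kl lt N X_unit(2)[of 1] by (cases "l = 0") auto
        then show ?thesis by (simp only: zero)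
      qed
    qed (use lt in auto)
    also have "\<dots> = tens sH sH (g ^ N) (X 1 (N - 1))"
      using lt coact_entry_1_left[of 1] power_Suc[of g "N - 1"] by (simp add: X_unit coact_entry_diag)
    finally show ?thesis by (simp add: tscale_simps)
  qed
  moreover have "?f 1 (N - 1) = tens sH sH (X 1 (N - 1)) 1"
  proof -
    have "(\<Sum>k<N. \<Sum>l<N. ?t 1 (N - 1) k l) = ?t 1 (N - 1) 0 0"
    proof (rule sum_double_single)
      fix k l assume kl: "k \<in> {..<N}" "l \<in> {..<N}" "(k, l) \<noteq> (0, 0)"
      then have "coact_entry (1 - 1) k * coact_entry (N - 1 - (N - 1)) l = 0"
        by (auto simp: coact_entry_0_left)
      then show "?t 1 (N - 1) k l = 0" by (simp only: mult_zero_right zero)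
    qed (use lt in auto)
    also have "\<dots> = tens sH sH (X 1 (N - 1)) 1"
      using lt by (simp add: X_unit coact_entry_0_left)
    finally show ?thesis by (simp add: tscale_simps)
  qed
  ultimately show ?thesis
    unfolding skew_primitive_def comult_X[OF lt(1,2)] by (simp only: add.commute)
qed

text \<open>
  If \<open>g\<^sup>N = 1\<close> then \<open>l\<close> is not determined, and a compatible datum requires the choice \<open>l = 0\<close>.
\<close>

lemma X_top:
  assumes H: "finite_dimensional sH \<or> cosemisimple sH \<Delta>"
  obtains l where "sH (qfact (N - 1)) (X 1 (N - 1)) = sH l (1 - g ^ N)" "g ^ N = 1 \<Longrightarrow> l = 0"
    "\<And>a. 1 \<le> a \<Longrightarrow> a < N \<Longrightarrow> sH (qfact a * qfact (N - a)) (X a (N - a)) = sH l (1 - g ^ N)"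
proof -
  have "g ^ N * X 1 (N - 1) = X 1 (N - 1) * g ^ N"
    using power_g_X[of 1 "N - 1" N] R_zero_less q_power_1_iff[of "N * N"] by simp
  then obtain l0 where l0: "X 1 (N - 1) = sH l0 (1 - g ^ N)"
    using H.skew_primitive_trivial[OF H grouplike_power[OF grouplike_g] X_top_skew_primitive[OF H]] by blast
  define l where "l = (if g ^ N = 1 then 0 else qfact (N - 1) * l0)"
  have l: "sH (qfact (N - 1)) (X 1 (N - 1)) = sH l (1 - g ^ N)"
    unfolding l0 l_def by auto
  have "sH (qfact a * qfact (N - a)) (X a (N - a)) = sH l (1 - g ^ N)" if "1 \<le> a" "a < N" for a
  proof (subst l[symmetric], rule X_ratio)
    fix i j k l assume *: "i < N" "j < N" "k < N" "l < N" "0 < i + j" "0 < k + l" "i + j + (k + l) = N"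
    show "X i j * X k l = 0"
    proof (cases "2 * (i + j) = N")
      case True
      then show ?thesis using half_square[OF H True refl, of k l] * by simp
    next
      case False
      then show ?thesis using X_below(2)[of i j] * by simp
    qed
  qed (use that in auto)
  then show ?thesis using that[OF l] by (simp add: l_def)
qed

text \<open>
  Equivariance of \<open>\<xi>\<close> at \<open>y \<otimes> d\<^sub>N\<^sub>-\<^sub>1\<close> says that \<open>l (1 - g\<^sup>N)\<close> transforms by \<open>\<chi>\<^sup>N\<close> under the adjoint
  action.
\<close>

lemma compatible:
  assumes "sH (qfact (N - 1)) (X 1 (N - 1)) = sH l (1 - g ^ N)" "g ^ N = 1 \<Longrightarrow> l = 0"
  shows "compatible_datum N q g \<chi> l"
proof -
  let ?L = "sH l (1 - g ^ N)"
  have "l = 0" if h: "sH (conv_pow \<chi> N h) (1 - g ^ N) \<noteq> tlift sH sH (\<Delta> h) (\<lambda>h1 h2. h1 * (1 - g ^ N) * S h2)" for h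
  proof (rule ccontr)
    assume l: "l \<noteq> 0"
    let ?X = "X 1 (N - 1)"
    have lin1: "Vector_Spaces.linear (*) sH (\<lambda>c. sH c ?X)"
      by (rule linear_scale_by[OF linear_map_ident[OF vector_space_mult] H_space])
    have lin2: "Vector_Spaces.linear sH sH (\<lambda>z. sH c z)" for c
      by (rule linear_scale_fun[OF linear_map_ident[OF H_space]])
    have tl: "f (tlift sH sH t F) = tlift sH sH t (\<lambda>a b. f (F a b))"
      if "Vector_Spaces.linear s s' f" for s :: "'k \<Rightarrow> 'x::ab_group_add \<Rightarrow> 'x"
        and s' :: "'k \<Rightarrow> 'z::ab_group_add \<Rightarrow> 'z" and f t F
      by (simp add: tlift_def linear_simps(7)[OF that] o_def split_def)
    have d: "act h1 (d 1) = sR (\<chi> h1) (d 1)" "act h2 (d (N - 1)) = sR (conv_pow \<chi> (N - 1) h2) (d (N - 1))" for h1 h2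
      using act_y R_zero_less by (auto simp: basis_facts(8) basis_facts(5)[unfolded One_nat_def])
    have "tlift sH sH (\<Delta> h) (\<lambda>h1 h2. \<xi> (act h1 (d 1)) (act h2 (d (N - 1))))
        = sH (tlift sH sH (\<Delta> h) (\<lambda>h1 h2. \<chi> h1 * conv_pow \<chi> (N - 1) h2)) ?X"
      unfolding tl[OF lin1] d by (simp add: bilinear_simps[OF xi_bilinear] X_def mult.commute)
    also have "tlift sH sH (\<Delta> h) (\<lambda>h1 h2. \<chi> h1 * conv_pow \<chi> (N - 1) h2) = conv_pow \<chi> N h"
      using R_zero_less conv_pow.simps(2)[of \<chi> "N - 1"] by simp
    finally have eq: "sH (conv_pow \<chi> N h) ?X = tlift sH sH (\<Delta> h) (\<lambda>h1 h2. h1 * ?X * S h2)"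
      using xi_act[of h "d 1" "d (N - 1)"] by (simp add: X_def)
    let ?c = "qfact (N - 1)"
    have "sH (conv_pow \<chi> N h) ?L = sH ?c (sH (conv_pow \<chi> N h) ?X)"
      unfolding assms(1)[symmetric] by (simp add: mult.commute)
    also have "\<dots> = tlift sH sH (\<Delta> h) (\<lambda>h1 h2. h1 * sH ?c ?X * S h2)"
      unfolding eq tl[OF lin2] by (simp add: bilinear_simps[OF mult_bilinear])
    also have "\<dots> = sH l (tlift sH sH (\<Delta> h) (\<lambda>h1 h2. h1 * (1 - g ^ N) * S h2))"
      unfolding assms(1) tl[OF lin2] by (simp add: bilinear_simps(2,8)[OF mult_bilinear])
    finally have "sH l (sH (conv_pow \<chi> N h) (1 - g ^ N))
        = sH l (tlift sH sH (\<Delta> h) (\<lambda>h1 h2. h1 * (1 - g ^ N) * S h2))" by (simp add: mult.commute)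
    then show False using h l unfolding scale_cancel_left by simp
  qed
  then show ?thesis using assms(2) datum theta_eq_N by (auto simp: compatible_datum_def)
qed

subsection \<open>Powers of y\<close>

lemma qbin_qfact: "i < N \<Longrightarrow> j < N \<Longrightarrow> qbin i j = qfact (i + j) / (qfact i * qfact j)"
proof -
  assume ij: "i < N" "j < N"
  have prod: "qfact (i + j) = (\<Prod>s<i. qnum (j + s + 1)) * qfact j" for i
    by (induction i) (simp_all add: qfact_simps algebra_simps)
  show ?thesis
    using qfact_nonzero[OF ij(2)] unfolding qbin_def prod[of i] qfact_def[of i, symmetric] by simp
qed

text \<open>With \<open>qfact n = 0\<close> for \<open>n \<ge> N\<close>, the product formula holds without a bound on \<open>i + j\<close>.\<close>

lemma m_d_qfact:
  assumes "i < N" "j < N"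
  shows "m (d i) (d j) = sR (qfact (i + j) / (qfact i * qfact j)) (d (i + j))"
  using assms m_d[of i j] theta_eq_N qfact_eq_0[of "i + j"] by (simp add: qbin_qfact)

lemma m_pow_y: "m_pow y n = sR (qfact n) (d n)"
proof (induction n)
  case 0
  then show ?case by (simp add: m_pow_def qfact_simps basis_facts(4))
next
  case (Suc n)
  have "m_pow y (Suc n) = m (d 1) (m_pow y n)"
    using basis_facts(5) by (simp add: m_pow_def)
  also have "\<dots> = sR (qfact n) (m (d 1) (d n))"
    unfolding Suc by (simp add: bilinear_simps[OF m_bilinear])
  also have "\<dots> = sR (qfact (Suc n)) (d (Suc n))"
    using m_y[of n] qfact_eq_0[of n] qfact_eq_0[of "Suc n"]
    by (cases "n < N"; cases "n + 1 < N") (auto simp: qfact_simps)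
  finally show ?case .
qed

lemma xi_m_pow: "\<xi> (m_pow y a) (m_pow y b) = sH (qfact a * qfact b) (X a b)"
  by (simp add: m_pow_y X_def bilinear_simps[OF xi_bilinear])

subsection \<open>Powers in the crossed product\<close>

lemma smash_mult_sum:
  "smash_mult (tens sR sH r h) (\<Sum>i\<in>I. tens sR sH (s i) (k i)) =
    (\<Sum>i\<in>I. tlift sH sH (\<Delta> h) (\<lambda>h1 h2. sweedler2 r (act h1 (s i))
      (\<lambda>a b c e. tens sR sH (m a b) (\<xi> c e * h2 * k i))))"
proof -
  have b1: "bilinear_map sR sH tscale (\<lambda>r h. tlift sR sH w (\<lambda>s k. tlift sH sH (\<Delta> h) (\<lambda>h1 h2.
     sweedler2 r (act h1 s) (\<lambda>a b c e. tens sR sH (m a b) (\<xi> c e * h2 * k)))))" for w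
    unfolding sweedler2_def by (intro lin_rules)
  have b2: "bilinear_map sR sH tscale (\<lambda>s k. tlift sH sH (\<Delta> h) (\<lambda>h1 h2.
     sweedler2 r (act h1 s) (\<lambda>a b c e. tens sR sH (m a b) (\<xi> c e * h2 * k))))"
    unfolding sweedler2_def by (intro lin_rules)
  show ?thesis
    unfolding smash_mult_def tlift_tens[OF b1] tlift_sum[OF b2] ..
qed

lemma smash_mult_add:
  "smash_mult (tens sR sH r h) (tens sR sH s k + tens sR sH s' k') =
    smash_mult (tens sR sH r h) (tens sR sH s k) + smash_mult (tens sR sH r h) (tens sR sH s' k')"
  using smash_mult_sum[of r h "\<lambda>i. if i = 0 then s else s'" "\<lambda>i. if i = 0 then k else k'" "{0, 1::nat}"]
    smash_mult_sum[of r h "\<lambda>_. s" "\<lambda>_. k" "{()}"] smash_mult_sum[of r h "\<lambda>_. s'" "\<lambda>_. k'" "{()}"]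
  by (simp only: sum.insert finite.intros insert_iff empty_iff sum.empty add_0_right if_True if_False
      one_neq_zero zero_neq_one simp_thms)

lemma bilinear_smash_integrand:
  "bilinear_map sH sH tscale (\<lambda>h1 h2. sweedler2 r (act h1 s) (\<lambda>a b c e. tens sR sH (m a b) (\<xi> c e * h2 * k)))"
  unfolding sweedler2_def by (intro lin_rules)

lemma quadrilinear_smash: "quadrilinear sR tscale (\<lambda>a b c e. tens sR sH (m a b) (\<xi> c e * h2 * k))"
  by (intro lin_rules)

text \<open>
  Since \<open>\<delta>(y) = y \<otimes> 1 + 1 \<otimes> y\<close>, left multiplication by \<open>Y\<close> only involves the values \<open>\<xi>(y \<otimes> d\<^sub>k)\<close>.
\<close>

lemma smash_mult_y:
  assumes "n < N"
  shows "smash_mult (tens sR sH y 1) (tens sR sH (d n) k) =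
    tens sR sH (m (d 1) (d n)) k + (\<Sum>j\<le>n. tscale (q ^ j) (tens sR sH (d j) (X 1 (n - j) * k)))"
proof -
  have "smash_mult (tens sR sH y 1) (tens sR sH (d n) k) =
      sweedler2 (d 1) (d n) (\<lambda>a b c e. tens sR sH (m a b) (\<xi> c e * 1 * k))"
    using smash_mult_sum[of y 1 "\<lambda>_. d n" "\<lambda>_. k" "{()}"]
    by (simp add: comult_one tlift_tens[OF bilinear_smash_integrand] act_one basis_facts(5)[unfolded One_nat_def])
  also have "\<dots> = (\<Sum>i\<le>1. \<Sum>j\<le>n. tscale (q ^ ((1 - i) * j)) (tens sR sH (m (d i) (d j)) (X (1 - i) (n - j) * k)))"
    using assms R_zero_less theta_eq_N
    by (subst sweedler2_d[OF quadrilinear_smash]) (auto simp: X_def)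
  also have "\<dots> = (\<Sum>j\<le>n. tscale (q ^ j) (tens sR sH (d j) (X 1 (n - j) * k)))
      + (\<Sum>j\<le>n. tens sR sH (m (d 1) (d j)) (X 0 (n - j) * k))"
    by (simp add: m_d_unit tscale_simps)
  also have "(\<Sum>j\<le>n. tens sR sH (m (d 1) (d j)) (X 0 (n - j) * k)) = (\<Sum>j\<le>n. if j = n then tens sR sH (m (d 1) (d n)) k else 0)"
    using assms by (intro sum.cong) (auto simp: X_unit bilinear_simps[OF RH_tens])
  also have "\<dots> = tens sR sH (m (d 1) (d n)) k" by simp
  finally show ?thesis by (rule trans[OF _ add.commute])
qed

lemma smash_mult_g: "smash_mult (tens sR sH (u 1) g) (tens sR sH (u 1) k) = tens sR sH (u 1) (g * k)"
proof -
  have "smash_mult (tens sR sH (u 1) g) (tens sR sH (u 1) k) =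
      sweedler2 (d 0) (d 0) (\<lambda>a b c e. tens sR sH (m a b) (\<xi> c e * g * k))"
    using smash_mult_sum[of "u 1" g "\<lambda>_. u 1" "\<lambda>_. k" "{()}"] R_zero_less basis_facts(7)[of 0]
    by (simp add: comult_g tlift_tens[OF bilinear_smash_integrand] basis_facts(4))
  also have "\<dots> = tens sR sH (u 1) (g * k)"
    using R_zero_less X_unit(1)[of 0] sweedler2_d[OF quadrilinear_smash, of 0 0]
    by (simp add: X_def m_d_unit tscale_simps) (simp add: basis_facts(4))
  finally show ?thesis .
qed

lemma smash_pow_Suc: "smash_pow v (Suc n) = smash_mult v (smash_pow v n)"
  by (simp add: smash_pow_def)

lemma smash_pow_g: "smash_pow (tens sR sH (u 1) g) n = tens sR sH (u 1) (g ^ n)"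
  by (induction n) (simp_all add: smash_pow_def smash_one_def smash_mult_g)

lemma qnum_add: "qnum (a + b) = qnum a + q ^ a * qnum b"
  by (induction b) (simp_all add: qnum_simps algebra_simps power_add)

text \<open>
  For \<open>n < N\<close> one finds \<open>Y\<^sup>n = (n)\<^sub>q! d\<^sub>n # 1 + (n)\<^sub>q!/(p)\<^sub>q d\<^sub>n\<^sub>-\<^sub>p # x\<close>, where the second summand is only
  present for even \<open>N = 2 p\<close> and \<open>n \<ge> p\<close>: as \<open>x\<^sup>2 = 0\<close>, no further terms arise, and the
  coefficients follow the rule \<open>(n + 1)\<^sub>q = (n + 1 - p)\<^sub>q + q\<^sup>n\<^sup>+\<^sup>1\<^sup>-\<^sup>p (p)\<^sub>q\<close>. For \<open>n = N\<close> both
  coefficients contain \<open>(N)\<^sub>q = 0\<close>, and only \<open>\<xi>(y \<otimes> d\<^sub>N\<^sub>-\<^sub>1)\<close>, which first enters there, remains.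
\<close>

lemma smash_pow_y:
  assumes H: "finite_dimensional sH \<or> cosemisimple sH \<Delta>"
  shows "smash_pow (tens sR sH y 1) N = tens sR sH (d 0) (sH (qfact (N - 1)) (X 1 (N - 1)))"
proof -
  define p where "p = N div 2"
  (* With x = 0 for odd N, both parities can be treated together. *)
  define x where "x = (if even N then X 1 (p - 1) else 0)"
  define W where "W n = tens sR sH (d n) (sH (qfact n) 1)
    + tens sR sH (d (n - p)) (sH (if p \<le> n then qfact n / qnum p else 0) x)" for n
  have p: "0 < p" "p < N" "p - 1 < N" using R_zero_less by (auto simp: p_def)
  have p0: "qnum p \<noteq> 0" using p qnum_nonzero theta_eq_N by simp
  have X1: "X 1 j = (if j = p - 1 then x else 0)" if "j + 1 < N" for j
  proof (cases "j = 0")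
    case True
    then show ?thesis using X_unit(2)[of 1] R_zero_less by (auto simp: x_def)
  next
    case False
    show ?thesis
    proof (cases "2 * (1 + j) = N")
      case True
      then show ?thesis by (auto simp: p_def x_def)
    next
      case False
      have "j = p - 1 \<Longrightarrow> odd N" using False p by (auto simp: p_def)
      then show ?thesis using X_below(2)[of 1 j] False that by (auto simp: x_def)
    qed
  qed
  have xx: "x * x = 0"
  proof (cases "even N")
    case True
    then have "2 * p = N" by (simp add: p_def)
    then show ?thesis using half_square[OF H, of p 1 "p - 1" 1 "p - 1"] p by (simp add: x_def)
  qed (simp add: x_def)
  note bil = bilinear_simps[OF RH_tens]
  have mult: "smash_mult (tens sR sH y 1) (W n) = tens sR sH (m (d 1) (d n)) (sH (qfact n) 1)
    + tens sR sH (d (n + 1 - p)) (sH (if p \<le> n + 1 then qfact n * qnum (n + 1) / qnum p else 0) x)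
    + (if n = N - 1 then tens sR sH (d 0) (sH (qfact n) (X 1 (N - 1))) else 0)" if n: "n < N" for n
  proof -
    define \<kappa> where "\<kappa> = (if p \<le> n then qfact n / qnum p else 0)"
    have "smash_mult (tens sR sH y 1) (W n) = smash_mult (tens sR sH y 1) (tens sR sH (d n) (sH (qfact n) 1))
      + smash_mult (tens sR sH y 1) (tens sR sH (d (n - p)) (sH \<kappa> x))"
      unfolding W_def \<kappa>_def by (rule smash_mult_add)
    also have "smash_mult (tens sR sH y 1) (tens sR sH (d n) (sH (qfact n) 1)) = tens sR sH (m (d 1) (d n)) (sH (qfact n) 1)
      + (tens sR sH (d (n + 1 - p)) (sH (if p \<le> n + 1 then q ^ (n + 1 - p) * qfact n else 0) x)
      + (if n = N - 1 then tens sR sH (d 0) (sH (qfact n) (X 1 (N - 1))) else 0))"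
    proof -
      have "(\<Sum>j\<le>n. tscale (q ^ j) (tens sR sH (d j) (X 1 (n - j) * sH (qfact n) 1)))
        = (\<Sum>j\<le>n. (if j = n + 1 - p then tens sR sH (d (n + 1 - p)) (sH (if p \<le> n + 1 then q ^ (n + 1 - p) * qfact n else 0) x) else 0)
         + (if j = 0 then (if n = N - 1 then tens sR sH (d 0) (sH (qfact n) (X 1 (N - 1))) else 0) else 0))"
      proof (intro sum.cong refl)
        fix j assume j: "j \<in> {..n}"
        show "tscale (q ^ j) (tens sR sH (d j) (X 1 (n - j) * sH (qfact n) 1)) =
          (if j = n + 1 - p then tens sR sH (d (n + 1 - p)) (sH (if p \<le> n + 1 then q ^ (n + 1 - p) * qfact n else 0) x) else 0)
         + (if j = 0 then (if n = N - 1 then tens sR sH (d 0) (sH (qfact n) (X 1 (N - 1))) else 0) else 0)"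
        proof (cases "j = 0 \<and> n = N - 1")
          case True
          then show ?thesis using p by (simp add: bil bilinear_simps[OF mult_bilinear] tscale_simps)
        next
          case False
          then have X: "X 1 (n - j) = (if n - j = p - 1 then x else 0)" using n j by (intro X1) auto
          have "n - j = p - 1 \<longleftrightarrow> j = n + 1 - p \<and> p \<le> n + 1" using j p by auto
          then show ?thesis using False unfolding X
            by (auto simp: bil bilinear_simps[OF mult_bilinear] simp flip: bil(8))
        qed
      qed
      also have "\<dots> = tens sR sH (d (n + 1 - p)) (sH (if p \<le> n + 1 then q ^ (n + 1 - p) * qfact n else 0) x)
         + (if n = N - 1 then tens sR sH (d 0) (sH (qfact n) (X 1 (N - 1))) else 0)"
        using p by (simp add: sum.distrib)
      finally show ?thesis unfolding smash_mult_y[OF n] by simp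
    qed
    also have "smash_mult (tens sR sH y 1) (tens sR sH (d (n - p)) (sH \<kappa> x))
      = tens sR sH (d (n + 1 - p)) (sH (if p \<le> n then qnum (n + 1 - p) * \<kappa> else 0) x)"
    proof (cases "p \<le> n")
      case True
      have "X 1 (n - p - j) * x = 0" for j
        using X1[of "n - p - j"] n p True xx by auto
      then have "smash_mult (tens sR sH y 1) (tens sR sH (d (n - p)) (sH \<kappa> x)) = tens sR sH (m (d 1) (d (n - p))) (sH \<kappa> x)"
        using n smash_mult_y[of "n - p" "sH \<kappa> x"]
        by (simp add: bilinear_simps[OF mult_bilinear] bil tscale_simps)
      also have "m (d 1) (d (n - p)) = sR (qnum (n + 1 - p)) (d (n + 1 - p))"
      proof -
        have "n - p + 1 < N" "n + 1 - p = n - p + 1" using n p True by auto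
        then show ?thesis using m_y[of "n - p"] by simp
      qed
      finally show ?thesis using True by (simp add: bil tscale_simps mult.commute)
    next
      case False
      then show ?thesis using smash_mult_y[of "n - p" 0] n by (simp add: \<kappa>_def bil tscale_simps)
    qed
    also have "tens sR sH (m (d 1) (d n)) (sH (qfact n) 1)
      + (tens sR sH (d (n + 1 - p)) (sH (if p \<le> n + 1 then q ^ (n + 1 - p) * qfact n else 0) x)
      + (if n = N - 1 then tens sR sH (d 0) (sH (qfact n) (X 1 (N - 1))) else 0))
      + tens sR sH (d (n + 1 - p)) (sH (if p \<le> n then qnum (n + 1 - p) * \<kappa> else 0) x)
      = tens sR sH (m (d 1) (d n)) (sH (qfact n) 1)
      + tens sR sH (d (n + 1 - p)) (sH (if p \<le> n + 1 then q ^ (n + 1 - p) * qfact n else 0) x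
        + sH (if p \<le> n then qnum (n + 1 - p) * \<kappa> else 0) x)
      + (if n = N - 1 then tens sR sH (d 0) (sH (qfact n) (X 1 (N - 1))) else 0)"
      by (simp only: bil(7) add_ac)
    also have "sH (if p \<le> n + 1 then q ^ (n + 1 - p) * qfact n else 0) x
        + sH (if p \<le> n then qnum (n + 1 - p) * \<kappa> else 0) x
        = sH (if p \<le> n + 1 then qfact n * qnum (n + 1) / qnum p else 0) x"
    proof (cases "p \<le> n + 1")
      case True
      have "qnum (n + 1) = qnum (n + 1 - p) + q ^ (n + 1 - p) * qnum p"
        using qnum_add[of "n + 1 - p" p] True by simp
      moreover have "(if p \<le> n then qnum (n + 1 - p) * \<kappa> else 0) = qnum (n + 1 - p) * (qfact n / qnum p)"
        using True qnum_simps(1) by (auto simp: \<kappa>_def)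
      ultimately have "(if p \<le> n + 1 then q ^ (n + 1 - p) * qfact n else 0)
          + (if p \<le> n then qnum (n + 1 - p) * \<kappa> else 0) = qfact n * qnum (n + 1) / qnum p"
        using True p0 by (simp add: field_simps)
      then show ?thesis using True by (simp only: scale_left_distrib[symmetric] if_True)
    qed simp
    finally show ?thesis .
  qed
  have pow: "smash_pow (tens sR sH y 1) n = W n" if "n < N" for n
    using that
  proof (induction n)
    case 0
    then show ?case using p by (simp add: W_def smash_pow_def smash_one_def qfact_simps basis_facts(4) bil)
  next
    case (Suc n)
    have n: "n < N" "n \<noteq> N - 1" using Suc.prems by auto
    have 1: "tens sR sH (m (d 1) (d n)) (sH (qfact n) 1) = tens sR sH (d (Suc n)) (sH (qfact (Suc n)) 1)"
      using Suc.prems m_y[of n] by (simp add: bil qfact_simps tscale_simps mult.commute)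
    have "smash_pow (tens sR sH y 1) (Suc n) = smash_mult (tens sR sH y 1) (W n)"
      using Suc.IH[OF n(1)] by (simp only: smash_pow_Suc)
    also have "\<dots> = W (Suc n)"
      unfolding mult[OF n(1)] 1 if_not_P[OF n(2)] 
      by (simp only: W_def qfact_simps(2) add_0_right) (simp only: Suc_eq_plus1)
    finally show ?case .
  qed
  obtain n where n: "N = Suc n" using gr0_implies_Suc[OF R_zero_less(1)] by blast
  have "smash_pow (tens sR sH y 1) (Suc n) = smash_mult (tens sR sH y 1) (W n)"
    using pow[of n] by (simp only: smash_pow_Suc n lessI)
  then have "smash_pow (tens sR sH y 1) N = smash_mult (tens sR sH y 1) (W (N - 1))"
    by (simp only: n diff_Suc_1)
  also have "\<dots> = tens sR sH (d 0) (sH (qfact (N - 1)) (X 1 (N - 1)))"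
  proof -
    have N: "N - 1 < N" "N - 1 + 1 = N" using R_zero_less by auto
    have "qfact (N - 1) * qnum N / qnum p = 0" using qnum_N by simp
    then have 0: "sH (if p \<le> N then qfact (N - 1) * qnum N / qnum p else 0) x = 0" by simp
    show ?thesis
      unfolding mult[OF N(1)] N(2) 0 m_y_last if_P[OF refl] by (simp only: bil(3,9) add_0_left)
  qed
  finally show ?thesis .
qed


section \<open>The quantum line\<close>

text \<open>
  The cocycle identity for \<open>y, d\<^sub>a\<^sub>-\<^sub>1, d\<^sub>b\<close>. On one side only \<open>(a)\<^sub>q X a b\<close> is left. On the other side
  \<open>\<xi>\<close> is evaluated at \<open>y \<otimes> d\<^sub>k\<close>, which is nonzero for \<open>k = N - 1\<close> only, and the remaining factor then has
  degree \<open>a + b - N\<close>, strictly between \<open>0\<close> and \<open>N\<close>.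
\<close>

lemma X_above:
  assumes van: "\<And>a b. 0 < a + b \<Longrightarrow> a + b < N \<Longrightarrow> X a b = 0"
    and ab: "a < N" "b < N" "N < a + b"
  shows "X a b = 0"
proof -
  obtain e where e: "a = e + 1" using ab by (cases a) auto
  have lt: "1 < N" "e < N" using ab e R_zero_less by auto
  let ?f = "\<lambda>i j. sH (q ^ ((e - i) * j)) (\<xi> (d 1) (m (d i) (d j)) * X (e - i) (b - j))"
  let ?g = "\<lambda>i j. sH (q ^ ((1 - i) * j))
      (tlift sH sH (\<Delta> (X (1 - i) (e - j))) (\<lambda>h1 h2. \<xi> (m (d i) (d j)) (act h1 (d b)) * h2))"
  have "(\<Sum>i\<le>e. \<Sum>j\<le>b. ?f i j) = (\<Sum>i\<le>1. \<Sum>j\<le>e. ?g i j)"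
    using cocycle_d[OF lt ab(2)] .
  moreover have "(\<Sum>i\<le>e. \<Sum>j\<le>b. ?f i j) = 0"
  proof (intro sum.neutral ballI)
    fix i j assume ij: "i \<in> {..e}" "j \<in> {..b}"
    have "\<xi> (d 1) (m (d i) (d j)) * X (e - i) (b - j) = 0"
    proof (cases "i + j = N - 1")
      case True
      then have "X (e - i) (b - j) = 0" using ij ab e by (intro van) auto
      then show ?thesis by simp
    next
      case False
      have "i + j < N \<Longrightarrow> X 1 (i + j) = 0" using False by (intro van) auto
      then have "\<xi> (d 1) (m (d i) (d j)) = 0"
        using xi_m(1)[of i j "d 1"] ij ab e lt by (simp add: X_def)
      then show ?thesis by simp
    qed
    then show "?f i j = 0" by simp
  qed
  moreover have "(\<Sum>i\<le>1. \<Sum>j\<le>e. ?g i j) = ?g 1 e"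
  proof (rule sum_atMost_single)
    fix i j :: nat assume ij: "i \<le> 1" "j \<le> e" "(i, j) \<noteq> (1, e)"
    have "X (1 - i) (e - j) = 0" using ij ab e by (intro van) (auto split: nat_diff_split)
    then show "?g i j = 0"
      by (simp add: linear_simps(3)[OF comult_linear] tlift_zero[OF bilinear_cocycle_integrand] del: zero_fun_apply)
  qed auto
  moreover have "?g 1 e = sH (qnum a) (X a b)"
    using xi_m(2)[of 1 e "d b"] qbin_simps(1)[of e] lt ab e
    by (simp add: X_unit comult_one tlift_tens[OF bilinear_cocycle_integrand] act_one X_def[symmetric])
  ultimately have "sH (qnum a) (X a b) = 0" by simp
  moreover have "qnum a \<noteq> 0" using qnum_nonzero[of a] e ab theta_eq_N by simp
  ultimately show ?thesis by simp
qed

lemma linear_eq_on_basis: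
  assumes "Vector_Spaces.linear sR sU f" "Vector_Spaces.linear sR sU f'"
    and "\<And>n. n < N \<Longrightarrow> f (d n) = f' (d n)"
  shows "f r = f' r"
proof -
  have "f r = (\<Sum>k<N. sU (coord k r) (f (d k)))"
    by (subst coord_expand[of r]) (simp add: linear_simps[OF assms(1)])
  also have "\<dots> = (\<Sum>k<N. sU (coord k r) (f' (d k)))" using assms(3) by simp
  also have "\<dots> = f' r"
    by (subst (2) coord_expand[of r]) (simp add: linear_simps[OF assms(2)])
  finally show ?thesis .
qed

lemma m_associative: "m (m r s) t = m r (m s t)"
proof -
  have b: "m (m (d i) (d j)) (d k) = m (d i) (m (d j) (d k))" if "i < N" "j < N" "k < N" for i j k
  proof -
    have "m (m (d i) (d j)) (d k) = (if i + j + k < N then sR (qfact (i + j + k) / (qfact i * qfact j * qfact k)) (d (i + j + k)) else 0)"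
      using that m_d_qfact[of i j] m_d_qfact[of "i + j" k] qfact_nonzero[of "i + j"] qfact_eq_0[of "i + j"] qfact_eq_0[of "i + j + k"]
      by (cases "i + j < N") (auto simp: bilinear_simps[OF m_bilinear])
    also have "\<dots> = m (d i) (m (d j) (d k))"
      using that m_d_qfact[of j k] m_d_qfact[of i "j + k"] qfact_nonzero[of "j + k"] qfact_eq_0[of "j + k"] qfact_eq_0[of "i + j + k"]
      by (cases "j + k < N") (auto simp: bilinear_simps[OF m_bilinear] add.assoc mult.assoc)
    finally show ?thesis .
  qed
  have l: "Vector_Spaces.linear sR sR (\<lambda>x. m x a)" "Vector_Spaces.linear sR sR (\<lambda>x. m a x)" for a
    by (intro lin_rules)+
  have ll: "Vector_Spaces.linear sR sR (\<lambda>x. m (m x a) c)" "Vector_Spaces.linear sR sR (\<lambda>x. m (m a x) c)"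
    "Vector_Spaces.linear sR sR (\<lambda>x. m a (m x c))" "Vector_Spaces.linear sR sR (\<lambda>x. m a (m c x))" for a c
    by (rule linear_comp[OF l(1) l(1)] linear_comp[OF l(1) l(2)] linear_comp[OF l(2) l(1)] linear_comp[OF l(2) l(2)])+
  have 1: "m (m (d i) (d j)) t = m (d i) (m (d j) t)" if "i < N" "j < N" for i j
    using linear_eq_on_basis[OF l(2) ll(4) b[OF that]] .
  have 2: "m (m (d i) s) t = m (d i) (m s t)" if "i < N" for i
    using linear_eq_on_basis[OF ll(2) ll(3) 1[OF that]] .
  show ?thesis
    using linear_eq_on_basis[OF ll(1) l(1) 2] .
qed

lemma coord_poly_val:
  assumes "n < N"
  shows "coord n (poly_val y p) = coeff p n * qfact n"
proof -
  have "coord n (poly_val y p) = (\<Sum>i\<le>degree p. coeff p i * (qfact i * coord n (d i)))"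
    by (simp add: poly_val_def coord_simps m_pow_y mult.assoc)
  also have "\<dots> = (\<Sum>i\<le>degree p. if i = n then coeff p n * qfact n else 0)"
  proof (intro sum.cong refl)
    fix i
    show "coeff p i * (qfact i * coord n (d i)) = (if i = n then coeff p n * qfact n else 0)"
      using assms by (cases "i < N") (auto simp: coord_d qfact_eq_0)
  qed
  also have "\<dots> = coeff p n * qfact n" by (auto simp: coeff_eq_0)
  finally show ?thesis .
qed

text \<open>
  Vanishing of \<open>\<xi>\<close> makes column \<open>1\<close> of the coaction matrix trivial, so that \<open>\<rho>(d\<^sub>n) = g\<^sup>n \<otimes> d\<^sub>n\<close> and \<open>m\<close>
  is colinear.
\<close>

lemma quantum_line_if_vanishing:
  assumes van: "\<And>a b. 0 < a + b \<Longrightarrow> a + b < N \<Longrightarrow> X a b = 0"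
  shows "quantum_line sH \<Delta> \<epsilon>H S sR act \<rho> \<delta> \<epsilon> m u N q g \<chi> y"
proof -
  have one: "coact_entry k 1 = 0" if "2 \<le> k" "k < N" for k
    using that by (intro coact_entry_1_eq_0 van) auto
  have entry: "coact_entry n k = (if k = n then g ^ n else 0)" if "n < N" "k < N" for n k
  proof -
    have "k < n \<Longrightarrow> coact_entry n k = 0"
      by (rule coact_entry_off_diagonal[where e = N]) (use that one in auto)
    then show ?thesis using that coact_entry_eq_0[of n k] coact_entry_diag[of n]
      by (cases n k rule: linorder_cases) auto
  qed
  have \<rho>: "\<rho> (d n) = tens sH sR (g ^ n) (d n)" if n: "n < N" for n
  proof -
    have "\<rho> (d n) = (\<Sum>k<N. if k = n then tens sH sR (g ^ n) (d n) else 0)"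
      unfolding coact_d using n by (intro sum.cong) (auto simp: entry bilinear_simps[OF HR_tens])
    then show ?thesis using n by simp
  qed
  have b1: "bilinear_map sH sR tscale (\<lambda>a v0. tlift sH sR (\<rho> w) (\<lambda>b w0. tens sH sR (a * b) (m v0 w0)))" for w
    by (intro lin_rules)
  have b2: "bilinear_map sH sR tscale (\<lambda>b w0. tens sH sR (a * b) (m v0 w0))" for a v0
    by (intro lin_rules)
  have lin: "Vector_Spaces.linear sR tscale (\<lambda>x. \<rho> (m x s))" "Vector_Spaces.linear sR tscale (\<lambda>x. \<rho> (m s x))" for s
    by (rule linear_comp[OF coact_linear], intro lin_rules)+
  have lin2: "Vector_Spaces.linear sR tscale (\<lambda>x. coact_sum2 x s (\<lambda>a r0 s0. tens sH sR a (m r0 s0)))"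
    "Vector_Spaces.linear sR tscale (\<lambda>x. coact_sum2 s x (\<lambda>a r0 s0. tens sH sR a (m r0 s0)))" for s
    unfolding coact_sum2_def by (intro lin_rules)+
  have colinear: "\<rho> (m r s) = coact_sum2 r s (\<lambda>a r0 s0. tens sH sR a (m r0 s0))" for r s
  proof -
    have "\<rho> (m (d i) (d j)) = coact_sum2 (d i) (d j) (\<lambda>a r0 s0. tens sH sR a (m r0 s0))"
      if ij: "i < N" "j < N" for i j
    proof -
      have "coact_sum2 (d i) (d j) (\<lambda>a r0 s0. tens sH sR a (m r0 s0)) = tens sH sR (g ^ (i + j)) (m (d i) (d j))"
        unfolding coact_sum2_def \<rho>[OF ij(1)] tlift_tens[OF b1]
        unfolding \<rho>[OF ij(2)] tlift_tens[OF b2] by (simp add: power_add)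
      also have "\<dots> = \<rho> (m (d i) (d j))"
        using ij qfact_eq_0[of "i + j"]
        by (cases "i + j < N")
           (simp_all add: m_d_qfact \<rho> linear_simps[OF coact_linear] bilinear_simps[OF HR_tens])
      finally show ?thesis by (rule sym)
    qed
    note * = this
    have "\<rho> (m (d i) s) = coact_sum2 (d i) s (\<lambda>a r0 s0. tens sH sR a (m r0 s0))" if "i < N" for i
      using linear_eq_on_basis[OF lin(2) lin2(2) that[THEN *]] .
    from linear_eq_on_basis[OF lin(1) lin2(1) this] show ?thesis .
  qed
  have surj: "range (poly_val y) = UNIV"
  proof (intro equalityI subset_UNIV subsetI)
    fix r
    define p where "p = (\<Sum>k<N. monom (coord k r / qfact k) k)"
    have "coord n (poly_val y p) = coord n r" if n: "n < N" for n
    proof -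
      have "coeff p n = (\<Sum>k<N. if k = n then coord n r / qfact n else 0)"
        unfolding p_def coeff_sum by (intro sum.cong) auto
      then show ?thesis using n qfact_nonzero[OF n] by (simp add: coord_poly_val)
    qed
    then have "r = poly_val y p" by (intro coord_eqI) simp
    then show "r \<in> range (poly_val y)" by (rule range_eqI)
  qed
  have ker: "poly_val y p = 0 \<longleftrightarrow> monom 1 N dvd p" for p
  proof -
    have "poly_val y p = 0 \<longleftrightarrow> (\<forall>n<N. coord n (poly_val y p) = 0)"
      using coord_eqI[of "poly_val y p" 0] by (auto simp: coord_simps)
    also have "\<dots> \<longleftrightarrow> (\<forall>n<N. coeff p n = 0)"
      using qfact_nonzero by (auto simp: coord_poly_val)
    finally show ?thesis by (simp add: monom_1_dvd_iff')
  qed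
  have \<delta>y: "\<delta> y = tens sR sR y (u 1) + tens sR sR (u 1) y"
    using basis_facts(6)[OF R_zero_less(2)] basis_facts(4,5) by (simp add: add.commute)
  show ?thesis
    by unfold_locales
       (use m_associative colinear surj ker act_y coact_y \<delta>y datum theta_eq_N in auto)
qed

end

theorem proposition2p11:
  fixes sH :: "'k::field_char_0 \<Rightarrow> 'h::ring_1 \<Rightarrow> 'h"
    and \<Delta> :: "'h \<Rightarrow> ('k, 'h, 'h) tensor" and \<epsilon>H :: "'h \<Rightarrow> 'k" and S :: "'h \<Rightarrow> 'h"
    and sR :: "'k \<Rightarrow> 'r::ab_group_add \<Rightarrow> 'r"
    and act :: "'h \<Rightarrow> 'r \<Rightarrow> 'r" and \<rho> :: "'r \<Rightarrow> ('k, 'h, 'r) tensor"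
    and \<delta> :: "'r \<Rightarrow> ('k, 'r, 'r) tensor" and \<epsilon> :: "'r \<Rightarrow> 'k"
    and m :: "'r \<Rightarrow> 'r \<Rightarrow> 'r" and u :: "'k \<Rightarrow> 'r" and \<xi> :: "'r \<Rightarrow> 'r \<Rightarrow> 'h"
    and N :: nat and y :: 'r and g :: 'h and \<chi> :: "'h \<Rightarrow> 'k" and q :: 'k and d :: "nat \<Rightarrow> 'r"
    and Y \<Gamma> :: "('k, 'r, 'h) tensor" and x :: 'h
  assumes R: "pre_bialgebra_with_cocycle sH \<Delta> \<epsilon>H S sR act \<rho> \<delta> \<epsilon> m u \<xi>"
    and H: "finite_dimensional sH \<or> cosemisimple sH \<Delta>"
    and dim: "finite_dimensional sR" "vector_space.dim sR UNIV = N"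
    and thin: "thin sR \<delta> (u 1)" "primitives sR \<delta> (u 1) = module.span sR {y}"
    and datum: "pre_bialgebra.associated_yd_datum sH \<Delta> \<epsilon>H sR act \<rho> y g \<chi>"
    and q: "q = \<chi> g"
    and basis: "pre_bialgebra.divided_power_basis sH \<Delta> \<epsilon>H sR act \<delta> m u N q g \<chi> y d"
    and Y: "Y = y \<otimes>\<^bsub>sR,sH\<^esub> 1"
    and \<Gamma>: "\<Gamma> = u 1 \<otimes>\<^bsub>sR,sH\<^esub> g"
    and x: "even N \<Longrightarrow> x = \<xi> (d 1) (d (N div 2 - 1))"
  shows "\<exists>l :: 'k.
    ((\<forall>a. 1 \<le> a \<and> a \<le> N - 1 \<longrightarrow>
        \<xi> (pre_bialgebra.m_pow m u y a) (pre_bialgebra.m_pow m u y (N - a)) = sH l (1 - g ^ N)) \<and>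
     hopf_algebra.compatible_datum sH \<Delta> \<epsilon>H S N q g \<chi> l \<and>
     pre_bialgebra_with_cocycle.smash_pow sH \<Delta> sR act \<rho> \<delta> m u \<xi> Y N =
       tscale l (pre_bialgebra_with_cocycle.smash_one sH sR u -
         pre_bialgebra_with_cocycle.smash_pow sH \<Delta> sR act \<rho> \<delta> m u \<xi> \<Gamma> N)) \<and>
    (odd N \<or> even N \<and> x = 0 \<longrightarrow>
      (\<forall>a b. \<xi> (pre_bialgebra.m_pow m u y a) (pre_bialgebra.m_pow m u y b) =
         (if a + b = 0 then 1
          else if a + b = N \<and> a \<noteq> 0 \<and> b \<noteq> 0 then sH l (1 - g ^ N)
          else 0)) \<and>
      quantum_line sH \<Delta> \<epsilon>H S sR act \<rho> \<delta> \<epsilon> m u N q g \<chi> y) \<and>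
    (even N \<and> (even (N div 2) \<or> cosemisimple sH \<Delta>) \<longrightarrow> x = 0)"
proof -
  interpret P: pre_bialgebra_with_cocycle sH \<Delta> \<epsilon>H S sR act \<rho> \<delta> \<epsilon> m u \<xi> by (rule R)
  obtain \<theta> where \<theta>: "2 \<le> \<theta>" "\<theta> \<le> N" "P.yd_datum \<theta> q g \<chi>"
    and y: "\<rho> y = tens sH sR g y" "\<And>h. act h y = sR (\<chi> h) y"
    using datum unfolding P.associated_yd_datum_def q dim(2) by blast
  interpret D: divided_power_cocycle sH \<Delta> \<epsilon>H S sR act \<rho> \<delta> \<epsilon> m u \<xi> N y g \<chi> q d \<theta>
    by unfold_locales (use \<theta> y basis in auto)
  obtain l where l: "sH (D.qfact (N - 1)) (D.X 1 (N - 1)) = sH l (1 - g ^ N)" "g ^ N = 1 \<Longrightarrow> l = 0"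
    and top: "\<And>a. 1 \<le> a \<Longrightarrow> a < N \<Longrightarrow> sH (D.qfact a * D.qfact (N - a)) (D.X a (N - a)) = sH l (1 - g ^ N)"
    using D.X_top[OF H] by blast
  have x_eq: "x = D.X 1 (N div 2 - 1)" if "even N" using x[OF that] by (simp add: D.X_def)
  have x_0: "x = 0" if "even N" "even (N div 2) \<or> cosemisimple sH \<Delta>"
    unfolding x_eq[OF that(1)]
    by (rule D.X_half_eq_0[OF H, of "N div 2"]) (use that D.R_zero_less in auto)
  have pow_Y: "P.smash_pow Y N = tscale l (P.smash_one - P.smash_pow \<Gamma> N)"
    unfolding Y \<Gamma> D.smash_pow_y[OF H] l(1) D.smash_pow_g P.smash_one_def
    by (simp only: bilinear_simps[OF D.RH_tens] D.basis_facts(4))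
  (* In degree N/2 every value is a multiple of x, by the same ratio as in degree N. *)
  have van: "D.X a b = 0" if "odd N \<or> even N \<and> x = 0" "0 < a + b" "a + b < N" for a b
  proof (cases "2 * (a + b) = N \<and> a \<noteq> 0 \<and> b \<noteq> 0")
    case True
    then have "even N" by auto
    have N2: "1 \<le> a" "a < a + b" "b = a + b - a" "N div 2 = a + b" using True by auto
    have "sH (D.qfact a * D.qfact (a + b - a)) (D.X a (a + b - a))
        = sH (D.qfact (a + b - 1)) (D.X 1 (a + b - 1))"
    proof (rule D.X_ratio)
      fix i j k n assume "i < N" "j < N" "0 < i + j" "0 < k + n" "i + j + (k + n) = a + b"
      then have "D.X i j = 0" using True by (intro D.X_below(2)) auto
      then show "D.X i j * D.X k n = 0" by simp
    qed (use N2 that in auto)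
    also have "D.X 1 (a + b - 1) = 0" using that(1) x_eq N2 \<open>even N\<close> by auto
    finally show ?thesis using D.qfact_nonzero[of a] D.qfact_nonzero[of b] that by simp
  next
    case False
    show ?thesis
    proof (cases "a = 0 \<or> b = 0")
      case True
      then show ?thesis using that D.X_unit by auto
    next
      case nz: False
      then show ?thesis using False that by (intro D.X_below(2)) auto
    qed
  qed
  have xi_values: "\<xi> (P.m_pow y a) (P.m_pow y b) = (if a + b = 0 then 1
      else if a + b = N \<and> a \<noteq> 0 \<and> b \<noteq> 0 then sH l (1 - g ^ N) else 0)"
    if hyp: "odd N \<or> even N \<and> x = 0" for a b
  proof (cases "a < N \<and> b < N")
    case False
    then show ?thesis using D.R_zero_less D.qfact_eq_0 by (auto simp: D.xi_m_pow)
  next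
    case True
    consider "a = 0 \<or> b = 0" | "a \<noteq> 0" "b \<noteq> 0" "a + b < N" | "a \<noteq> 0" "b \<noteq> 0" "a + b = N" | "N < a + b"
      by linarith
    then show ?thesis
    proof cases
      case 1
      then show ?thesis using True by (auto simp: D.xi_m_pow D.X_unit D.qfact_simps)
    next
      case 2
      then show ?thesis using van[OF hyp, of a b] by (simp add: D.xi_m_pow)
    next
      case 3
      then have "b = N - a" by simp
      then show ?thesis using top[of a] 3 by (simp add: D.xi_m_pow)
    next
      case 4
      then show ?thesis using D.X_above[OF van[OF hyp], of a b] True by (auto simp: D.xi_m_pow)
    qed
  qed
  show ?thesis
  proof (intro exI[of _ l] conjI impI allI)
    fix a assume "1 \<le> a \<and> a \<le> N - 1"
    then have "1 \<le> a" "a < N" using D.R_zero_less by auto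
    then show "\<xi> (P.m_pow y a) (P.m_pow y (N - a)) = sH l (1 - g ^ N)"
      using top[of a] by (simp only: D.xi_m_pow)
  next
    show "P.compatible_datum N q g \<chi> l" using D.compatible[OF l] .
  next
    show "P.smash_pow Y N = tscale l (P.smash_one - P.smash_pow \<Gamma> N)" by (rule pow_Y)
  next
    fix a b assume "odd N \<or> even N \<and> x = 0"
    then show "\<xi> (P.m_pow y a) (P.m_pow y b) = (if a + b = 0 then 1
      else if a + b = N \<and> a \<noteq> 0 \<and> b \<noteq> 0 then sH l (1 - g ^ N) else 0)" by (rule xi_values)
  next
    assume hyp: "odd N \<or> even N \<and> x = 0"
    show "quantum_line sH \<Delta> \<epsilon>H S sR act \<rho> \<delta> \<epsilon> m u N q g \<chi> y"
      by (rule D.quantum_line_if_vanishing) (rule van[OF hyp])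
  next
    assume "even N \<and> (even (N div 2) \<or> cosemisimple sH \<Delta>)"
    then show "x = 0" using x_0 by blast
  qed
qed

end
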